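(* Let $\mathcal F$ be a transversely $C^0$ codimension $1$ totally umbilical foliation of $\mathbb H^n$ orthogonal to an arc-length parametrized geodesic line $\gamma:\mathbb R\to\mathbb H^n$. If for any $t\in\mathbb R$ the mean curvature of the leaf through $\gamma(t)$ (taken with orientation opposite to $\gamma$) is $h(t)$, then $|h|\le 1$ and there are $t_-,t_+\in[-\infty,+\infty]$ such that (i) $h|_{(-\infty,t_-]}\equiv -1$; (ii) the function $(-\operatorname{ath}\circ h)|_{(t_-,t_+)}$ is $1$-Lipschitz; (iii) $h|_{[t_+,+\infty)}\equiv 1$. Conversely, if $h:\mathbb R\to[-1,1]$ is a continuous function for which there are $t_-,t_+\in[-\infty,+\infty]$ satisfying (i), (ii), (iii), then $h$ is an umbilical route along any geodesic line in $\mathbb H^n$.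
   Context: $\mathbb H^n$ is the real hyperbolic space of constant curvature $-1$; in the half-space model it is $\Pi^{n,+}=\{x\in\mathbb R^n: x_n>0\}$ with metric $x_n^{-2}\langle\cdot,\cdot\rangle$ and ideal boundary $(\mathbb R^{n-1}\times\{0\})\cup\{\infty\}$. $\operatorname{ath}=(\tanh)^{-1}$, $\operatorname{ath}(t)=\ln\sqrt{\frac{1+t}{1-t}}$. Intervals $(-\infty,t_-]$ and $[t_+,+\infty)$ are taken within $\mathbb R$, so that for $t_-=-\infty$ (resp. $t_+=+\infty$) condition (i) (resp. (iii)) is empty. A generalized hypersphere is a complete hypersurface of $\mathbb H^n$ which is a horosphere, a totally geodesic hypersurface, or a hypersphere (a connected component of a set equidistant from a totally geodesic hypersurface). In the half-space model these are the nonempty intersections with $\Pi^{n,+}$ of spheres or hyperplanes meeting or tangent to the ideal boundary (tangency point removed; hyperplanes parallel to $\mathbb R^{n-1}\times\{0\}$ included as horospheres). A submanifold is totally umbilical if at each of its points all eigenvalues of the shape operator are equal; a totally umbilical foliation is a foliation all of whose leaves are totally umbilical. A foliation is orthogonal to a curve $\gamma$ if at each $\gamma(t)$ the leaf through $\gamma(t)$ is orthogonal to $\gamma'(t)$. Sign convention: the mean curvature of an oriented totally umbilical hypersurface with unit normal $N$ is the common eigenvalue of $X\mapsto\nabla_XN$; "orientation opposite to $\gamma$" means that at $\gamma(t)$ the unit normal of the leaf is $-\gamma'(t)$. Thus a horosphere centered at the ideal point $\gamma(+\infty)$ has mean curvature $+1$ and one centered at $\gamma(-\infty)$ has mean curvature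 $-1$. A function $h:\mathbb R\to\mathbb R$ is an umbilical route along an arc-length parametrized curve $\gamma:\mathbb R\to\mathbb H^n$ if the family $(L_t)_{t\in\mathbb R}$, where $L_t$ is the generalized hypersphere through $\gamma(t)$, orthogonal to $\gamma$ there and having mean curvature $h(t)$ (orientation opposite to $\gamma$), can be extended to a totally umbilical foliation of $\mathbb H^n$.
   Formalization: "1-Lipschitz" in (ii) is the one-sided bound u(t)-u(s) ≤ t-s for s ≤ t, u = -ath∘h (the two-sided claim fails: caps |x|²=(T-y)(y+T¹⁹), T=eᵗ, give h=tanh 9t); for n=2 totally umbilical also requires constant geodesic curvature. *)

theory Defs
  imports "HOL-Analysis.Analysis"
begin

(* Half-space model of hyperbolic n-space: R^n is the type 'a * real with R^(n-1) = 'a, so that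
   n = DIM('a) + 1 is an arbitrary dimension >= 2, and snd is the last coordinate. *)

definition halfspace :: "('a::euclidean_space \<times> real) set"
  where "halfspace = {p. 0 < snd p}"

definition hmetric :: "'a::euclidean_space \<times> real \<Rightarrow> 'a \<times> real \<Rightarrow> 'a \<times> real \<Rightarrow> real"
  where "hmetric p X Y = (X \<bullet> Y) / (snd p)\<^sup>2"

(* Levi-Civita derivative nabla_X Y at p, where DY is the Euclidean derivative of the field Y in
   the direction X.  It is the formula for the conformal metric exp(2 phi) <.,.>,
     D_X Y + (X phi) Y + (Y phi) X - <X,Y> grad phi,   with phi = - ln x_n.
   Only DY, not Y as a field, enters, so it also covers fields along curves and hypersurfaces.
   The two lemmas below (no torsion, compatibility with the metric) characterise it. *)
definition hnabla ::
    "'a::euclidean_space \<times> real \<Rightarrow> 'a \<times> real \<Rightarrow> 'a \<times> real \<Rightarrow> 'a \<times> real \<Rightarrow> 'a \<times> real"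
  where "hnabla p X Y DY =
    DY - (snd X / snd p) *\<^sub>R Y - (snd Y / snd p) *\<^sub>R X + ((X \<bullet> Y) / snd p) *\<^sub>R (0, 1)"

lemma hnabla_torsion_free: "hnabla p X Y DY - hnabla p Y X DX = DY - DX"
  by (simp add: hnabla_def inner_commute)

lemma hnabla_metric:
  fixes c Y Z :: "real \<Rightarrow> 'a::euclidean_space \<times> real"
  assumes c: "(c has_vector_derivative X) (at t)"
    and Y: "(Y has_vector_derivative DY) (at t)"
    and Z: "(Z has_vector_derivative DZ) (at t)"
    and pos: "c t \<in> halfspace"
  shows "((\<lambda>s. hmetric (c s) (Y s) (Z s)) has_real_derivative
            hmetric (c t) (hnabla (c t) X (Y t) DY) (Z t)
          + hmetric (c t) (Y t) (hnabla (c t) X (Z t) DZ)) (at t)"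
proof -
  have p: "snd (c t) > 0" using pos by (simp add: halfspace_def)
  have 1: "((\<lambda>s. snd (c s)) has_real_derivative snd X) (at t)"
    using bounded_linear.has_vector_derivative[OF bounded_linear_snd c]
    by (simp add: has_real_derivative_iff_has_vector_derivative)
  have 2: "((\<lambda>s. Y s \<bullet> Z s) has_real_derivative (Y t \<bullet> DZ + DY \<bullet> Z t)) (at t)"
    using bounded_bilinear.has_vector_derivative[OF bounded_bilinear_inner Y Z]
    by (simp add: has_real_derivative_iff_has_vector_derivative)
  have e: "(0, a) \<bullet> W = a * snd W" "W \<bullet> (0, a) = a * snd W" for W :: "'a \<times> real" and a
    by (simp_all add: inner_prod_def)
  show ?thesis
    unfolding hmetric_def
    apply (rule derivative_eq_intros 1 2 refl)+
    using p apply simp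
    using p by (simp add: hnabla_def inner_simps e inner_commute field_simps power2_eq_square)
qed

primrec Ck :: "nat \<Rightarrow> ('a::real_normed_vector \<Rightarrow> 'b::real_normed_vector) \<Rightarrow> bool"
  where
    "Ck 0 f \<longleftrightarrow> continuous_on UNIV f"
  | "Ck (Suc k) f \<longleftrightarrow>
       (\<forall>x. f differentiable (at x)) \<and> (\<forall>v. Ck k (\<lambda>x. frechet_derivative f (at x) v))"

definition smooth :: "('a::real_normed_vector \<Rightarrow> 'b::real_normed_vector) \<Rightarrow> bool"
  where "smooth f \<longleftrightarrow> (\<forall>k. Ck k f)"

definition geodesic_line :: "(real \<Rightarrow> 'a::euclidean_space \<times> real) \<Rightarrow> bool"
  where "geodesic_line \<gamma> \<longleftrightarrow> (\<exists>\<gamma>' \<gamma>''. \<forall>t.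
      \<gamma> t \<in> halfspace \<and>
      (\<gamma> has_vector_derivative \<gamma>' t) (at t) \<and>
      (\<gamma>' has_vector_derivative \<gamma>'' t) (at t) \<and>
      hmetric (\<gamma> t) (\<gamma>' t) (\<gamma>' t) = 1 \<and>
      hnabla (\<gamma> t) (\<gamma>' t) (\<gamma>' t) (\<gamma>'' t) = 0)"

(* A smooth immersion of R^(n-1) into the hyperbolic space, i.e. a parametrised piece of a
   hypersurface.  Notions for a hypersurface L (a leaf, possibly only injectively immersed) are
   expressed through the patches with image in L; for a leaf these are exactly the immersions of
   R^(n-1) into a single leaf. *)
definition patch :: "('a::euclidean_space \<Rightarrow> 'a \<times> real) \<Rightarrow> bool"
  where "patch r \<longleftrightarrow> smooth r \<and> range r \<subseteq> halfspace \<and>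
    (\<forall>x. inj (frechet_derivative r (at x)))"

definition patch_in :: "('a::euclidean_space \<Rightarrow> 'a \<times> real) \<Rightarrow> ('a \<times> real) set \<Rightarrow> bool"
  where "patch_in r L \<longleftrightarrow> patch r \<and> range r \<subseteq> L"

definition tangent_space ::
    "('a::euclidean_space \<times> real) set \<Rightarrow> 'a \<times> real \<Rightarrow> ('a \<times> real) set"
  where "tangent_space L p =
    {frechet_derivative r (at x) v | r x v. patch_in r L \<and> r x = p}"

definition unit_normal_field ::
    "('a::euclidean_space \<Rightarrow> 'a \<times> real) \<Rightarrow> ('a \<Rightarrow> 'a \<times> real) \<Rightarrow> bool"
  where "unit_normal_field r N \<longleftrightarrow> smooth N \<and>
    (\<forall>x. hmetric (r x) (N x) (N x) = 1 \<and>
         (\<forall>v. hmetric (r x) (N x) (frechet_derivative r (at x) v) = 0))"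

(* Eigenvalues at r x of the shape operator X |-> nabla_X N, with X = dr v. *)
definition shape_eigenvalues ::
    "('a::euclidean_space \<Rightarrow> 'a \<times> real) \<Rightarrow> ('a \<Rightarrow> 'a \<times> real) \<Rightarrow> 'a \<Rightarrow> real set"
  where "shape_eigenvalues r N x =
    {\<kappa>. \<exists>v. v \<noteq> 0 \<and>
       hnabla (r x) (frechet_derivative r (at x) v) (N x) (frechet_derivative N (at x) v)
         = \<kappa> *\<^sub>R frechet_derivative r (at x) v}"

(* For n = 2 the eigenvalue condition is void; as usual, an umbilical curve is then understood to
   be one of constant geodesic curvature (for n >= 3 constancy is automatic and not assumed). *)
definition totally_umbilical :: "('a::euclidean_space \<times> real) set \<Rightarrow> bool"
  where "totally_umbilical L \<longleftrightarrow> (\<forall>r N. patch_in r L \<and> unit_normal_field r N \<longrightarrow>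
    (\<forall>x. \<exists>\<kappa>. shape_eigenvalues r N x = {\<kappa>}) \<and>
    (DIM('a) = 1 \<longrightarrow> (\<exists>\<kappa>. \<forall>x. shape_eigenvalues r N x = {\<kappa>})))"

(* L has mean curvature \<kappa> at p for the orientation given by the unit normal \<nu> at p. *)
definition has_mean_curvature ::
    "('a::euclidean_space \<times> real) set \<Rightarrow> 'a \<times> real \<Rightarrow> 'a \<times> real \<Rightarrow> real \<Rightarrow> bool"
  where "has_mean_curvature L p \<nu> \<kappa> \<longleftrightarrow>
    (\<exists>r N x. patch_in r L \<and> unit_normal_field r N \<and> r x = p \<and> N x = \<nu> \<and>
             shape_eigenvalues r N x = {\<kappa>})"

(* A partition into leaves such that around every point there is a chart f = g^(-1) : U -> R^(n-1) x R
   in which the components of the intersections of the leaves with U are the plaques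
   {f_n = const}.  The chart is merely a homeomorphism (transversely C^0), but the plaques
   are smoothly immersed.  Leaves being path connected and their local components being path
   components amounts to leaves being the sets of points joined by chains of plaques. *)
definition foliation :: "('a::euclidean_space \<times> real) set set \<Rightarrow> bool"
  where "foliation \<F> \<longleftrightarrow>
    \<Union>\<F> = halfspace \<and> disjoint \<F> \<and>
    (\<forall>L\<in>\<F>. L \<noteq> {} \<and> path_connected L) \<and>
    (\<forall>p\<in>halfspace. \<exists>U g f. open U \<and> p \<in> U \<and> U \<subseteq> halfspace \<and>
       homeomorphism UNIV U g f \<and>
       (\<forall>s::real. patch (\<lambda>x. g (x, s))) \<and>
       (\<forall>L\<in>\<F>. \<forall>q\<in>L \<inter> U.
          path_component_set (L \<inter> U) q = range (\<lambda>x. g (x, snd (f q)))))"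

definition umbilical_foliation :: "('a::euclidean_space \<times> real) set set \<Rightarrow> bool"
  where "umbilical_foliation \<F> \<longleftrightarrow> foliation \<F> \<and> (\<forall>L\<in>\<F>. totally_umbilical L)"

definition orthogonal_at ::
    "('a::euclidean_space \<times> real) set \<Rightarrow> 'a \<times> real \<Rightarrow> 'a \<times> real \<Rightarrow> bool"
  where "orthogonal_at L p w \<longleftrightarrow> (\<forall>X\<in>tangent_space L p. hmetric p X w = 0)"

definition orthogonal_foliation ::
    "('a::euclidean_space \<times> real) set set \<Rightarrow> (real \<Rightarrow> 'a \<times> real) \<Rightarrow> bool"
  where "orthogonal_foliation \<F> \<gamma> \<longleftrightarrow>
    (\<forall>t. \<forall>L\<in>\<F>. \<gamma> t \<in> L \<longrightarrow> orthogonal_at L (\<gamma> t) (vector_derivative \<gamma> (at t)))"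

(* Tangency to the ideal boundary is the case where the sphere meets {x_n = 0} in one point,
   which is not in the half-space.  Hyperplanes always meet or touch the ideal boundary (those
   parallel to {x_n = 0} at infinity). *)
definition generalized_hypersphere :: "('a::euclidean_space \<times> real) set \<Rightarrow> bool"
  where "generalized_hypersphere S \<longleftrightarrow> S \<noteq> {} \<and>
    ((\<exists>c r. 0 < r \<and> sphere c r \<inter> {p. snd p = 0} \<noteq> {} \<and> S = sphere c r \<inter> halfspace) \<or>
     (\<exists>a b. a \<noteq> 0 \<and> S = {p. a \<bullet> p = b} \<inter> halfspace))"

definition umbilical_route ::
    "(real \<Rightarrow> real) \<Rightarrow> (real \<Rightarrow> 'a::euclidean_space \<times> real) \<Rightarrow> bool"
  where "umbilical_route h \<gamma> \<longleftrightarrow>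
    (\<exists>L. (\<forall>t. generalized_hypersphere (L t) \<and> \<gamma> t \<in> L t \<and>
            orthogonal_at (L t) (\<gamma> t) (vector_derivative \<gamma> (at t)) \<and>
            has_mean_curvature (L t) (\<gamma> t) (- vector_derivative \<gamma> (at t)) (h t)) \<and>
         (\<exists>\<F>. umbilical_foliation \<F> \<and> range L \<subseteq> \<F>))"

(* "1-Lipschitz" for u = - artanh o h is the one-sided bound u t - u s <= t - s for s <= t.
   It is the only possible reading: with the two-sided bound on an interval with a finite end
   point, h would jump there, and the necessity statement would fail.  For instance, the caps
     |x|^2 + y^2 + (exp (19 t) - exp t) y = exp (20 t),   y > 0,
   through (0, exp t) foliate the half-space, are orthogonal to t |-> (0, exp t) and have
   mean curvature h t = tanh (9 t).
   The middle condition makes artanh o h meaningful (artanh 1 and artanh (-1) are junk). *)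
definition route_condition :: "(real \<Rightarrow> real) \<Rightarrow> ereal \<Rightarrow> ereal \<Rightarrow> bool"
  where "route_condition h t\<^sub>1 t\<^sub>2 \<longleftrightarrow>
    (\<forall>t. ereal t \<le> t\<^sub>1 \<longrightarrow> h t = -1) \<and>
    (\<forall>t. t\<^sub>1 < ereal t \<and> ereal t < t\<^sub>2 \<longrightarrow> \<bar>h t\<bar> < 1) \<and>
    (\<forall>s t. t\<^sub>1 < ereal s \<and> s \<le> t \<and> ereal t < t\<^sub>2 \<longrightarrow>
        (- artanh (h t)) - (- artanh (h s)) \<le> t - s) \<and>
    (\<forall>t. t\<^sub>2 \<le> ereal t \<longrightarrow> h t = 1)"

end

theory Submission
  imports Defs
begin

text \<open>
The proof turns hyperspheres into lines in a plane.

A piece of a totally umbilical hypersurface has a Euclidean unit normal \<open>M\<close> whose derivative is a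
constant multiple \<open>l\<close> of the derivative of the position, so it lies in a Euclidean sphere or hyperplane
(\<open>umbilic_patch_in_gsphere\<close>); its hyperbolic mean curvature is \<open>l x\<^sub>n - M\<^sub>n\<close>. A leaf of an umbilical
foliation lies in a single such sphere, since the spheres carrying overlapping plaques coincide
(\<open>leaf_in_gsphere\<close>). By invariance of domain the leaf is open in that sphere, and it is closed
there because a limit of plaques is a plaque; so a path in the sphere inside the half-space that
starts in the leaf stays in it (\<open>path_stays_in_leaf\<close>).

In the hyperboloid model the geodesic is \<open>e\<^sup>t A + e\<^sup>-\<^sup>t B\<close> with null vectors \<open>A\<close> and \<open>B\<close>. The products of
a point with \<open>2 B\<close> and \<open>2 A\<close> are two positive functions \<open>u\<close> and \<open>v\<close> with \<open>u v \<ge> 1\<close>, and the geodesic is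
the set where \<open>u v = 1\<close>, with \<open>u = e\<^sup>t\<close> at time \<open>t\<close>. The hypersphere orthogonal to the geodesic at time
\<open>t\<close> with mean curvature \<open>h\<close> has the equation (\<open>tsphere_iff\<close>)

  \<open>(1 - h) (e\<^sup>-\<^sup>t u - 1) = (1 + h) (e\<^sup>t v - 1)\<close>.

So it is the preimage of a line through the point \<open>(e\<^sup>t, e\<^sup>-\<^sup>t)\<close> of the hyperbola; for \<open>|h| \<le> 1\<close> the part
with \<open>u v \<ge> 1\<close> is the ray from that point in the direction \<open>((1 + h) e\<^sup>t, (1 - h) e\<^sup>-\<^sup>t)\<close>, whose slope is
\<open>exp (- 2 (t + artanh h))\<close>. Rays that start at different points of the hyperbola are disjoint if and
only if their slopes do not increase, i.e. if \<open>t + artanh (h t)\<close> is nondecreasing. With the values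
\<open>-\<infinity>\<close> and \<open>\<infinity>\<close> for \<open>h = -1\<close> and \<open>h = 1\<close>, this is the route condition.

For the necessity, the leaves through the geodesic are the full preimages of their rays, hence the
rays are pairwise disjoint (\<open>rays_monotone_slopes\<close>); \<open>h\<close> is continuous because nearby plaques are
close, and \<open>|h| > 1\<close> is impossible because the line would meet the hyperbola twice and cut a ray that
starts between the two points (\<open>rays_slope_le_1\<close>). For the sufficiency, the rays are disjoint, and by
the intermediate value theorem they cover the whole region, so the hyperspheres through the geodesic
already form the foliation. Fermi coordinates give one global chart for it
(\<open>leaves_foliation\<close>).
\<close>

section \<open>Smooth maps\<close>

abbreviation D :: "('a::real_normed_vector \<Rightarrow> 'b::real_normed_vector) \<Rightarrow> 'a \<Rightarrow> 'a \<Rightarrow> 'b"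
  where "D f x v \<equiv> frechet_derivative f (at x) v"

lemma Ck_SucD:
  assumes "Ck (Suc k) f"
  shows "f differentiable (at x)" "Ck k (\<lambda>x. D f x v)"
  using assms by auto

lemma Ck_SucI:
  assumes "\<And>x. (f has_derivative f' x) (at x)" "\<And>v. Ck k (\<lambda>x. f' x v)"
  shows "Ck (Suc k) f"
proof -
  have "D f x = f' x" for x
    using assms(1) frechet_derivative_at by metis
  then show ?thesis using assms by (auto simp: differentiable_def)
qed

lemma Ck_Suc_has_derivative:
  assumes "Ck (Suc k) f"
  shows "(f has_derivative D f x) (at x)"
  using assms by (simp add: frechet_derivative_works)

text \<open>The predicate \<open>Ck (Suc k)\<close> does not mention continuity of \<open>f\<close> itself; it follows from
differentiability. The inductions for products and compositions need this step, since the derivative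
of a product contains the undifferentiated factors.\<close>

lemma Ck_decrease: "Ck (Suc k) f \<Longrightarrow> Ck k f"
proof (induction k arbitrary: f)
  case 0
  then show ?case
    by (simp add: continuous_at_imp_continuous_on differentiable_imp_continuous_within)
next
  case (Suc k)
  then show ?case by (metis Ck.simps(2))
qed

lemma Ck_const: "Ck k (\<lambda>x. c)"
proof (induction k arbitrary: c)
  case 0
  then show ?case by simp
next
  case (Suc k)
  then show ?case by (intro Ck_SucI[where f' = "\<lambda>x v. 0"]) auto
qed

lemma Ck_linear_compose:
  assumes "bounded_linear L" "Ck k f"
  shows "Ck k (\<lambda>x. L (f x))"
  using assms(2)
proof (induction k arbitrary: f)
  case 0
  then show ?case
    using assms(1) by (auto intro: continuous_intros linear_continuous_on bounded_linear.continuous_on)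
next
  case (Suc k)
  show ?case
    by (rule Ck_SucI[OF bounded_linear.has_derivative[OF assms(1) Ck_Suc_has_derivative[OF Suc.prems]]])
      (rule Suc.IH[OF Ck_SucD(2)[OF Suc.prems]])
qed

lemma Ck_add:
  assumes "Ck k f" "Ck k g"
  shows "Ck k (\<lambda>x. f x + g x)"
  using assms
proof (induction k arbitrary: f g)
  case 0
  then show ?case by (auto intro: continuous_intros)
next
  case (Suc k)
  show ?case
    by (rule Ck_SucI[OF has_derivative_add[OF Ck_Suc_has_derivative[OF Suc.prems(1)]
            Ck_Suc_has_derivative[OF Suc.prems(2)]]])
      (rule Suc.IH[OF Ck_SucD(2)[OF Suc.prems(1)] Ck_SucD(2)[OF Suc.prems(2)]])
qed

lemma Ck_sum:
  assumes "\<And>i. i \<in> I \<Longrightarrow> Ck k (f i)"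
  shows "Ck k (\<lambda>x. \<Sum>i\<in>I. f i x)"
  using assms
proof (induction I rule: infinite_finite_induct)
  case (insert i I)
  then show ?case by (simp add: Ck_add)
qed (simp_all add: Ck_const)

lemma Ck_bilinear:
  assumes "bounded_bilinear B" "Ck k f" "Ck k g"
  shows "Ck k (\<lambda>x. B (f x) (g x))"
  using assms(2,3)
proof (induction k arbitrary: f g)
  case 0
  then show ?case
    by (auto intro: bounded_bilinear.continuous_on[OF assms(1)])
next
  case (Suc k)
  show ?case
    by (rule Ck_SucI[OF bounded_bilinear.FDERIV[OF assms(1) Ck_Suc_has_derivative[OF Suc.prems(1)]
            Ck_Suc_has_derivative[OF Suc.prems(2)]]])
      (rule Ck_add[OF Suc.IH[OF Ck_decrease[OF Suc.prems(1)] Ck_SucD(2)[OF Suc.prems(2)]]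
          Suc.IH[OF Ck_SucD(2)[OF Suc.prems(1)] Ck_decrease[OF Suc.prems(2)]]])
qed

lemma Ck_inverse:
  fixes q :: "'a::real_normed_vector \<Rightarrow> real"
  assumes "\<And>x. q x \<noteq> 0" "Ck k q"
  shows "Ck k (\<lambda>x. inverse (q x))"
  using assms(2)
proof (induction k)
  case 0
  then show ?case using assms(1) by (auto intro!: continuous_intros)
next
  case (Suc k)
  have I: "Ck k (\<lambda>x. inverse (q x))" using Suc.IH Ck_decrease[OF Suc.prems] by simp
  have 1: "((\<lambda>x. inverse (q x)) has_derivative
      (\<lambda>v. - (inverse (q x) * D q x v * inverse (q x)))) (at x)" for x
    by (rule Deriv.has_derivative_inverse[OF assms(1) Ck_Suc_has_derivative[OF Suc.prems]])
  have 2: "Ck k (\<lambda>x. - (inverse (q x) * D q x v * inverse (q x)))" for v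
    by (intro Ck_linear_compose[OF bounded_linear_minus[OF bounded_linear_ident]]
        Ck_bilinear[OF bounded_bilinear_mult] I Ck_SucD(2)[OF Suc.prems])
  show ?case by (rule Ck_SucI[OF 1 2])
qed

lemma Ck_sqrt:
  assumes "\<And>x. q x > 0" "Ck k q"
  shows "Ck k (\<lambda>x. sqrt (q x))"
  using assms(2)
proof (induction k)
  case 0
  then show ?case using assms(1) by (auto intro!: continuous_intros)
next
  case (Suc k)
  have I: "Ck k (\<lambda>x. inverse (sqrt (q x)))"
    using Suc.IH Ck_decrease[OF Suc.prems] assms(1) by (intro Ck_inverse) (auto simp: less_imp_neq[symmetric])
  have 1: "((\<lambda>x. sqrt (q x)) has_derivative
      (\<lambda>v. D q x v * (inverse (sqrt (q x)) / 2))) (at x)" for x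
    using has_derivative_compose[OF Ck_Suc_has_derivative[OF Suc.prems]
        DERIV_real_sqrt[OF assms(1), unfolded has_field_derivative_def]]
    by (simp add: o_def mult.commute)
  have 2: "Ck k (\<lambda>x. D q x v * (inverse (sqrt (q x)) / 2))" for v
    by (rule Ck_bilinear[OF bounded_bilinear_mult Ck_SucD(2)[OF Suc.prems]
          Ck_linear_compose[OF bounded_linear_divide I]])
  show ?case by (rule Ck_SucI[OF 1 2])
qed

text \<open>The chain rule gives \<open>D f (g x) (D g x v)\<close>, where the direction depends on \<open>x\<close>. Expanding the
direction in the standard basis turns this into a finite sum of products of functions to which the
induction hypothesis applies.\<close>

lemma Ck_compose:
  fixes f :: "'b::euclidean_space \<Rightarrow> 'c::real_normed_vector"
  assumes "Ck k f" "Ck k g"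
  shows "Ck k (\<lambda>x. f (g x))"
  using assms
proof (induction k arbitrary: f)
  case 0
  then show ?case by (auto intro: continuous_on_compose2)
next
  case (Suc k)
  note f' = Ck_Suc_has_derivative[OF Suc.prems(1)]
  have 1: "((\<lambda>x. f (g x)) has_derivative
      (\<lambda>v. D f (g x) (D g x v))) (at x)" for x
    by (rule has_derivative_compose[OF Ck_Suc_has_derivative[OF Suc.prems(2)] f'])
  have 2: "Ck k (\<lambda>x. D f (g x) (D g x v))" for v
  proof -
    have rep: "D f (g x) w
        = (\<Sum>b\<in>Basis. (w \<bullet> b) *\<^sub>R D f (g x) b)" for x w
    proof -
      note l = has_derivative_linear[OF f', of "g x"]
      have "D f (g x) w
          = D f (g x) (\<Sum>b\<in>Basis. (w \<bullet> b) *\<^sub>R b)"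
        by (simp only: euclidean_representation)
      also have "\<dots> = (\<Sum>b\<in>Basis. (w \<bullet> b) *\<^sub>R D f (g x) b)"
        by (simp only: linear_sum[OF l] linear_scale[OF l] o_def)
      finally show ?thesis .
    qed
    have "(\<lambda>x. D f (g x) (D g x v))
        = (\<lambda>x. \<Sum>b\<in>Basis. (D g x v \<bullet> b)
            *\<^sub>R D f (g x) b)"
      by (rule ext) (rule rep)
    moreover have "Ck k \<dots>"
      by (rule Ck_sum, rule Ck_bilinear[OF bounded_bilinear_scaleR
            Ck_linear_compose[OF bounded_linear_inner_left Ck_SucD(2)[OF Suc.prems(2)]]
            Suc.IH[OF Ck_SucD(2)[OF Suc.prems(1)] Ck_decrease[OF Suc.prems(2)]]])
    ultimately show ?thesis by metis
  qed
  show ?case by (rule Ck_SucI[OF 1 2])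
qed

lemma smooth_const: "smooth (\<lambda>x. c)"
  by (simp add: smooth_def Ck_const)

lemma smooth_linear_compose: "bounded_linear L \<Longrightarrow> smooth f \<Longrightarrow> smooth (\<lambda>x. L (f x))"
  by (simp add: smooth_def Ck_linear_compose)

lemma smooth_bilinear:
  "bounded_bilinear B \<Longrightarrow> smooth f \<Longrightarrow> smooth g \<Longrightarrow> smooth (\<lambda>x. B (f x) (g x))"
  by (simp add: smooth_def Ck_bilinear)

lemma smooth_ident: "smooth (\<lambda>x::'a::real_normed_vector. x)"
proof -
  have "Ck k (\<lambda>x::'a. x)" for k
  proof (induction k)
    case (Suc k)
    show ?case by (rule Ck_SucI[OF has_derivative_ident]) (rule Ck_const)
  qed simp
  then show ?thesis by (simp add: smooth_def)
qed

lemma smooth_linear: "bounded_linear L \<Longrightarrow> smooth L"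
  using smooth_linear_compose[OF _ smooth_ident] .

lemma smooth_add: "smooth f \<Longrightarrow> smooth g \<Longrightarrow> smooth (\<lambda>x. f x + g x)"
  by (simp add: smooth_def Ck_add)

lemma smooth_minus: "smooth f \<Longrightarrow> smooth (\<lambda>x. - f x)"
  by (rule smooth_linear_compose[OF bounded_linear_minus[OF bounded_linear_ident]])

lemma smooth_diff: "smooth f \<Longrightarrow> smooth g \<Longrightarrow> smooth (\<lambda>x. f x - g x)"
  using smooth_add[OF _ smooth_minus, of f g] by simp

lemmas smooth_scaleR = smooth_bilinear[OF bounded_bilinear_scaleR]
lemmas smooth_inner = smooth_bilinear[OF bounded_bilinear_inner]

lemma smooth_mult: "smooth f \<Longrightarrow> smooth g \<Longrightarrow> smooth (\<lambda>x. f x * g x :: real)"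
  by (rule smooth_bilinear[OF bounded_bilinear_mult])

lemma smooth_inverse:
  "(\<And>x. q x \<noteq> 0) \<Longrightarrow> smooth q \<Longrightarrow> smooth (\<lambda>x. inverse (q x) :: real)"
  by (simp add: smooth_def Ck_inverse)

lemma smooth_divide:
  "(\<And>x. q x \<noteq> 0) \<Longrightarrow> smooth f \<Longrightarrow> smooth q \<Longrightarrow> smooth (\<lambda>x. f x / q x :: real)"
  unfolding divide_inverse by (intro smooth_mult smooth_inverse)

lemma smooth_sqrt: "(\<And>x. q x > 0) \<Longrightarrow> smooth q \<Longrightarrow> smooth (\<lambda>x. sqrt (q x))"
  by (simp add: smooth_def Ck_sqrt)

lemma smooth_compose:
  fixes f :: "'b::euclidean_space \<Rightarrow> 'c::real_normed_vector"
  shows "smooth f \<Longrightarrow> smooth g \<Longrightarrow> smooth (\<lambda>x. f (g x))"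
  by (simp add: smooth_def Ck_compose)

lemma smooth_snd: "smooth f \<Longrightarrow> smooth (\<lambda>x. snd (f x))"
  by (rule smooth_linear_compose[OF bounded_linear_snd])

lemma smooth_fst: "smooth f \<Longrightarrow> smooth (\<lambda>x. fst (f x))"
  by (rule smooth_linear_compose[OF bounded_linear_fst])

lemma smooth_Pair:
  fixes f :: "_ \<Rightarrow> 'b::real_normed_vector" and g :: "_ \<Rightarrow> 'c::real_normed_vector"
  assumes "smooth f" "smooth g"
  shows "smooth (\<lambda>x. (f x, g x))"
proof -
  have "bounded_linear (\<lambda>y::'b. (y, 0::'c))" "bounded_linear (\<lambda>y::'c. (0::'b, y))"
    by (auto intro: bounded_linear_Pair bounded_linear_ident bounded_linear_zero)
  from smooth_add[OF smooth_linear_compose[OF this(1) assms(1)] smooth_linear_compose[OF this(2) assms(2)]]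
  show ?thesis by simp
qed

lemma smooth_continuous: "smooth f \<Longrightarrow> continuous_on S f"
  unfolding smooth_def by (metis Ck.simps(1) continuous_on_subset subset_UNIV)

lemma smooth_has_derivative:
  "smooth f \<Longrightarrow> (f has_derivative D f x) (at x within S)"
  unfolding smooth_def using Ck_Suc_has_derivative has_derivative_at_withinI by blast

lemma smooth_frechet_derivative: "smooth f \<Longrightarrow> smooth (\<lambda>x. D f x v)"
  unfolding smooth_def using Ck_SucD(2) by blast

text \<open>The mixed second difference of \<open>f\<close> over a parallelogram with sides \<open>h v\<close> and \<open>h w\<close> is
  \<open>h\<^sup>2\<close> times a value of either mixed derivative inside the parallelogram, by two applications of
  the mean value theorem; letting \<open>h\<close> tend to \<open>0\<close> identifies the two mixed derivatives.\<close>

lemma mixed_difference_mean_value: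
  fixes f :: "'a::real_normed_vector \<Rightarrow> real"
  assumes "smooth f" "h > 0"
  obtains a b where "0 < a" "a < h" "0 < b" "b < h"
    "f (x + h *\<^sub>R v + h *\<^sub>R w) - f (x + h *\<^sub>R v) - f (x + h *\<^sub>R w) + f x
      = h\<^sup>2 * D (\<lambda>y. D f y v) (x + a *\<^sub>R v + b *\<^sub>R w) w"
proof -
  have line: "((\<lambda>s. g (p + s *\<^sub>R z)) has_real_derivative D g (p + s *\<^sub>R z) z) (at s)"
    if "smooth g" for g :: "'a \<Rightarrow> real" and p z s
  proof -
    have 1: "((\<lambda>s. p + s *\<^sub>R z) has_derivative (\<lambda>u. u *\<^sub>R z)) (at s)"
      by (auto intro!: derivative_eq_intros)
    have "((\<lambda>s. g (p + s *\<^sub>R z)) has_derivative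
        (\<lambda>u. D g (p + s *\<^sub>R z) (u *\<^sub>R z))) (at s)"
      by (rule has_derivative_compose[OF 1 smooth_has_derivative[OF that]])
    then show ?thesis
      using linear_scale[OF has_derivative_linear[OF smooth_has_derivative[OF that]]]
      by (simp add: has_field_derivative_def mult.commute[of _ "D g (p + s *\<^sub>R z) z"])
  qed
  define fd where "fd y = D f y v" for y
  have fd: "smooth fd" unfolding fd_def by (rule smooth_frechet_derivative[OF assms(1)])
  let ?\<psi> = "\<lambda>s. f ((x + h *\<^sub>R w) + s *\<^sub>R v) - f (x + s *\<^sub>R v)"
  have "(?\<psi> has_real_derivative (fd ((x + h *\<^sub>R w) + s *\<^sub>R v) - fd (x + s *\<^sub>R v))) (at s)" for s
    unfolding fd_def by (intro DERIV_diff line assms)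
  from MVT2[of 0 h ?\<psi>, OF assms(2) this] obtain a where a: "0 < a" "a < h"
    "?\<psi> h - ?\<psi> 0 = h * (fd ((x + h *\<^sub>R w) + a *\<^sub>R v) - fd (x + a *\<^sub>R v))" by auto
  let ?\<chi> = "\<lambda>s. fd ((x + a *\<^sub>R v) + s *\<^sub>R w)"
  have "(?\<chi> has_real_derivative D fd (x + a *\<^sub>R v + s *\<^sub>R w) w) (at s)" for s
    by (rule line[OF fd])
  from MVT2[of 0 h ?\<chi>, OF assms(2) this] obtain b where b: "0 < b" "b < h"
    "?\<chi> h - ?\<chi> 0 = h * D fd (x + a *\<^sub>R v + b *\<^sub>R w) w" by auto
  have "x + h *\<^sub>R w + a *\<^sub>R v = x + a *\<^sub>R v + h *\<^sub>R w" "x + h *\<^sub>R w + h *\<^sub>R v = x + h *\<^sub>R v + h *\<^sub>R w"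
    by (simp_all add: algebra_simps)
  with a(3) b(3) have "f (x + h *\<^sub>R v + h *\<^sub>R w) - f (x + h *\<^sub>R v) - f (x + h *\<^sub>R w) + f x
      = h * (h * D fd (x + a *\<^sub>R v + b *\<^sub>R w) w)"
    by simp
  with that[OF a(1,2) b(1,2)] show ?thesis by (simp add: fd_def[abs_def] power2_eq_square)
qed

lemma mixed_derivatives_commute_real:
  fixes f :: "'a::real_normed_vector \<Rightarrow> real"
  assumes "smooth f"
  shows "D (\<lambda>y. D f y v) x w
       = D (\<lambda>y. D f y w) x v"
    (is "?F x = ?G x")
proof -
  define h :: "nat \<Rightarrow> real" where "h n = inverse (real (Suc n))" for n
  have h: "h n > 0" for n by (simp add: h_def)
  have h0: "h \<longlonglongrightarrow> 0" unfolding h_def by (rule LIMSEQ_inverse_real_of_nat)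
  let ?\<Delta> = "\<lambda>n v w. f (x + h n *\<^sub>R v + h n *\<^sub>R w) - f (x + h n *\<^sub>R v) - f (x + h n *\<^sub>R w) + f x"
  have "\<forall>n. \<exists>a b. 0 < a \<and> a < h n \<and> 0 < b \<and> b < h n \<and> ?\<Delta> n v w = (h n)\<^sup>2 * ?F (x + a *\<^sub>R v + b *\<^sub>R w)"
    using mixed_difference_mean_value[OF assms h] by metis
  then obtain a b where ab: "\<And>n. 0 < a n \<and> a n < h n \<and> 0 < b n \<and> b n < h n
      \<and> ?\<Delta> n v w = (h n)\<^sup>2 * ?F (x + a n *\<^sub>R v + b n *\<^sub>R w)" by metis
  have "\<forall>n. \<exists>a b. 0 < a \<and> a < h n \<and> 0 < b \<and> b < h n \<and> ?\<Delta> n w v = (h n)\<^sup>2 * ?G (x + a *\<^sub>R w + b *\<^sub>R v)"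
    using mixed_difference_mean_value[OF assms h] by metis
  then obtain c d where cd: "\<And>n. 0 < c n \<and> c n < h n \<and> 0 < d n \<and> d n < h n
      \<and> ?\<Delta> n w v = (h n)\<^sup>2 * ?G (x + c n *\<^sub>R w + d n *\<^sub>R v)" by metis
  have z: "k \<longlonglongrightarrow> 0" if "\<And>n. 0 < k n \<and> k n < h n" for k
    by (rule tendsto_sandwich[OF _ _ tendsto_const h0]) (use that in \<open>auto intro!: always_eventually less_imp_le\<close>)
  have cont: "isCont ?F y" "isCont ?G y" for y
    using smooth_continuous[OF smooth_frechet_derivative[OF smooth_frechet_derivative[OF assms]], of UNIV]
    by (auto simp: continuous_on_eq_continuous_at)
  have lim: "(\<lambda>n. x + p n *\<^sub>R v' + q n *\<^sub>R w') \<longlonglongrightarrow> x" if "p \<longlonglongrightarrow> 0" "q \<longlonglongrightarrow> 0" for p q v' w'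
    using tendsto_add[OF tendsto_add[OF tendsto_const tendsto_scaleR[OF that(1) tendsto_const]]
        tendsto_scaleR[OF that(2) tendsto_const], of x v' w'] by simp
  have "(\<lambda>n. ?F (x + a n *\<^sub>R v + b n *\<^sub>R w)) \<longlonglongrightarrow> ?F x"
    by (rule isCont_tendsto_compose[OF cont(1)], rule lim; rule z; use ab in blast)
  moreover have "(\<lambda>n. ?G (x + c n *\<^sub>R w + d n *\<^sub>R v)) \<longlonglongrightarrow> ?G x"
    by (rule isCont_tendsto_compose[OF cont(2)], rule lim; rule z; use cd in blast)
  moreover have "?F (x + a n *\<^sub>R v + b n *\<^sub>R w) = ?G (x + c n *\<^sub>R w + d n *\<^sub>R v)" for n
  proof -
    have swap: "x + h n *\<^sub>R w + h n *\<^sub>R v = x + h n *\<^sub>R v + h n *\<^sub>R w"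
      by (simp only: ac_simps)
    have "?\<Delta> n w v = ?\<Delta> n v w" unfolding swap by simp
    then show ?thesis using ab[of n] cd[of n] h[of n] by simp
  qed
  ultimately show ?thesis using LIMSEQ_unique by simp
qed

lemma frechet_derivative_inner_left:
  assumes "smooth f"
  shows "D (\<lambda>y. f y \<bullet> b) x v = D f x v \<bullet> b"
  using frechet_derivative_at[OF has_derivative_inner_left[OF smooth_has_derivative[OF assms]]]
  by metis

lemma mixed_derivatives_commute:
  fixes f :: "'a::real_normed_vector \<Rightarrow> 'b::euclidean_space"
  assumes "smooth f"
  shows "D (\<lambda>y. D f y v) x w
       = D (\<lambda>y. D f y w) x v"
proof (rule euclidean_eqI)
  fix b :: 'b
  have "smooth (\<lambda>y. f y \<bullet> b)" by (rule smooth_inner[OF assms smooth_const])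
  from mixed_derivatives_commute_real[OF this, of v x w]
  show "D (\<lambda>y. D f y v) x w \<bullet> b
      = D (\<lambda>y. D f y w) x v \<bullet> b"
    by (simp add: frechet_derivative_inner_left assms smooth_frechet_derivative)
qed

lemma derivative_of_locally_constant:
  assumes "(f has_derivative f') (at x)" "open T" "x \<in> T" "\<And>y. y \<in> T \<Longrightarrow> f y = c"
  shows "f' v = 0"
proof -
  have "(f has_derivative (\<lambda>v. 0)) (at x)"
    by (rule has_derivative_transform_within_open[OF has_derivative_const assms(2,3)])
      (simp add: assms(4))
  then show ?thesis using has_derivative_unique[OF assms(1)] by metis
qed

section \<open>Generalised spheres\<close>

text \<open>The Euclidean sphere (for \<open>l = 0\<close>, the hyperplane) through \<open>p\<close> with unit normal \<open>m\<close> at \<open>p\<close> and Euclidean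
curvature \<open>l\<close>. In this form spheres and hyperplanes need no case distinction: the unit normal at \<open>q\<close>
is \<open>m + l (q - p)\<close>, and \<open>(m, l)\<close> and \<open>(- m, - l)\<close> give the same set.\<close>

definition gsphere :: "'b::real_inner \<Rightarrow> 'b \<Rightarrow> real \<Rightarrow> 'b set"
  where "gsphere p m l = {q. 2 * (m \<bullet> (q - p)) + l * ((q - p) \<bullet> (q - p)) = 0}"

lemma gsphere_base: "p \<in> gsphere p m l"
  by (simp add: gsphere_def)

lemma gsphere_normal_unit:
  assumes "m \<bullet> m = 1" "q \<in> gsphere p m l"
  shows "(m + l *\<^sub>R (q - p)) \<bullet> (m + l *\<^sub>R (q - p)) = 1"
proof -
  have "(m + l *\<^sub>R (q - p)) \<bullet> (m + l *\<^sub>R (q - p))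
      = m \<bullet> m + l * (2 * (m \<bullet> (q - p)) + l * ((q - p) \<bullet> (q - p)))"
    by (simp add: inner_simps inner_commute algebra_simps)
  then show ?thesis using assms by (simp add: gsphere_def)
qed

text \<open>The equation with respect to \<open>q\<close> is the equation with respect to \<open>p\<close> minus its value at \<open>q\<close>.\<close>

lemma gsphere_rebase:
  assumes "q \<in> gsphere p m l"
  shows "gsphere q (m + l *\<^sub>R (q - p)) l = gsphere p m l"
proof -
  have "2 * ((m + l *\<^sub>R (q - p)) \<bullet> (z - q)) + l * ((z - q) \<bullet> (z - q))
      = (2 * (m \<bullet> (z - p)) + l * ((z - p) \<bullet> (z - p)))
        - (2 * (m \<bullet> (q - p)) + l * ((q - p) \<bullet> (q - p)))" for z
  proof -
    have "z - q = (z - p) - (q - p)" by simp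
    then show ?thesis
      by (simp only:) (simp add: inner_simps inner_commute algebra_simps)
  qed
  then show ?thesis using assms by (simp add: gsphere_def)
qed

lemma gsphere_minus: "gsphere p (- m) (- l) = gsphere p m l"
proof -
  have "2 * (- m \<bullet> (q - p)) + - l * ((q - p) \<bullet> (q - p))
      = - (2 * (m \<bullet> (q - p)) + l * ((q - p) \<bullet> (q - p)))" for q
    by simp
  then show ?thesis unfolding gsphere_def by (metis neg_equal_0_iff_equal)
qed

text \<open>Two generalised spheres that are tangent at \<open>p\<close> differ, as functions, by a multiple of the squared
distance from \<open>p\<close>; so one further common point identifies them.\<close>

lemma gsphere_tangent_unique:
  assumes "q \<in> gsphere p m l" "q \<in> gsphere p m l'" "q \<noteq> p"
  shows "l = l'"
proof -
  have "(l - l') * ((q - p) \<bullet> (q - p)) = 0"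
    using assms(1,2) by (simp add: gsphere_def algebra_simps)
  then show ?thesis using assms(3) by simp
qed

lemma closed_gsphere: "closed (gsphere p m l)"
  unfolding gsphere_def by (intro closed_Collect_eq continuous_intros)

section \<open>Umbilical patches\<close>

text \<open>The orthogonal complement of a tangent hyperplane is a line.\<close>

lemma normal_line_unique:
  fixes L :: "'a::euclidean_space \<Rightarrow> 'a \<times> real"
  assumes "linear L" "inj L" "m \<noteq> 0" "\<And>v. m \<bullet> L v = 0" "\<And>v. z \<bullet> L v = 0"
  obtains k where "z = k *\<^sub>R m"
proof -
  let ?T = "{y \<in> UNIV. \<forall>x\<in>range L. orthogonal x y}"
  have "dim (range L) = DIM('a)"
    using dim_image_eq[of L UNIV] assms(1,2) by (simp add: dim_UNIV)
  moreover have "subspace (range L)"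
    using assms(1) by (simp add: linear_subspace_image)
  ultimately have "dim ?T = 1"
    using dim_subspace_orthogonal_to_vectors[of "range L" UNIV] by (simp add: dim_UNIV)
  moreover have "dim (span {m}) = 1" using assms(3) by (simp add: dim_insert)
  moreover have sub: "subspace ?T"
    by (auto simp: subspace_def orthogonal_def inner_add_right)
  moreover have "span {m} \<subseteq> ?T"
    by (rule span_minimal[OF _ sub]) (use assms(4) in \<open>auto simp: orthogonal_def inner_commute\<close>)
  ultimately have "span {m} = ?T"
    by (intro subspace_dim_equal) (auto simp: subspace_span)
  moreover have "z \<in> ?T" using assms(5) by (auto simp: orthogonal_def inner_commute)
  ultimately show ?thesis using that by (auto simp: span_singleton)
qed

lemma tangent_normal_span:
  fixes L :: "'a::euclidean_space \<Rightarrow> 'a \<times> real"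
  assumes "linear L" "inj L" "m \<noteq> 0" "\<And>v. m \<bullet> L v = 0" "\<And>v. z \<bullet> L v = 0" "z \<bullet> m = 0"
  shows "z = 0"
proof -
  from normal_line_unique[OF assms(1-5)] obtain k where k: "z = k *\<^sub>R m" .
  then show ?thesis using assms(3,6) by simp
qed

lemma unit_normal_unique:
  fixes L :: "'a::euclidean_space \<Rightarrow> 'a \<times> real"
  assumes "linear L" "inj L" "m \<bullet> m = 1" "n \<bullet> n = 1" "\<And>v. m \<bullet> L v = 0" "\<And>v. n \<bullet> L v = 0"
  shows "n = m \<or> n = - m"
proof -
  from assms(3) have "m \<noteq> 0" by auto
  from normal_line_unique[OF assms(1,2) this assms(5,6)] obtain k where k: "n = k *\<^sub>R m" .
  with assms(3,4) have "k * k = 1" by simp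
  then have "k = 1 \<or> k = - 1" by (simp add: square_eq_1_iff)
  with k show ?thesis by auto
qed

text \<open>The first order condition at a minimum, for a quadratic polynomial.\<close>

lemma nonneg_quadratic_imp_linear_zero:
  fixes b q :: real
  assumes "\<And>e. 0 \<le> 2 * e * b + e\<^sup>2 * q"
  shows "b = 0"
proof (rule ccontr)
  assume b: "b \<noteq> 0"
  define Q where "Q = \<bar>q\<bar> + 1"
  have Q: "Q > 0" "q \<le> Q" by (simp_all add: Q_def)
  let ?e = "- b / Q"
  have "2 * ?e * b + ?e\<^sup>2 * q \<le> 2 * ?e * b + ?e\<^sup>2 * Q"
    using Q by (intro add_left_mono mult_left_mono) auto
  also have "\<dots> = - (b\<^sup>2 / Q)" using Q by (simp add: field_simps power2_eq_square)
  also have "\<dots> < 0" using b Q by simp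
  finally have "2 * ?e * b + ?e\<^sup>2 * q < 0" .
  with assms[of ?e] show False by simp
qed

text \<open>The operator \<open>S\<close> is read as a symmetric operator for the inner product \<open>L v \<bullet> L w\<close> that \<open>L\<close> induces on
the parameter space. At a maximum of the Rayleigh quotient the first variation vanishes, so
\<open>k L v - S v\<close> is orthogonal to the range of \<open>L\<close>; it is also orthogonal to the normal \<open>m\<close>, hence zero.\<close>

lemma symmetric_operator_max_eigenvalue:
  fixes S L :: "'a::euclidean_space \<Rightarrow> 'a \<times> real"
  assumes S: "linear S" and L: "linear L" "inj L"
    and m: "m \<noteq> 0" "\<And>v. m \<bullet> L v = 0" "\<And>v. S v \<bullet> m = 0"
    and sym: "\<And>v w. S v \<bullet> L w = S w \<bullet> L v"
  obtains v k where "v \<noteq> 0" "S v = k *\<^sub>R L v" "\<And>w. S w \<bullet> L w \<le> k * (L w \<bullet> L w)"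
proof -
  have L0: "L v = 0 \<longleftrightarrow> v = 0" for v
    using inj_eq[OF L(2), of v 0] linear_0[OF L(1)] by simp
  let ?q = "\<lambda>v. (S v \<bullet> L v) / (L v \<bullet> L v)"
  have c1: "continuous_on (sphere 0 1) S" "continuous_on (sphere 0 1) L"
    by (rule linear_continuous_on[OF linear_conv_bounded_linear[THEN iffD1, OF S]],
        rule linear_continuous_on[OF linear_conv_bounded_linear[THEN iffD1, OF L(1)]])
  have c2: "continuous_on (sphere 0 1) (\<lambda>v. S v \<bullet> L v)" 
    by (rule continuous_on_inner[OF c1])
  have c3: "continuous_on (sphere 0 1) (\<lambda>v. L v \<bullet> L v)" 
    by (rule continuous_on_inner[OF c1(2) c1(2)])
  have ne: "\<forall>v\<in>sphere 0 1. L v \<bullet> L v \<noteq> 0" unfolding inner_eq_zero_iff L0 by auto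
  have "continuous_on (sphere 0 1) ?q"
    by (rule continuous_on_divide[OF c2 c3 ne])
  moreover have "sphere (0::'a) 1 \<noteq> {}" by simp
  ultimately obtain v where v: "v \<in> sphere 0 1" and max: "\<And>w. w \<in> sphere 0 1 \<Longrightarrow> ?q w \<le> ?q v"
    using continuous_attains_sup[OF compact_sphere, of 0 1 ?q] by blast
  define k where "k = ?q v"
  have v0: "v \<noteq> 0" using v by auto
  have le: "S w \<bullet> L w \<le> k * (L w \<bullet> L w)" for w
  proof (cases "w = 0")
    case True
    then show ?thesis using S L by (simp add: linear_0)
  next
    case False
    let ?u = "w /\<^sub>R norm w"
    have "L ?u = L w /\<^sub>R norm w" "S ?u = S w /\<^sub>R norm w"
      using S L(1) by (simp_all add: linear_scale)
    then have "?q ?u = ?q w" using False by simp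
    moreover have "?u \<in> sphere 0 1" using False by simp
    ultimately have "?q w \<le> k" using max[of ?u] k_def by simp
    moreover have "L w \<bullet> L w > 0" using L0 False by simp
    ultimately show ?thesis by (simp add: field_simps)
  qed
  have eq: "S v \<bullet> L v = k * (L v \<bullet> L v)"
    using v0 L0 by (simp add: k_def)
  have "(k *\<^sub>R L v - S v) \<bullet> L w = 0" for w
  proof (rule nonneg_quadratic_imp_linear_zero)
    fix e :: real
    have "L (v + e *\<^sub>R w) = L v + e *\<^sub>R L w" "S (v + e *\<^sub>R w) = S v + e *\<^sub>R S w"
      using S L(1) by (simp_all add: linear_add linear_scale)
    with le[of "v + e *\<^sub>R w"]
    have "0 \<le> k * ((L v + e *\<^sub>R L w) \<bullet> (L v + e *\<^sub>R L w)) - (S v + e *\<^sub>R S w) \<bullet> (L v + e *\<^sub>R L w)"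
      by simp
    also have "\<dots> = k * (L v \<bullet> L v) - S v \<bullet> L v
        + 2 * e * ((k *\<^sub>R L v - S v) \<bullet> L w) + e\<^sup>2 * (k * (L w \<bullet> L w) - S w \<bullet> L w)"
      using sym[of v w] by (simp add: inner_simps inner_commute[of "L w" "L v"] algebra_simps power2_eq_square)
    finally show "0 \<le> 2 * e * ((k *\<^sub>R L v - S v) \<bullet> L w) + e\<^sup>2 * (k * (L w \<bullet> L w) - S w \<bullet> L w)"
      using eq by simp
  qed
  moreover have "(k *\<^sub>R L v - S v) \<bullet> m = 0"
    using m by (simp add: inner_diff_left inner_commute[of "L v" m])
  ultimately have "k *\<^sub>R L v - S v = 0"
    by (intro tangent_normal_span[OF L m(1,2)])
  with that[OF v0 _ le] show ?thesis by simp
qed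

text \<open>The largest and the smallest value of the Rayleigh quotient are eigenvalues, so both are \<open>c\<close> and the
quadratic form of \<open>S - c L\<close> vanishes; polarisation gives \<open>S = c L\<close>. In this way a single eigenvalue of
the shape operator makes it a multiple of the identity.\<close>

lemma unique_eigenvalue_imp_scalar:
  fixes S L :: "'a::euclidean_space \<Rightarrow> 'a \<times> real"
  assumes S: "linear S" and L: "linear L" "inj L"
    and m: "m \<noteq> 0" "\<And>v. m \<bullet> L v = 0" "\<And>v. S v \<bullet> m = 0"
    and sym: "\<And>v w. S v \<bullet> L w = S w \<bullet> L v"
    and eig: "\<And>v k. v \<noteq> 0 \<Longrightarrow> S v = k *\<^sub>R L v \<Longrightarrow> k = c"
  shows "S v = c *\<^sub>R L v"
proof -
  obtain v1 k1 where 1: "v1 \<noteq> 0" "S v1 = k1 *\<^sub>R L v1" "\<And>w. S w \<bullet> L w \<le> k1 * (L w \<bullet> L w)"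
    using symmetric_operator_max_eigenvalue[OF S L m sym] by metis
  have S': "linear (\<lambda>v. - S v)" using S by (simp add: linear_compose_neg)
  obtain v2 k2 where 2: "v2 \<noteq> 0" "- S v2 = k2 *\<^sub>R L v2" "\<And>w. - S w \<bullet> L w \<le> k2 * (L w \<bullet> L w)"
    using symmetric_operator_max_eigenvalue[OF S' L m(1,2)] m(3) sym by (metis inner_minus_left neg_equal_0_iff_equal)
  have "k1 = c" using eig 1 by blast
  have "S v2 = (- k2) *\<^sub>R L v2" using 2(2) by (metis add.inverse_inverse scaleR_minus_left)
  then have "k2 = - c" using eig[OF 2(1)] by fastforce
  have q: "S w \<bullet> L w = c * (L w \<bullet> L w)" for w
    using 1(3)[of w] 2(3)[of w] \<open>k1 = c\<close> \<open>k2 = - c\<close> by simp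
  have "(S v - c *\<^sub>R L v) \<bullet> L w = 0" for w
  proof -
    have "L (v + w) = L v + L w" "S (v + w) = S v + S w" using S L by (simp_all add: linear_add)
    with q[of "v + w"] q[of v] q[of w] sym[of v w] show ?thesis
      by (simp add: inner_simps inner_commute[of "L w" "L v"] algebra_simps)
  qed
  moreover have "(S v - c *\<^sub>R L v) \<bullet> m = 0"
    using m by (simp add: inner_diff_left inner_commute[of "L v" m])
  ultimately have "S v - c *\<^sub>R L v = 0"
    by (intro tangent_normal_span[OF L m(1,2)])
  then show ?thesis by simp
qed

lemma patch_smooth: "patch r \<Longrightarrow> smooth r"
  and patch_pos: "patch r \<Longrightarrow> 0 < snd (r x)"
  and patch_inj: "patch r \<Longrightarrow> inj (D r x)"
  by (auto simp: patch_def halfspace_def)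

lemma patch_linear: "patch r \<Longrightarrow> linear (D r x)"
  using has_derivative_linear[OF smooth_has_derivative[OF patch_smooth]] .

lemma patch_nonzero:
  assumes "patch r" "v \<noteq> 0"
  shows "D r x v \<noteq> 0"
  using assms(2) inj_eq[OF patch_inj[OF assms(1)], of x v 0] linear_0[OF patch_linear[OF assms(1)]]
  by simp

definition euclidean_normal :: "('a \<Rightarrow> 'a \<times> real) \<Rightarrow> ('a \<Rightarrow> 'a \<times> real) \<Rightarrow> 'a::euclidean_space \<Rightarrow> 'a \<times> real"
  where "euclidean_normal r N x = inverse (snd (r x)) *\<^sub>R N x"

context
  fixes r N :: "'a::euclidean_space \<Rightarrow> 'a \<times> real" and M
  assumes r: "patch r" and N: "unit_normal_field r N"
  defines "M \<equiv> euclidean_normal r N"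
begin

lemma euclidean_normal_smooth: "smooth M"
proof -
  have "smooth (\<lambda>x. inverse (snd (r x)))"
    using patch_pos[OF r] by (intro smooth_inverse smooth_snd patch_smooth r) (metis less_irrefl)
  moreover have "smooth N" using N by (simp add: unit_normal_field_def)
  moreover have "M = (\<lambda>x. inverse (snd (r x)) *\<^sub>R N x)"
    by (rule ext) (simp add: M_def euclidean_normal_def)
  ultimately show ?thesis using smooth_scaleR by simp
qed

lemma euclidean_normal_unit: "M x \<bullet> M x = 1"
proof -
  have "N x \<bullet> N x = (snd (r x))\<^sup>2"
    using N patch_pos[OF r, of x] by (simp add: unit_normal_field_def hmetric_def)
  then show ?thesis
    using patch_pos[OF r, of x] by (simp add: M_def euclidean_normal_def power2_eq_square field_simps)
qed

lemma euclidean_normal_orthogonal: "M x \<bullet> D r x v = 0"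
proof -
  have "N x \<bullet> D r x v = 0"
    using N patch_pos[OF r, of x] by (auto simp: unit_normal_field_def hmetric_def)
  then show ?thesis by (simp add: M_def euclidean_normal_def)
qed

lemma normal_eq: "N x = snd (r x) *\<^sub>R M x"
  using patch_pos[OF r, of x] by (simp add: M_def euclidean_normal_def)

lemma euclidean_normal_derivative_tangent: "D M x v \<bullet> M x = 0"
proof -
  have "((\<lambda>x. M x \<bullet> M x) has_derivative (\<lambda>v. M x \<bullet> D M x v + D M x v \<bullet> M x)) (at x)"
    by (intro has_derivative_inner smooth_has_derivative euclidean_normal_smooth)
  from derivative_of_locally_constant[OF this open_UNIV UNIV_I euclidean_normal_unit, of v]
  show ?thesis by (simp add: inner_commute)
qed

text \<open>Differentiating \<open>M \<bullet> D r w = 0\<close> turns the second fundamental form into the second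
  derivative of \<open>r\<close>, which is symmetric.\<close>

lemma second_fundamental_form: "D M x v \<bullet> D r x w = - (M x \<bullet> D (\<lambda>y. D r y w) x v)"
proof -
  have "((\<lambda>x. M x \<bullet> D r x w) has_derivative
      (\<lambda>v. M x \<bullet> D (\<lambda>y. D r y w) x v + D M x v \<bullet> D r x w)) (at x)"
    by (intro has_derivative_inner smooth_has_derivative euclidean_normal_smooth
        smooth_frechet_derivative patch_smooth r)
  from derivative_of_locally_constant[OF this open_UNIV UNIV_I euclidean_normal_orthogonal, of v]
  show ?thesis by simp
qed

lemma second_fundamental_form_symmetric: "D M x v \<bullet> D r x w = D M x w \<bullet> D r x v"
  unfolding second_fundamental_form mixed_derivatives_commute[OF patch_smooth[OF r], of w x v] ..

text \<open>The conformal change of metric: the hyperbolic shape operator is the Euclidean one times the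
  height, minus the vertical component of the normal times the identity.\<close>

lemma hnabla_normal:
  "hnabla (r x) (D r x v) (N x) (D N x v) = snd (r x) *\<^sub>R D M x v - snd (M x) *\<^sub>R D r x v"
proof -
  have "((\<lambda>x. snd (r x) *\<^sub>R M x) has_derivative
      (\<lambda>v. snd (r x) *\<^sub>R D M x v + snd (D r x v) *\<^sub>R M x)) (at x)"
    by (intro has_derivative_scaleR has_derivative_snd smooth_has_derivative euclidean_normal_smooth
        patch_smooth r)
  moreover have "(\<lambda>x. snd (r x) *\<^sub>R M x) = N" by (rule ext) (rule normal_eq[symmetric])
  ultimately have "(N has_derivative
      (\<lambda>v. snd (r x) *\<^sub>R D M x v + snd (D r x v) *\<^sub>R M x)) (at x)" by simp
  then have "D N x = (\<lambda>v. snd (r x) *\<^sub>R D M x v + snd (D r x v) *\<^sub>R M x)"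
    by (rule frechet_derivative_at[symmetric])
  then have DN: "D N x v = snd (r x) *\<^sub>R D M x v + snd (D r x v) *\<^sub>R M x" by simp
  have "D r x v \<bullet> N x = 0"
    unfolding normal_eq using euclidean_normal_orthogonal[of x v] by (simp add: inner_commute)
  then show ?thesis
    unfolding hnabla_def DN normal_eq using patch_pos[OF r, of x] by (simp add: zero_prod_def[symmetric])
qed

lemma shape_eigenvalues_eq:
  "shape_eigenvalues r N x =
    {k. \<exists>v. v \<noteq> 0 \<and> snd (r x) *\<^sub>R D M x v - snd (M x) *\<^sub>R D r x v = k *\<^sub>R D r x v}"
  unfolding shape_eigenvalues_def hnabla_normal ..

lemma shape_eigenvalues_scalar:
  assumes "\<And>v. D M x v = l *\<^sub>R D r x v"
  shows "shape_eigenvalues r N x = {snd (r x) * l - snd (M x)}"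
proof -
  have "snd (r x) *\<^sub>R D M x v - snd (M x) *\<^sub>R D r x v = k *\<^sub>R D r x v \<longleftrightarrow> k = snd (r x) * l - snd (M x)"
    if "v \<noteq> 0" for v k
  proof -
    have "snd (r x) *\<^sub>R D M x v - snd (M x) *\<^sub>R D r x v = (snd (r x) * l - snd (M x)) *\<^sub>R D r x v"
      by (simp add: assms algebra_simps)
    then show ?thesis using patch_nonzero[OF r that, of x] by auto
  qed
  moreover have "\<exists>v::'a. v \<noteq> 0" using nonzero_Basis nonempty_Basis by (metis ex_in_conv)
  ultimately show ?thesis unfolding shape_eigenvalues_eq by auto
qed

text \<open>By \<open>hnabla_normal\<close>, the hyperbolic and the Euclidean shape operators have the same eigenvectors.\<close>

lemma umbilic_point:
  assumes "shape_eigenvalues r N x = {k}"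
  shows "D M x v = ((k + snd (M x)) / snd (r x)) *\<^sub>R D r x v"
proof (rule unique_eigenvalue_imp_scalar[where m = "M x"])
  show "linear (D M x)"
    by (rule has_derivative_linear[OF smooth_has_derivative[OF euclidean_normal_smooth]])
  show "linear (D r x)" "inj (D r x)" by (rule patch_linear[OF r], rule patch_inj[OF r])
  show "M x \<noteq> 0" using euclidean_normal_unit[of x] by auto
  show "M x \<bullet> D r x v = 0" for v by (rule euclidean_normal_orthogonal)
  show "D M x v \<bullet> M x = 0" for v by (rule euclidean_normal_derivative_tangent)
  show "D M x v \<bullet> D r x w = D M x w \<bullet> D r x v" for v w by (rule second_fundamental_form_symmetric)
next
  fix v c assume v: "v \<noteq> 0" "D M x v = c *\<^sub>R D r x v"
  have "snd (r x) *\<^sub>R D M x v - snd (M x) *\<^sub>R D r x v = (snd (r x) * c - snd (M x)) *\<^sub>R D r x v"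
    by (simp add: v(2) algebra_simps)
  with v(1) have "snd (r x) * c - snd (M x) \<in> shape_eigenvalues r N x"
    unfolding shape_eigenvalues_eq by blast
  then have "k = snd (r x) * c - snd (M x)" using assms by simp
  then show "c = (k + snd (M x)) / snd (r x)" using patch_pos[OF r, of x] by simp
qed

text \<open>An umbilical patch lies in a generalised sphere: the factor \<open>l\<close> with \<open>D M = l D r\<close> is
  constant.  If the dimension of the patch is at least two, this is the symmetry of the second
  derivative of \<open>M\<close>, which reads \<open>D l w D r v = D l v D r w\<close>; for curves it follows
  from the constancy of the curvature \<open>y l - M\<^sub>n\<close>.\<close>

lemma umbilic_patch_in_gsphere:
  assumes umb: "\<And>x. \<exists>k. shape_eigenvalues r N x = {k}"
    and curve: "DIM('a) = 1 \<Longrightarrow> \<exists>k. \<forall>x. shape_eigenvalues r N x = {k}"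
  obtains l where
    "\<And>x. shape_eigenvalues r N x = {snd (r x) * l - snd (M x)}"
    "\<And>x. range r \<subseteq> gsphere (r x) (M x) l"
proof -
  note sr = patch_smooth[OF r] and sM = euclidean_normal_smooth
  obtain b :: 'a where b: "b \<in> Basis" using nonempty_Basis by blast
  then have b0: "b \<noteq> 0" by (rule nonzero_Basis)
  define l where "l x = (D M x b \<bullet> D r x b) / (D r x b \<bullet> D r x b)" for x
  have DM: "D M x v = l x *\<^sub>R D r x v" for x v
  proof -
    obtain k where "shape_eigenvalues r N x = {k}" using umb by blast
    from umbilic_point[OF this] obtain c where c: "\<And>v. D M x v = c *\<^sub>R D r x v" by metis
    \<comment> \<open>The factor is read off in the fixed direction \<open>b\<close>, which makes it a smooth function of \<open>x\<close>.\<close>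
    then have "l x = c" using patch_nonzero[OF r b0, of x] by (simp add: l_def)
    with c show ?thesis by simp
  qed
  have sl: "smooth l"
    unfolding l_def
    by (intro smooth_divide smooth_inner smooth_frechet_derivative sr sM)
      (use patch_nonzero[OF r b0] in auto)
  have "D l x w = 0" for x w
  proof (cases "DIM('a) = 1")
    case True
    from curve[OF this] obtain k where k: "\<And>x. shape_eigenvalues r N x = {k}" by blast
    have *: "snd (r x) * l x - snd (M x) = k" for x
      using k[of x] shape_eigenvalues_scalar[OF DM, of x] by simp
    have "((\<lambda>x. snd (r x) * l x - snd (M x)) has_derivative
        (\<lambda>w. (snd (r x) * D l x w + snd (D r x w) * l x) - snd (D M x w))) (at x)"
      by (intro has_derivative_diff has_derivative_mult has_derivative_snd smooth_has_derivative sl sr sM)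
    from derivative_of_locally_constant[OF this open_UNIV UNIV_I *, of w]
    show ?thesis using patch_pos[OF r, of x] by (simp add: DM)
  next
    case False
    have DDM: "D (\<lambda>y. D M y v) x w = D l x w *\<^sub>R D r x v + l x *\<^sub>R D (\<lambda>y. D r y v) x w" for v w
    proof -
      have "((\<lambda>y. l y *\<^sub>R D r y v) has_derivative
          (\<lambda>w. l x *\<^sub>R D (\<lambda>y. D r y v) x w + D l x w *\<^sub>R D r x v)) (at x)"
        by (intro has_derivative_scaleR smooth_has_derivative sl smooth_frechet_derivative sr)
      moreover have "(\<lambda>y. l y *\<^sub>R D r y v) = (\<lambda>y. D M y v)" by (simp add: DM)
      ultimately have "((\<lambda>y. D M y v) has_derivative
          (\<lambda>w. l x *\<^sub>R D (\<lambda>y. D r y v) x w + D l x w *\<^sub>R D r x v)) (at x)" by simp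
      then have "D (\<lambda>y. D M y v) x = (\<lambda>w. l x *\<^sub>R D (\<lambda>y. D r y v) x w + D l x w *\<^sub>R D r x v)"
        by (rule frechet_derivative_at[symmetric])
      then show ?thesis by simp
    qed
    have swap: "D l x w *\<^sub>R D r x v = D l x v *\<^sub>R D r x w" for v w
      using mixed_derivatives_commute[OF sM, of v x w] mixed_derivatives_commute[OF sr, of v x w]
      unfolding DDM by simp
    have "D l x v = 0" if v: "v \<in> Basis" for v
    proof -
      have "Basis \<noteq> {v}" using False by (metis One_nat_def card_1_singleton_iff)
      then obtain u where u: "u \<in> Basis" "u \<noteq> v" using v by blast
      have "D r x (D l x v *\<^sub>R u - D l x u *\<^sub>R v) = 0"
        using swap[of u v] patch_linear[OF r, of x] by (simp add: linear_diff linear_scale)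
      then have "D l x v *\<^sub>R u - D l x u *\<^sub>R v = 0"
        using patch_nonzero[OF r] by blast
      then have "(D l x v *\<^sub>R u - D l x u *\<^sub>R v) \<bullet> u = 0" by simp
      then show ?thesis using u v by (simp add: inner_diff_left inner_Basis)
    qed
    then have "D l x (\<Sum>b\<in>Basis. (w \<bullet> b) *\<^sub>R b) = 0"
      using has_derivative_linear[OF smooth_has_derivative[OF sl], of x]
      by (simp add: linear_sum linear_scale)
    then show ?thesis by (simp only: euclidean_representation)
  qed
  then have "(l has_derivative (\<lambda>w. 0)) (at x within UNIV)" for x
    using smooth_has_derivative[OF sl, of x UNIV] by (metis ext)
  then obtain c where c: "\<And>x. l x = c"
    using has_derivative_zero_constant[of UNIV l] by auto
  show ?thesis
  proof (rule that)
    show "shape_eigenvalues r N x = {snd (r x) * c - snd (M x)}" for x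
      using shape_eigenvalues_scalar[OF DM, of x] c by simp
    show "range r \<subseteq> gsphere (r x) (M x) c" for x
    proof -
      have "((\<lambda>y. M y - c *\<^sub>R r y) has_derivative (\<lambda>w. D M y w - c *\<^sub>R D r y w)) (at y within UNIV)" for y
        by (intro has_derivative_diff has_derivative_scaleR_right smooth_has_derivative sr sM)
      then have "((\<lambda>y. M y - c *\<^sub>R r y) has_derivative (\<lambda>w. 0)) (at y within UNIV)" for y
        by (simp add: DM c)
      then obtain d where "\<And>y. M y - c *\<^sub>R r y = d"
        using has_derivative_zero_constant[of UNIV "\<lambda>y. M y - c *\<^sub>R r y"] by auto
      then have "M y - c *\<^sub>R r y = M x - c *\<^sub>R r x" for y by simp
      then have M: "M y = M x + c *\<^sub>R (r y - r x)" for y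
        by (simp add: diff_eq_eq algebra_simps)
      let ?q = "\<lambda>y. 2 * (M x \<bullet> (r y - r x)) + c * ((r y - r x) \<bullet> (r y - r x))"
      have "(?q has_derivative (\<lambda>w. 0)) (at y within UNIV)" for y
      proof -
        have 1: "((\<lambda>y. r y - r x) has_derivative (\<lambda>w. D r y w)) (at y)"
          using has_derivative_diff[OF smooth_has_derivative[OF sr] has_derivative_const] by fastforce
        have "(?q has_derivative (\<lambda>w. 2 * (M x \<bullet> D r y w)
            + c * ((r y - r x) \<bullet> D r y w + D r y w \<bullet> (r y - r x)))) (at y)"
          by (intro has_derivative_add has_derivative_mult_right has_derivative_inner_right
              has_derivative_inner 1)
        moreover have "2 * (M x \<bullet> D r y w) + c * ((r y - r x) \<bullet> D r y w + D r y w \<bullet> (r y - r x))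
            = 2 * (M y \<bullet> D r y w)" for w
          by (simp add: M[of y] inner_add_left inner_commute[of "D r y w"])
        ultimately show ?thesis by (simp add: euclidean_normal_orthogonal)
      qed
      then obtain d where "\<And>y. ?q y = d"
        using has_derivative_zero_constant[of UNIV ?q] by auto
      from this this[of x] show ?thesis by (auto simp: gsphere_def)
    qed
  qed
qed

end

text \<open>The gradient of the defining function of the generalised sphere is \<open>2 (m + l (q - p))\<close>.\<close>

lemma gsphere_normal_orthogonal:
  assumes "smooth r" "open T" "x \<in> T" "r ` T \<subseteq> gsphere p m l"
  shows "(m + l *\<^sub>R (r x - p)) \<bullet> D r x v = 0"
proof -
  let ?q = "\<lambda>y. 2 * (m \<bullet> (r y - p)) + l * ((r y - p) \<bullet> (r y - p))"
  have 1: "((\<lambda>y. r y - p) has_derivative (\<lambda>w. D r x w)) (at x)"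
    using has_derivative_diff[OF smooth_has_derivative[OF assms(1)] has_derivative_const] by fastforce
  have "(?q has_derivative (\<lambda>w. 2 * (m \<bullet> D r x w)
      + l * ((r x - p) \<bullet> D r x w + D r x w \<bullet> (r x - p)))) (at x)"
    by (intro has_derivative_add has_derivative_mult_right has_derivative_inner_right
        has_derivative_inner 1)
  moreover have "?q y = 0" if "y \<in> T" for y using assms(4) that by (auto simp: gsphere_def)
  ultimately have "2 * (m \<bullet> D r x v) + l * ((r x - p) \<bullet> D r x v + D r x v \<bullet> (r x - p)) = 0"
    by (rule derivative_of_locally_constant[OF _ assms(2,3)])
  then show ?thesis by (simp add: inner_add_left inner_commute[of "D r x v"])
qed

text \<open>Both \<open>m + l (r x - p)\<close> and the Euclidean unit normal of the patch are unit normals, so they agree up to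
a sign, which is constant by connectedness. The first one has derivative \<open>l D r\<close>, so the curvature is
the value of \<open>l y - M\<^sub>n\<close> for \<open>M = m + l (q - p)\<close>, which is the same at all points \<open>q\<close>.\<close>

lemma gsphere_patch_umbilic:
  fixes r N :: "'a::euclidean_space \<Rightarrow> 'a \<times> real"
  assumes r: "patch r" and N: "unit_normal_field r N" and m: "m \<bullet> m = 1"
    and sub: "range r \<subseteq> gsphere p m l"
  obtains s where "s = 1 \<or> s = - 1"
    "\<And>x. euclidean_normal r N x = s *\<^sub>R (m + l *\<^sub>R (r x - p))"
    "\<And>x. shape_eigenvalues r N x = {s * (l * snd p - snd m)}"
proof -
  let ?M = "euclidean_normal r N" and ?G = "\<lambda>x. m + l *\<^sub>R (r x - p)"
  note sr = patch_smooth[OF r] and sM = euclidean_normal_smooth[OF r N]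
  have G1: "?G x \<bullet> ?G x = 1" for x
    using gsphere_normal_unit[OF m, of "r x" p l] sub by blast
  have G0: "?G x \<bullet> D r x v = 0" for x v
    by (rule gsphere_normal_orthogonal[OF sr open_UNIV _ sub]) simp
  have pm: "?M x = ?G x \<or> ?M x = - ?G x" for x
    by (rule unit_normal_unique[OF patch_linear[OF r] patch_inj[OF r] G1
          euclidean_normal_unit[OF r N] G0 euclidean_normal_orthogonal[OF r N]])
  define s where "s x = ?M x \<bullet> ?G x" for x
  have s: "s x = 1 \<and> ?M x = ?G x \<or> s x = - 1 \<and> ?M x = - ?G x" for x
    unfolding s_def using pm[of x] G1[of x]
    by (elim disjE) (simp_all only: inner_minus_left simp_thms)
  have cs: "continuous_on UNIV s"
    unfolding s_def using smooth_continuous[OF sM] smooth_continuous[OF sr]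
    by (intro continuous_intros)
  have "s constant_on UNIV"
  proof (rule continuous_discrete_range_constant[OF connected_UNIV cs])
    fix x
    have "1 \<le> norm (s y - s x)" if "s y \<noteq> s x" for y
      using s[of x] s[of y] that by auto
    then show "\<exists>e>0. \<forall>y. y \<in> UNIV \<and> s y \<noteq> s x \<longrightarrow> e \<le> norm (s y - s x)"
      by (intro exI[of _ 1]) auto
  qed
  then obtain c where c: "\<And>x. s x = c" by (auto simp: constant_on_def)
  have M: "?M x = c *\<^sub>R ?G x" for x using s[of x] c[of x] by auto
  have c1: "c = 1 \<or> c = - 1" using s[of 0] c[of 0] by auto
  have "shape_eigenvalues r N x = {c * (l * snd p - snd m)}" for x
  proof -
    have "((\<lambda>x. c *\<^sub>R ?G x) has_derivative (\<lambda>v. c *\<^sub>R (l *\<^sub>R D r x v))) (at x)"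
      using smooth_has_derivative[OF sr, of x UNIV]
      by (auto intro!: derivative_eq_intros)
    moreover have "(\<lambda>x. c *\<^sub>R ?G x) = ?M" using M by auto
    ultimately have "(?M has_derivative (\<lambda>v. c *\<^sub>R (l *\<^sub>R D r x v))) (at x)" by simp
    then have "D ?M x = (\<lambda>v. c *\<^sub>R (l *\<^sub>R D r x v))" by (rule frechet_derivative_at[symmetric])
    then have "D ?M x v = (c * l) *\<^sub>R D r x v" for v by simp
    from shape_eigenvalues_scalar[OF r N this]
    show ?thesis by (simp add: M[of x] algebra_simps)
  qed
  with that c1 M show ?thesis by blast
qed

section \<open>Local unit normal fields\<close>

text \<open>Orthogonal projection off smooth independent vector fields is smooth: making the fields orthogonal one
after the other only divides by squared lengths of nonzero vectors.\<close>

lemma smooth_gram_schmidt: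
  fixes V :: "'i \<Rightarrow> 'a::real_normed_vector \<Rightarrow> 'b::euclidean_space"
  assumes "finite B" "\<And>b. b \<in> B \<Longrightarrow> smooth (V b)"
    and "\<And>x c. (\<Sum>b\<in>B. c b *\<^sub>R V b x) = 0 \<Longrightarrow> \<forall>b\<in>B. c b = 0"
    and "smooth W"
  shows "\<exists>W'. smooth W' \<and> (\<forall>x. \<forall>b\<in>B. W' x \<bullet> V b x = 0)
    \<and> (\<forall>x. \<exists>c. W x - W' x = (\<Sum>b\<in>B. c b *\<^sub>R V b x))"
  using assms
proof (induction B arbitrary: W rule: finite_induct)
  case empty
  then show ?case by (intro exI[of _ W]) auto
next
  case (insert a B)
  have ne: "b \<noteq> a" if "b \<in> B" for b using insert.hyps(2) that by auto
  have indep: "\<forall>b\<in>B. c b = 0" if "(\<Sum>b\<in>B. c b *\<^sub>R V b x) = 0" for x c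
  proof -
    have "(\<Sum>b\<in>B. (c(a := 0)) b *\<^sub>R V b x) = (\<Sum>b\<in>B. c b *\<^sub>R V b x)"
      using ne by (intro sum.cong) auto
    then have "(\<Sum>b\<in>insert a B. (c(a := 0)) b *\<^sub>R V b x) = 0"
      using that insert.hyps by simp
    from insert.prems(2)[OF this] ne show ?thesis by auto
  qed
  have IH: "\<exists>W'. smooth W' \<and> (\<forall>x. \<forall>b\<in>B. W' x \<bullet> V b x = 0)
      \<and> (\<forall>x. \<exists>c. W x - W' x = (\<Sum>b\<in>B. c b *\<^sub>R V b x))" if "smooth W" for W
    by (rule insert.IH[OF _ indep that]) (use insert.prems(1) in auto)
  obtain V' where V': "smooth V'" "\<And>x b. b \<in> B \<Longrightarrow> V' x \<bullet> V b x = 0"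
    "\<And>x. \<exists>c. V a x - V' x = (\<Sum>b\<in>B. c b *\<^sub>R V b x)"
    using IH[of "V a"] insert.prems(1) by auto
  then obtain c where c: "\<And>x. V a x - V' x = (\<Sum>b\<in>B. c x b *\<^sub>R V b x)" by metis
  obtain U where U: "smooth U" "\<And>x b. b \<in> B \<Longrightarrow> U x \<bullet> V b x = 0"
    "\<And>x. \<exists>d. W x - U x = (\<Sum>b\<in>B. d b *\<^sub>R V b x)"
    using IH[OF insert.prems(3)] by auto
  then obtain d where d: "\<And>x. W x - U x = (\<Sum>b\<in>B. d x b *\<^sub>R V b x)" by metis
  have V'0: "V' x \<noteq> 0" for x
  proof
    assume "V' x = 0"
    then have "V a x = (\<Sum>b\<in>B. c x b *\<^sub>R V b x)" using c[of x] by simp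
    moreover have "(\<Sum>b\<in>B. (if b = a then 1 else - c x b) *\<^sub>R V b x) = - (\<Sum>b\<in>B. c x b *\<^sub>R V b x)"
      unfolding sum_negf[symmetric] using ne by (intro sum.cong) auto
    ultimately have "(\<Sum>b\<in>insert a B. (if b = a then 1 else - c x b) *\<^sub>R V b x) = 0"
      using insert.hyps by simp
    from insert.prems(2)[OF this] show False by auto
  qed
  define k where "k x = (U x \<bullet> V' x) / (V' x \<bullet> V' x)" for x
  have sk: "smooth k"
    unfolding k_def using V'0 by (intro smooth_divide smooth_inner U V') auto
  let ?W = "\<lambda>x. U x - k x *\<^sub>R V' x"
  have "smooth ?W" by (intro smooth_diff smooth_scaleR sk U V')
  moreover have B: "?W x \<bullet> V b x = 0" if "b \<in> B" for x b
    using U(2)[OF that] V'(2)[OF that] by (simp add: inner_diff_left)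
  moreover have "?W x \<bullet> V a x = 0" for x
  proof -
    have "?W x \<bullet> V a x = ?W x \<bullet> V' x + ?W x \<bullet> (V a x - V' x)"
      by (simp add: inner_simps)
    also have "?W x \<bullet> (V a x - V' x) = 0"
      unfolding c inner_sum_right using B[of _ x] by (simp add: inner_commute)
    also have "?W x \<bullet> V' x = 0" using V'0[of x] by (simp add: k_def inner_diff_left)
    finally show ?thesis by simp
  qed
  moreover have "\<exists>f. W x - ?W x = (\<Sum>b\<in>insert a B. f b *\<^sub>R V b x)" for x
  proof (intro exI[of _ "\<lambda>b. if b = a then k x else d x b - k x * c x b"])
    have "(\<Sum>b\<in>B. (if b = a then k x else d x b - k x * c x b) *\<^sub>R V b x)
        = (\<Sum>b\<in>B. d x b *\<^sub>R V b x) - k x *\<^sub>R (\<Sum>b\<in>B. c x b *\<^sub>R V b x)"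
      unfolding scaleR_sum_right sum_subtractf[symmetric] using ne
      by (intro sum.cong) (auto simp: scaleR_left_diff_distrib)
    then show "W x - ?W x = (\<Sum>b\<in>insert a B. (if b = a then k x else d x b - k x * c x b) *\<^sub>R V b x)"
      using insert.hyps c[of x, symmetric] d[of x, symmetric] by (simp add: algebra_simps)
  qed
  ultimately show ?case by (intro exI[of _ ?W]) auto
qed

lemma inj_derivative_of_left_inverse:
  assumes "smooth f" "g differentiable (at (f x))" "\<And>y. g (f y) = y"
  shows "inj (D f x)"
proof -
  obtain g' where g': "(g has_derivative g') (at (f x))"
    using assms(2) by (auto simp: differentiable_def)
  have "((\<lambda>y. g (f y)) has_derivative (\<lambda>v. g' (D f x v))) (at x)"
    by (rule has_derivative_compose[OF smooth_has_derivative[OF assms(1)] g'])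
  then have "((\<lambda>y. y) has_derivative (\<lambda>v. g' (D f x v))) (at x)" by (simp add: assms(3))
  then have "(\<lambda>v. g' (D f x v)) = (\<lambda>v. v)" by (rule has_derivative_unique) simp
  then show ?thesis by (metis injI)
qed

text \<open>A smooth diffeomorphism from the whole space onto the ball of radius \<open>d\<close> around \<open>a\<close>. Patches have the
whole space as their domain, so restricting a patch to a ball means composing it with this map.\<close>

definition shrink :: "'a::real_inner \<Rightarrow> real \<Rightarrow> 'a \<Rightarrow> 'a"
  where "shrink a d x = a + (d / sqrt (1 + x \<bullet> x)) *\<^sub>R x"

lemma one_plus_square_pos: "0 < 1 + x \<bullet> x"
  by (rule add_pos_nonneg) simp_all

lemma smooth_shrink: "smooth (shrink a d)"
proof -
  have "sqrt (1 + x \<bullet> x) \<noteq> 0" for x :: 'a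
    using real_sqrt_gt_zero[OF one_plus_square_pos[of x]] by linarith
  then have "smooth (\<lambda>x. a + (d / sqrt (1 + x \<bullet> x)) *\<^sub>R x)"
    by (intro smooth_add smooth_scaleR smooth_divide smooth_sqrt smooth_inner smooth_const smooth_ident
        one_plus_square_pos)
  then show ?thesis by (simp add: shrink_def[abs_def])
qed

lemma shrink_inverse:
  assumes "d > 0"
  shows "(1 / sqrt (d\<^sup>2 - (shrink a d x - a) \<bullet> (shrink a d x - a))) *\<^sub>R (shrink a d x - a) = x"
    and "(shrink a d x - a) \<bullet> (shrink a d x - a) < d\<^sup>2"
proof -
  let ?s = "1 + x \<bullet> x"
  have s: "?s > 0" by (rule one_plus_square_pos)
  have e: "(shrink a d x - a) \<bullet> (shrink a d x - a) = d\<^sup>2 * (x \<bullet> x) / ?s"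
    using s by (simp add: shrink_def power2_eq_square)
  then have eq: "d\<^sup>2 - (shrink a d x - a) \<bullet> (shrink a d x - a) = d\<^sup>2 / ?s"
    using s by (simp add: field_simps)
  have "d\<^sup>2 / ?s > 0" using s assms by simp
  then show "(shrink a d x - a) \<bullet> (shrink a d x - a) < d\<^sup>2" using eq by linarith
  show "(1 / sqrt (d\<^sup>2 - (shrink a d x - a) \<bullet> (shrink a d x - a))) *\<^sub>R (shrink a d x - a) = x"
    unfolding eq using s assms by (simp add: shrink_def real_sqrt_divide)
qed

lemma range_shrink:
  assumes "d > 0"
  shows "range (shrink a d) = ball a d"
proof
  show "range (shrink a d) \<subseteq> ball a d"
  proof
    fix y assume "y \<in> range (shrink a d)"
    then have "(y - a) \<bullet> (y - a) < d\<^sup>2" using shrink_inverse(2)[OF assms] by auto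
    then have "(norm (y - a))\<^sup>2 < d\<^sup>2" by (simp add: power2_norm_eq_inner)
    then have "norm (y - a) < d" using assms by (simp add: power2_less_imp_less)
    then show "y \<in> ball a d" by (simp add: dist_norm norm_minus_commute)
  qed
  show "ball a d \<subseteq> range (shrink a d)"
  proof
    fix y assume "y \<in> ball a d"
    then have "norm (y - a) < d" by (simp add: dist_norm norm_minus_commute)
    then have "(norm (y - a))\<^sup>2 < d\<^sup>2" by (simp add: power_strict_mono)
    then have p: "d\<^sup>2 - (y - a) \<bullet> (y - a) > 0" by (simp add: power2_norm_eq_inner)
    define c where "c = sqrt (d\<^sup>2 - (y - a) \<bullet> (y - a))"
    let ?x = "(1 / c) *\<^sub>R (y - a)"
    have c: "c > 0" "c * c = d\<^sup>2 - (y - a) \<bullet> (y - a)" using p by (simp_all add: c_def)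
    have "1 + ?x \<bullet> ?x = (c * c + (y - a) \<bullet> (y - a)) / (c * c)" using c(1) by (simp add: add_divide_distrib)
    also have "\<dots> = d\<^sup>2 / (c * c)" by (simp only: c diff_add_cancel)
    also have "\<dots> = (d / c)\<^sup>2" by (simp only: power2_eq_square times_divide_times_eq)
    finally have "1 + ?x \<bullet> ?x = (d / c)\<^sup>2" .
    then have "sqrt (1 + ?x \<bullet> ?x) = d / c" using c(1) assms by (simp only:) simp
    then have "shrink a d ?x = y" unfolding shrink_def using c(1) assms by (simp only:) simp
    then show "y \<in> range (shrink a d)" by (metis rangeI)
  qed
qed

lemma inj_derivative_shrink:
  assumes "d > 0"
  shows "inj (D (shrink a d) x)"
proof (rule inj_derivative_of_left_inverse[OF smooth_shrink])
  let ?g = "\<lambda>y. (1 / sqrt (d\<^sup>2 - (y - a) \<bullet> (y - a))) *\<^sub>R (y - a)"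
  show "?g (shrink a d y) = y" for y by (rule shrink_inverse(1)[OF assms])
  have "d\<^sup>2 - (shrink a d x - a) \<bullet> (shrink a d x - a) > 0"
    using shrink_inverse(2)[OF assms] by simp
  then show "?g differentiable (at (shrink a d x))"
    unfolding differentiable_def
    by - (rule exI, (rule derivative_eq_intros refl | simp)+)
qed

lemma patch_shrink:
  assumes "patch r" "d > 0"
  shows "patch (\<lambda>x. r (shrink a d x))" "range (\<lambda>x. r (shrink a d x)) = r ` ball a d"
proof -
  show "range (\<lambda>x. r (shrink a d x)) = r ` ball a d"
    unfolding range_shrink[OF assms(2), symmetric] image_image ..
  have "D (\<lambda>x. r (shrink a d x)) x = (\<lambda>v. D r (shrink a d x) (D (shrink a d) x v))" for x
    by (rule frechet_derivative_at[symmetric])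
      (rule has_derivative_compose[OF smooth_has_derivative[OF smooth_shrink]
          smooth_has_derivative[OF patch_smooth[OF assms(1)]]])
  then have "inj (D (\<lambda>x. r (shrink a d x)) x)" for x
    using inj_compose[OF patch_inj[OF assms(1)] inj_derivative_shrink[OF assms(2)], of "shrink a d x" a x]
    by (simp add: o_def)
  then show "patch (\<lambda>x. r (shrink a d x))"
    using assms(1) smooth_compose[OF patch_smooth[OF assms(1)] smooth_shrink[of a d]]
    by (auto simp: patch_def)
qed

text \<open>Projecting a fixed normal at one point orthogonally off the tangent spaces gives a smooth
  normal field that vanishes nowhere near that point.\<close>

lemma patch_local_unit_normal:
  fixes r :: "'a::euclidean_space \<Rightarrow> 'a \<times> real"
  assumes r: "patch r"
  obtains d \<rho> N where "d > 0" "patch \<rho>" "range \<rho> = r ` ball a d" "unit_normal_field \<rho> N"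
proof -
  note sr = patch_smooth[OF r]
  have lin: "linear (D r x)" for x by (rule patch_linear[OF r])
  have rep: "D r x v = (\<Sum>b\<in>Basis. (v \<bullet> b) *\<^sub>R D r x b)" for x v
    using linear_sum[OF lin, of x "\<lambda>b. (v \<bullet> b) *\<^sub>R b" Basis]
    by (simp only: euclidean_representation linear_scale[OF lin] o_def)
  have indep: "\<forall>b\<in>Basis. c b = 0" if "(\<Sum>b\<in>Basis. c b *\<^sub>R D r x b) = 0" for x c
  proof -
    have "D r x (\<Sum>b\<in>Basis. c b *\<^sub>R b) = 0"
      using that by (simp only: linear_sum[OF lin] linear_scale[OF lin] o_def)
    then have "(\<Sum>b\<in>Basis. c b *\<^sub>R b) = 0" using patch_nonzero[OF r] by blast
    then show ?thesis
      by (metis inner_sum_left_Basis inner_zero_left)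
  qed
  have "dim (span (range (D r a))) \<le> DIM('a)"
    using dim_image_le[OF lin, of a UNIV] by (simp add: dim_UNIV)
  then have "span (range (D r a)) \<subset> span UNIV"
    by (metis Suc_n_not_le_n dim_UNIV DIM_prod DIM_real Suc_eq_plus1 dim_span span_UNIV top.not_eq_extremum)
  then obtain n where n: "n \<noteq> 0" "\<And>y. y \<in> span (range (D r a)) \<Longrightarrow> orthogonal n y"
    using orthogonal_to_subspace_exists_gen by metis
  then have nr: "n \<bullet> D r a v = 0" for v by (simp add: orthogonal_def span_base)
  have "\<exists>W. smooth W \<and> (\<forall>x. \<forall>b\<in>Basis. W x \<bullet> D r x b = 0)
      \<and> (\<forall>x. \<exists>c. n - W x = (\<Sum>b\<in>Basis. c b *\<^sub>R D r x b))"
  proof (rule smooth_gram_schmidt[where V = "\<lambda>b x. D r x b" and W = "\<lambda>x. n"])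
    show "smooth (\<lambda>x. D r x b)" for b by (rule smooth_frechet_derivative[OF sr])
    show "\<forall>b\<in>Basis. c b = 0" if "(\<Sum>b\<in>Basis. c b *\<^sub>R D r x b) = 0" for x c
      by (rule indep[OF that])
  qed (simp_all add: smooth_const)
  then obtain W where W: "smooth W" "\<And>x b. b \<in> Basis \<Longrightarrow> W x \<bullet> D r x b = 0"
    "\<And>x. \<exists>c. n - W x = (\<Sum>b\<in>Basis. c b *\<^sub>R D r x b)"
    by blast
  have Wr: "W x \<bullet> D r x v = 0" for x v
    by (subst rep) (simp add: inner_sum_right W(2))
  have "W a = n"
  proof -
    obtain c where c: "n - W a = (\<Sum>b\<in>Basis. c b *\<^sub>R D r a b)" using W(3) by blast
    have "(n - W a) \<bullet> (n - W a) = (n - W a) \<bullet> (\<Sum>b\<in>Basis. c b *\<^sub>R D r a b)" by (simp only: c)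
    also have "\<dots> = 0" by (simp add: inner_sum_right inner_diff_left nr Wr)
    finally show ?thesis by simp
  qed
  moreover have "isCont W a"
    using smooth_continuous[OF W(1), of UNIV] by (simp add: continuous_on_eq_continuous_at)
  ultimately obtain d where d: "d > 0" "\<And>y. dist a y < d \<Longrightarrow> W y \<noteq> 0"
    using continuous_at_avoid[of a W 0] n(1) by blast
  define \<rho> where "\<rho> x = r (shrink a d x)" for x
  have \<rho>: "patch \<rho>" "range \<rho> = r ` ball a d"
    using patch_shrink[OF r d(1)] by (simp_all add: \<rho>_def[abs_def])
  let ?W = "\<lambda>x. W (shrink a d x)"
  have W0: "?W x \<bullet> ?W x > 0" for x
  proof -
    have "shrink a d x \<in> ball a d" using range_shrink[OF d(1), of a] by blast
    then show ?thesis using d(2)[of "shrink a d x"] by simp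
  qed
  define N where "N x = (snd (\<rho> x) / sqrt (?W x \<bullet> ?W x)) *\<^sub>R ?W x" for x
  have sW: "smooth ?W" by (rule smooth_compose[OF W(1) smooth_shrink])
  moreover have "sqrt (?W x \<bullet> ?W x) \<noteq> 0" for x
    using real_sqrt_gt_zero[OF W0[of x]] by linarith
  ultimately have "smooth (\<lambda>x. (snd (\<rho> x) / sqrt (?W x \<bullet> ?W x)) *\<^sub>R ?W x)"
    by (intro smooth_scaleR smooth_divide smooth_sqrt smooth_snd smooth_inner sW
        patch_smooth[OF \<rho>(1)] W0)
  then have "smooth N" by (simp add: N_def[abs_def])
  moreover have "hmetric (\<rho> x) (N x) (N x) = 1" for x
    using W0[of x] patch_pos[OF \<rho>(1), of x] by (simp add: N_def hmetric_def power2_eq_square)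
  moreover have "hmetric (\<rho> x) (N x) (D \<rho> x v) = 0" for x v
  proof -
    have "D \<rho> x = (\<lambda>v. D r (shrink a d x) (D (shrink a d) x v))"
      unfolding \<rho>_def
      by (rule frechet_derivative_at[symmetric])
        (rule has_derivative_compose[OF smooth_has_derivative[OF smooth_shrink]
            smooth_has_derivative[OF sr]])
    then show ?thesis by (simp add: hmetric_def N_def Wr)
  qed
  ultimately have "unit_normal_field \<rho> N" by (simp add: unit_normal_field_def)
  with that d(1) \<rho> show ?thesis by blast
qed

section \<open>Leaves of umbilical foliations\<close>

text \<open>A hypersurface patch inside a generalised sphere is open in it. Moving along the normals of the patch
by small amounts \<open>k\<close> is injective, because the defining function takes the value \<open>2 k + l k\<^sup>2\<close> at height
\<open>k\<close>, which determines \<open>k\<close> and then the foot point. By invariance of domain the image is open, and the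
points of the generalised sphere in it are those of height \<open>0\<close>.\<close>

lemma gsphere_nbhd_in_range:
  fixes r :: "'a::euclidean_space \<Rightarrow> 'a \<times> real"
  assumes cont: "continuous_on UNIV r" and inj: "inj r" and m: "m \<bullet> m = 1"
    and sub: "range r \<subseteq> gsphere p m l"
  obtains e where "e > 0" "ball (r x) e \<inter> gsphere p m l \<subseteq> range r"
proof -
  let ?G = "\<lambda>x. m + l *\<^sub>R (r x - p)"
  let ?q = "\<lambda>z. 2 * (m \<bullet> (z - p)) + l * ((z - p) \<bullet> (z - p))"
  define \<Theta> where "\<Theta> z = r (fst z) + snd z *\<^sub>R ?G (fst z)" for z :: "'a \<times> real"
  \<comment> \<open>Heights below \<open>1 / |l|\<close> do not reach the centre of the sphere.\<close>
  define a where "a = 1 / (\<bar>l\<bar> + 1)"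
  have a: "a > 0" "\<bar>l\<bar> * a < 1" by (simp_all add: a_def field_simps)
  let ?S = "UNIV \<times> {- a<..<a} :: ('a \<times> real) set"
  have small: "\<bar>l * k\<bar> < 1" if "k \<in> {- a<..<a}" for k
  proof -
    have "\<bar>l\<bar> * \<bar>k\<bar> \<le> \<bar>l\<bar> * a" using that by (intro mult_left_mono) auto
    then show ?thesis using a(2) by (simp add: abs_mult)
  qed
  have G1: "?G x \<bullet> ?G x = 1" for x
    using gsphere_normal_unit[OF m, of "r x" p l] sub by blast
  have q: "?q (\<Theta> (x, k)) = 2 * k + l * k\<^sup>2" for x k
  proof -
    have "\<Theta> (x, k) - p = (r x - p) + k *\<^sub>R ?G x" by (simp add: \<Theta>_def)
    then have "?q (\<Theta> (x, k)) = ?q (r x) + 2 * k * (?G x \<bullet> ?G x) + l * k\<^sup>2 * (?G x \<bullet> ?G x)"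
      by (simp only:) (simp add: inner_simps inner_commute algebra_simps power2_eq_square)
    moreover have "?q (r x) = 0" using sub by (auto simp: gsphere_def)
    ultimately show ?thesis by (simp add: G1)
  qed
  have G: "m + l *\<^sub>R (\<Theta> (x, k) - p) = (1 + l * k) *\<^sub>R ?G x" for x k
    by (simp add: \<Theta>_def algebra_simps)
  have "inj_on \<Theta> ?S"
  proof (rule inj_onI, clarify)
    fix x k x' k'
    assume k: "k \<in> {- a<..<a}" "k' \<in> {- a<..<a}" and eq: "\<Theta> (x, k) = \<Theta> (x', k')"
    have "2 * k + l * k\<^sup>2 = 2 * k' + l * k'\<^sup>2" using q[of x k] q[of x' k'] eq by simp
    then have "(k - k') * (2 + (l * k + l * k')) = 0" by (simp add: algebra_simps power2_eq_square)
    moreover have "2 + (l * k + l * k') > 0" using small[OF k(1)] small[OF k(2)] by linarith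
    ultimately have kk: "k = k'" by simp
    have "(1 + l * k) *\<^sub>R ?G x = (1 + l * k) *\<^sub>R ?G x'"
      by (metis G eq kk)
    moreover have "1 + l * k \<noteq> 0" using small[OF k(1)] by linarith
    ultimately have "?G x = ?G x'" by simp
    moreover have "r x = \<Theta> (x, k) - k *\<^sub>R ?G x" "r x' = \<Theta> (x', k) - k *\<^sub>R ?G x'"
      by (simp_all add: \<Theta>_def)
    ultimately have "r x = r x'" using eq kk by metis
    then show "x = x' \<and> k = k'" using inj kk by (simp add: inj_eq)
  qed
  moreover have "continuous_on ?S \<Theta>"
  proof -
    have "continuous_on ?S (\<lambda>z. r (fst z))"
      by (rule continuous_on_compose2[OF cont]) (auto intro: continuous_intros)
    then show ?thesis unfolding \<Theta>_def by (intro continuous_intros)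
  qed
  moreover have "open ?S" by (intro open_Times) auto
  ultimately have "open (\<Theta> ` ?S)" by (intro invariance_of_domain)
  moreover have "r x \<in> \<Theta> ` ?S" using a(1) by (intro image_eqI[of _ _ "(x, 0)"]) (auto simp: \<Theta>_def)
  ultimately obtain e where e: "e > 0" "ball (r x) e \<subseteq> \<Theta> ` ?S" by (meson open_contains_ball)
  have "z \<in> range r" if z: "z \<in> ball (r x) e" "z \<in> gsphere p m l" for z
  proof -
    obtain x' k where k: "k \<in> {- a<..<a}" "z = \<Theta> (x', k)" using e z(1) by blast
    have "k * (2 + l * k) = 0"
      using q[of x' k] z(2) k(2) by (simp add: gsphere_def algebra_simps power2_eq_square)
    moreover have "2 + l * k > 0" using small[OF k(1)] by linarith
    ultimately have "k = 0" by simp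
    then show ?thesis using k(2) by (simp add: \<Theta>_def)
  qed
  with that e(1) show ?thesis by blast
qed

text \<open>Near \<open>q\<close>, the plaque of \<open>L\<close> through \<open>q\<close> lies in \<open>Q\<close>. Path components of \<open>L \<inter> W\<close> are used because \<open>L\<close>
itself may return to every neighbourhood of \<open>q\<close>.\<close>

definition leaf_germ_in :: "'b::topological_space set \<Rightarrow> 'b \<Rightarrow> 'b set \<Rightarrow> bool"
  where "leaf_germ_in L q Q \<longleftrightarrow> (\<exists>W. open W \<and> q \<in> W \<and> path_component_set (L \<inter> W) q \<subseteq> Q)"

lemma leaf_germ_in_imp_mem: "leaf_germ_in L q Q \<Longrightarrow> q \<in> L \<Longrightarrow> q \<in> Q"
  unfolding leaf_germ_in_def using path_component_refl by blast

lemma leaf_germ_in_along_path: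
  fixes \<pi> :: "real \<Rightarrow> 'b::topological_space"
  assumes "leaf_germ_in L (\<pi> t) Q" "continuous_on {0..1} \<pi>" "\<pi> ` {0..1} \<subseteq> L" "t \<in> {0..1}"
  obtains T where "openin (top_of_set {0..1}) T" "t \<in> T" "\<And>s. s \<in> T \<Longrightarrow> leaf_germ_in L (\<pi> s) Q"
proof -
  obtain W where W: "open W" "\<pi> t \<in> W" "path_component_set (L \<inter> W) (\<pi> t) \<subseteq> Q"
    using assms(1) by (auto simp: leaf_germ_in_def)
  have "openin (top_of_set {0..1}) ({0..1} \<inter> \<pi> -` W)"
    by (rule continuous_openin_preimage_gen[OF assms(2) W(1)])
  then obtain V where V: "open V" "{0..1} \<inter> \<pi> -` W = {0..1} \<inter> V" by (auto simp: openin_open)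
  have "t \<in> V" using V(2) W(2) assms(4) by blast
  then obtain e where e: "e > 0" "ball t e \<subseteq> V" using openE[OF V(1)] by blast
  let ?T = "{0..1} \<inter> ball t e"
  have tT: "t \<in> ?T" using e(1) assms(4) by simp
  have "convex ?T" by (intro convex_Int convex_ball) simp
  then have "path_connected (\<pi> ` ?T)"
    by (intro path_connected_continuous_image convex_imp_path_connected
        continuous_on_subset[OF assms(2)]) auto
  moreover have "\<pi> ` ?T \<subseteq> L \<inter> W" using V(2) e(2) assms(3) by blast
  ultimately have comp: "\<pi> ` ?T \<subseteq> path_component_set (L \<inter> W) (\<pi> t)"
    using tT by (intro path_component_maximal) auto
  have "leaf_germ_in L (\<pi> s) Q" if "s \<in> ?T" for s
  proof -
    have "\<pi> s \<in> path_component_set (L \<inter> W) (\<pi> t)"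
      using comp that by blast
    then have "path_component_set (L \<inter> W) (\<pi> s) \<subseteq> Q"
      using path_component_eq W(3) by metis
    moreover have "\<pi> s \<in> W" using V(2) e(2) that by blast
    ultimately show ?thesis using W(1) unfolding leaf_germ_in_def by blast
  qed
  moreover have "openin (top_of_set {0..1}) ?T" by (simp add: openin_open_Int)
  ultimately show ?thesis using that tT by blast
qed

definition plaque_chart ::
    "('a::euclidean_space \<times> real) set set \<Rightarrow> ('a \<times> real) set \<Rightarrow> ('a \<times> real \<Rightarrow> 'a \<times> real) \<Rightarrow> ('a \<times> real \<Rightarrow> 'a \<times> real) \<Rightarrow> bool"
  where "plaque_chart F U g f \<longleftrightarrow> open U \<and> homeomorphism UNIV U g f \<and> (\<forall>s. patch (\<lambda>x. g (x, s))) \<and>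
    (\<forall>L\<in>F. \<forall>z\<in>L \<inter> U. path_component_set (L \<inter> U) z = range (\<lambda>x. g (x, snd (f z))))"

lemma plaque_chartD:
  assumes "plaque_chart F U g f"
  shows "open U" "homeomorphism UNIV U g f" "patch (\<lambda>x. g (x, s))"
    "L \<in> F \<Longrightarrow> z \<in> L \<Longrightarrow> z \<in> U \<Longrightarrow> path_component_set (L \<inter> U) z = range (\<lambda>x. g (x, snd (f z)))"
  using assms by (auto simp: plaque_chart_def)

lemma plaque_subset_leaf:
  assumes "path_component_set (L \<inter> U) z = range r"
  shows "r x \<in> L"
  using assms path_component_subset[of "L \<inter> U" z] by blast

lemma plaque_in_gsphere_nbhd:
  fixes g :: "'a::euclidean_space \<times> real \<Rightarrow> 'a \<times> real"
  assumes m: "m \<bullet> m = 1"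
    and chart: "q \<in> U" "homeomorphism UNIV U g f" "patch (\<lambda>x. g (x, snd (f q)))"
      "path_component_set (L \<inter> U) q = range (\<lambda>x. g (x, snd (f q)))"
    and sub: "range (\<lambda>x. g (x, snd (f q))) \<subseteq> gsphere p m l"
  obtains e where "e > 0" "ball q e \<inter> gsphere p m l \<subseteq> L"
proof -
  let ?r = "\<lambda>x. g (x, snd (f q))"
  have "inj ?r"
  proof (rule injI)
    fix x y assume "?r x = ?r y"
    then have "f (?r x) = f (?r y)" by simp
    then show "x = y" using chart(2) by (simp add: homeomorphism_apply1)
  qed
  from gsphere_nbhd_in_range[OF smooth_continuous[OF patch_smooth[OF chart(3)]] this m sub, of "fst (f q)"]
  obtain e where e: "e > 0" "ball (?r (fst (f q))) e \<inter> gsphere p m l \<subseteq> range ?r" .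
  have "?r (fst (f q)) = q" using chart(1,2) by (simp add: homeomorphism_apply2)
  moreover have "range ?r \<subseteq> L" using chart(4) path_component_subset[of "L \<inter> U" q] by blast
  ultimately show ?thesis using e by (intro that[of e]) auto
qed

context
  fixes F :: "('a::euclidean_space \<times> real) set set"
  assumes F: "umbilical_foliation F"
begin

lemma leaf_subset: "L \<in> F \<Longrightarrow> L \<subseteq> halfspace"
  using F by (auto simp: umbilical_foliation_def foliation_def)

lemma leaf_eqI: "L \<in> F \<Longrightarrow> L' \<in> F \<Longrightarrow> q \<in> L \<Longrightarrow> q \<in> L' \<Longrightarrow> L = L'"
  using F by (auto simp: umbilical_foliation_def foliation_def disjoint_def)

lemma leaf_through:
  assumes "q \<in> halfspace"
  obtains L where "L \<in> F" "q \<in> L"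
proof -
  have "\<Union>F = halfspace" using F by (simp add: umbilical_foliation_def foliation_def)
  then have "q \<in> \<Union>F" using assms by simp
  then show ?thesis using that by blast
qed

lemma foliation_chart:
  assumes "q \<in> halfspace"
  obtains U g f where "plaque_chart F U g f" "q \<in> U"
  using F assms unfolding umbilical_foliation_def foliation_def plaque_chart_def by metis

text \<open>A plaque through \<open>q\<close> has a unit normal field near \<open>q\<close>, so the umbilicity of the leaf applies to it.\<close>

lemma leaf_germ_exists:
  assumes L: "L \<in> F" and q: "q \<in> L"
  obtains m l where "m \<bullet> m = 1" "leaf_germ_in L q (gsphere q m l)"
proof -
  obtain U g f where chart: "plaque_chart F U g f" and qU: "q \<in> U"
    using foliation_chart[OF subsetD[OF leaf_subset[OF L] q]] by blast
  note U = plaque_chartD(1)[OF chart] qU and h = plaque_chartD(2)[OF chart]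
    and p = plaque_chartD(3)[OF chart] and c = plaque_chartD(4)[OF chart]
  define x0 s where "x0 = fst (f q)" and "s = snd (f q)"
  let ?r = "\<lambda>x. g (x, s)"
  have rq: "?r x0 = q" using h U(2) by (simp add: x0_def s_def homeomorphism_apply2)
  have pl: "path_component_set (L \<inter> U) q = range ?r" using c[OF L q U(2)] by (simp add: s_def)
  obtain d \<rho> N where d: "d > 0" and \<rho>: "patch \<rho>" "range \<rho> = ?r ` ball x0 d" "unit_normal_field \<rho> N"
    using patch_local_unit_normal[OF p] by metis
  have "range ?r \<subseteq> L" using pl path_component_subset[of "L \<inter> U" q] by blast
  then have "patch_in \<rho> L" using \<rho> by (auto simp: patch_in_def)
  moreover have "totally_umbilical L" using F L by (simp add: umbilical_foliation_def)
  ultimately have u: "\<And>x. \<exists>k. shape_eigenvalues \<rho> N x = {k}"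
    "DIM('a) = 1 \<Longrightarrow> \<exists>k. \<forall>x. shape_eigenvalues \<rho> N x = {k}"
    using \<rho>(3) unfolding totally_umbilical_def by blast+
  obtain l where l: "\<And>x. range \<rho> \<subseteq> gsphere (\<rho> x) (euclidean_normal \<rho> N x) l"
    using umbilic_patch_in_gsphere[OF \<rho>(1,3) u] by metis
  have "q \<in> range \<rho>" unfolding \<rho>(2) using rq d by (intro image_eqI[of _ _ x0]) auto
  then obtain y where y: "q = \<rho> y" by blast
  let ?m = "euclidean_normal \<rho> N y"
  \<comment> \<open>The part of the chart domain over the ball meets the plaque through \<open>q\<close> in the range of \<open>\<rho>\<close>.\<close>
  define W where "W = U \<inter> f -` (ball x0 d \<times> UNIV)"
  have "continuous_on U f" using h by (simp add: homeomorphism_def)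
  then have "open W" unfolding W_def
    by (intro continuous_open_preimage U open_Times) auto
  moreover have "q \<in> W" using U(2) d by (auto simp: W_def x0_def mem_Times_iff)
  moreover have "path_component_set (L \<inter> W) q \<subseteq> gsphere q ?m l"
  proof
    fix z assume z: "z \<in> path_component_set (L \<inter> W) q"
    then have "z \<in> W" using path_component_subset[of "L \<inter> W" q] by blast
    have "z \<in> path_component_set (L \<inter> U) q"
      using z path_component_of_subset[of "L \<inter> W" "L \<inter> U" q z] by (auto simp: W_def)
    then obtain x where x: "z = g (x, s)" using pl by blast
    then have "f z = (x, s)" using h by (simp add: homeomorphism_apply1)
    then have "x \<in> ball x0 d" using \<open>z \<in> W\<close> by (simp add: W_def)
    then have "z \<in> range \<rho>" using x \<rho>(2) by blast
    then show "z \<in> gsphere q ?m l" using l[of y] y by blast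
  qed
  ultimately have "leaf_germ_in L q (gsphere q ?m l)" by (auto simp: leaf_germ_in_def)
  with that euclidean_normal_unit[OF \<rho>(1,3)] show ?thesis by blast
qed

text \<open>Both generalised spheres contain a small piece of the plaque through \<open>q\<close>. Hence they are tangent at \<open>q\<close>
and share a second point.\<close>

lemma leaf_germ_unique:
  assumes L: "L \<in> F" and q: "q \<in> L" and m: "m \<bullet> m = 1" "m' \<bullet> m' = 1"
    and germ: "leaf_germ_in L q (gsphere p m l)" "leaf_germ_in L q (gsphere p' m' l')"
  shows "gsphere p m l = gsphere p' m' l'"
proof -
  have qQ: "q \<in> gsphere p m l" "q \<in> gsphere p' m' l'"
    using germ leaf_germ_in_imp_mem q by blast+
  define n n' where "n = m + l *\<^sub>R (q - p)" and "n' = m' + l' *\<^sub>R (q - p')"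
  have n: "n \<bullet> n = 1" "n' \<bullet> n' = 1"
    unfolding n_def n'_def using gsphere_normal_unit m qQ by blast+
  have Q: "gsphere p m l = gsphere q n l" "gsphere p' m' l' = gsphere q n' l'"
    unfolding n_def n'_def using gsphere_rebase qQ by blast+
  obtain W W' where W: "open W" "q \<in> W" "path_component_set (L \<inter> W) q \<subseteq> gsphere q n l"
    and W': "open W'" "q \<in> W'" "path_component_set (L \<inter> W') q \<subseteq> gsphere q n' l'"
    using germ unfolding Q leaf_germ_in_def by auto
  obtain U g f where chart: "plaque_chart F U g f" and qU: "q \<in> U"
    using foliation_chart[OF subsetD[OF leaf_subset[OF L] q]] by blast
  note U = plaque_chartD(1)[OF chart] qU and h = plaque_chartD(2)[OF chart]
    and p = plaque_chartD(3)[OF chart] and c = plaque_chartD(4)[OF chart]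
  define x0 s where "x0 = fst (f q)" and "s = snd (f q)"
  define r where "r x = g (x, s)" for x
  have r: "patch r" using p by (simp add: r_def[abs_def])
  have rq: "r x0 = q" using h U(2) by (simp add: r_def x0_def s_def homeomorphism_apply2)
  have rL: "range r \<subseteq> L"
    using plaque_subset_leaf[OF c[OF L q U(2)]] by (auto simp: r_def s_def)
  have cr: "continuous_on UNIV r" by (rule smooth_continuous[OF patch_smooth[OF r]])
  have "open (r -` (W \<inter> W'))"
    using W(1) W'(1) by (intro open_vimage cr open_Int)
  moreover have "x0 \<in> r -` (W \<inter> W')" using W(2) W'(2) rq by simp
  ultimately obtain e where e: "e > 0" "ball x0 e \<subseteq> r -` (W \<inter> W')" by (meson open_contains_ball)
  have pc: "path_connected (r ` ball x0 e)"
    by (intro path_connected_continuous_image continuous_on_subset[OF cr] convex_imp_path_connected) auto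
  have q_in: "q \<in> r ` ball x0 e" using rq e(1) by (intro image_eqI[of _ _ x0]) auto
  have "r ` ball x0 e \<subseteq> path_component_set (L \<inter> W) q" "r ` ball x0 e \<subseteq> path_component_set (L \<inter> W') q"
    using e(2) rL by (intro path_component_maximal[OF q_in pc]; blast)+
  then have sub: "r ` ball x0 e \<subseteq> gsphere q n l" "r ` ball x0 e \<subseteq> gsphere q n' l'"
    using W(3) W'(3) by blast+
  have x0: "x0 \<in> ball x0 e" using e(1) by simp
  have orth: "n \<bullet> D r x0 v = 0" "n' \<bullet> D r x0 v = 0" for v
    using gsphere_normal_orthogonal[OF patch_smooth[OF r] open_ball x0 sub(1), of v]
      gsphere_normal_orthogonal[OF patch_smooth[OF r] open_ball x0 sub(2), of v] by (simp_all add: rq)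
  obtain b :: 'a where b: "b \<in> Basis" using nonempty_Basis by blast
  let ?x1 = "x0 + (e / 2) *\<^sub>R b"
  have x1: "?x1 \<in> ball x0 e" using e(1) b by (simp add: dist_norm)
  moreover have "r ?x1 \<noteq> r x0"
  proof
    assume "r ?x1 = r x0"
    then have "f (g (?x1, s)) = f (g (x0, s))" by (simp add: r_def)
    then have "?x1 = x0" using h by (simp add: homeomorphism_apply1)
    then show False using e(1) b nonzero_Basis by auto
  qed
  ultimately have z: "r ?x1 \<in> gsphere q n l" "r ?x1 \<in> gsphere q n' l'" "r ?x1 \<noteq> q"
    using sub rq by auto
  have "n' = n \<or> n' = - n"
    by (rule unit_normal_unique[OF patch_linear[OF r] patch_inj[OF r] n orth])
  then have "gsphere q n l = gsphere q n' l'"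
  proof
    assume "n' = n"
    then show ?thesis using gsphere_tangent_unique z by metis
  next
    assume "n' = - n"
    then have *: "gsphere q n' l' = gsphere q n (- l')" using gsphere_minus[of q n "- l'"] by simp
    then show ?thesis using gsphere_tangent_unique z by metis
  qed
  then show ?thesis using Q by simp
qed

text \<open>Along a path in the leaf, the generalised sphere containing the germ of the leaf is locally constant.\<close>

lemma leaf_in_gsphere:
  assumes L: "L \<in> F" and p: "p \<in> L"
  obtains m l where "m \<bullet> m = 1" "L \<subseteq> gsphere p m l"
proof -
  obtain m l where m: "m \<bullet> m = 1" and germ: "leaf_germ_in L p (gsphere p m l)"
    using leaf_germ_exists[OF L p] .
  let ?Q = "gsphere p m l"
  have "z \<in> ?Q" if z: "z \<in> L" for z
  proof -
    have "path_connected L" using F L by (simp add: umbilical_foliation_def foliation_def)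
    then obtain \<pi> where "path \<pi>" "path_image \<pi> \<subseteq> L" "pathstart \<pi> = p" "pathfinish \<pi> = z"
      using p z unfolding path_connected_def by blast
    then have \<pi>: "continuous_on {0..1} \<pi>" "\<pi> ` {0..1} \<subseteq> L" "\<pi> 0 = p" "\<pi> 1 = z"
      by (simp_all add: path_def path_image_def pathstart_def pathfinish_def)
    have "leaf_germ_in L (\<pi> 0) ?Q \<longleftrightarrow> leaf_germ_in L (\<pi> 1) ?Q"
    proof (rule connected_equivalence_relation[of "{0..1::real}" 0 1
          "\<lambda>s t. leaf_germ_in L (\<pi> s) ?Q \<longleftrightarrow> leaf_germ_in L (\<pi> t) ?Q"])
      fix t :: real assume t: "t \<in> {0..1}"
      then have tL: "\<pi> t \<in> L" using \<pi>(2) by blast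
      obtain m' l' where m': "m' \<bullet> m' = 1" and germ': "leaf_germ_in L (\<pi> t) (gsphere (\<pi> t) m' l')"
        using leaf_germ_exists[OF L tL] .
      let ?Q' = "gsphere (\<pi> t) m' l'"
      obtain T where T: "openin (top_of_set {0..1}) T" "t \<in> T" "\<And>s. s \<in> T \<Longrightarrow> leaf_germ_in L (\<pi> s) ?Q'"
        using leaf_germ_in_along_path[OF germ' \<pi>(1,2) t] by metis
      have "leaf_germ_in L (\<pi> s) ?Q \<longleftrightarrow> ?Q = ?Q'" if "s \<in> T" for s
      proof -
        have "s \<in> {0..1}" using T(1) that openin_imp_subset by blast
        then have "\<pi> s \<in> L" using \<pi>(2) by blast
        then show ?thesis using leaf_germ_unique[OF L _ m m' _ T(3)[OF that]] T(3)[OF that] by metis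
      qed
      then show "\<exists>T. openin (top_of_set {0..1}) T \<and> t \<in> T \<and>
          (\<forall>x\<in>T. leaf_germ_in L (\<pi> t) ?Q \<longleftrightarrow> leaf_germ_in L (\<pi> x) ?Q)"
        using T(1,2) by blast
    qed auto
    then have "leaf_germ_in L z ?Q" using germ \<pi>(3,4) by simp
    then show ?thesis using leaf_germ_in_imp_mem z by blast
  qed
  with that m show ?thesis by blast
qed

lemma leaf_open_in_gsphere:
  assumes L: "L \<in> F" and q: "q \<in> L" and m: "m \<bullet> m = 1" and sub: "L \<subseteq> gsphere p m l"
  obtains e where "e > 0" "ball q e \<inter> gsphere p m l \<subseteq> L"
proof -
  obtain U g f where chart: "plaque_chart F U g f" and qU: "q \<in> U"
    using foliation_chart[OF subsetD[OF leaf_subset[OF L] q]] by blast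
  note U = plaque_chartD(1)[OF chart] qU and h = plaque_chartD(2)[OF chart]
    and p = plaque_chartD(3)[OF chart] and c = plaque_chartD(4)[OF chart]
  note pc = c[OF L q U(2)]
  have "range (\<lambda>x. g (x, snd (f q))) \<subseteq> gsphere p m l"
    using plaque_subset_leaf[OF pc] sub by blast
  from plaque_in_gsphere_nbhd[OF m U(2) h p pc this] that show ?thesis by metis
qed

text \<open>The plaques of \<open>L\<close> near \<open>q\<close> converge to the plaque through \<open>q\<close>, which therefore lies in the generalised
sphere as well. Being open in it, this plaque contains points of \<open>L\<close>, so it is part of \<open>L\<close>.\<close>

lemma leaf_closed_in_gsphere:
  assumes L: "L \<in> F" and m: "m \<bullet> m = 1" and sub: "L \<subseteq> gsphere p m l"
    and q: "q \<in> closure L" "q \<in> halfspace"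
  shows "q \<in> L"
proof -
  obtain L' where L': "L' \<in> F" "q \<in> L'" using leaf_through[OF q(2)] .
  obtain U g f where chart: "plaque_chart F U g f" and qU: "q \<in> U"
    using foliation_chart[OF q(2)] by blast
  note U = plaque_chartD(1)[OF chart] qU and h = plaque_chartD(2)[OF chart]
    and p = plaque_chartD(3)[OF chart] and c = plaque_chartD(4)[OF chart]
  have "g (x, snd (f q)) \<in> gsphere p m l" for x
  proof (rule ccontr)
    assume not: "g (x, snd (f q)) \<notin> gsphere p m l"
    have cf: "continuous_on U f" and cg: "continuous_on UNIV g" using h by (auto simp: homeomorphism_def)
    have "continuous_on U (\<lambda>z. g (x, snd (f z)))"
      by (rule continuous_on_compose2[OF cg]) (auto intro!: continuous_intros cf)
    then have "open (U \<inter> (\<lambda>z. g (x, snd (f z))) -` (- gsphere p m l))"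
      by (intro continuous_open_preimage U open_Compl closed_gsphere)
    moreover have "q \<in> U \<inter> (\<lambda>z. g (x, snd (f z))) -` (- gsphere p m l)" using not U(2) by simp
    ultimately obtain z where "z \<in> L" "z \<in> U" "g (x, snd (f z)) \<notin> gsphere p m l"
      using q(1) unfolding closure_iff_nhds_not_empty by blast
    then show False using plaque_subset_leaf[OF c[OF L]] sub by blast
  qed
  then have "range (\<lambda>x. g (x, snd (f q))) \<subseteq> gsphere p m l" by blast
  from plaque_in_gsphere_nbhd[OF m U(2) h p c[OF L' U(2)] this]
  obtain e where e: "e > 0" "ball q e \<inter> gsphere p m l \<subseteq> L'" .
  from q(1) e(1) obtain z where "z \<in> L" "z \<in> ball q e"
    by (metis closure_approachable dist_commute mem_ball)
  then show ?thesis using e(2) sub leaf_eqI[OF L L'(1)] L'(2) by blast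
qed

text \<open>A leaf is open and closed in the part of its generalised sphere inside the half-space.\<close>

lemma path_stays_in_leaf:
  assumes L: "L \<in> F" and m: "m \<bullet> m = 1" and sub: "L \<subseteq> gsphere p m l"
    and \<pi>: "continuous_on {0..1::real} \<pi>" "\<And>t. t \<in> {0..1} \<Longrightarrow> \<pi> t \<in> gsphere p m l \<inter> halfspace"
    and 0: "\<pi> 0 \<in> L"
  shows "\<pi> 1 \<in> L"
proof -
  have "\<pi> 0 \<in> L \<longleftrightarrow> \<pi> 1 \<in> L"
  proof (rule connected_equivalence_relation[of "{0..1::real}" 0 1 "\<lambda>s t. \<pi> s \<in> L \<longleftrightarrow> \<pi> t \<in> L"])
    fix t :: real assume t: "t \<in> {0..1}"
    obtain V where V: "open V" "\<pi> t \<in> V" "\<And>z. z \<in> V \<Longrightarrow> z \<in> gsphere p m l \<Longrightarrow> z \<in> L \<longleftrightarrow> \<pi> t \<in> L"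
    proof (cases "\<pi> t \<in> L")
      case True
      then obtain e where e: "e > 0" "ball (\<pi> t) e \<inter> gsphere p m l \<subseteq> L"
        using leaf_open_in_gsphere[OF L _ m sub] by metis
      then have "\<pi> t \<in> ball (\<pi> t) e" by simp
      with True e(2) show ?thesis
        by (intro that[OF open_ball, of "\<pi> t" e]) (auto simp del: mem_ball)
    next
      case False
      then have "\<pi> t \<notin> closure L" using leaf_closed_in_gsphere[OF L m sub] \<pi>(2)[OF t] by blast
      moreover have "open (- closure L)" by (intro open_Compl closed_closure)
      ultimately show ?thesis
        using False closure_subset[of L] by (intro that[of "- closure L"]) blast+
    qed
    have "openin (top_of_set {0..1}) ({0..1} \<inter> \<pi> -` V)"
      by (rule continuous_openin_preimage_gen[OF \<pi>(1) V(1)])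
    moreover have "t \<in> {0..1} \<inter> \<pi> -` V" using t V(2) by simp
    moreover have "\<forall>s\<in>{0..1} \<inter> \<pi> -` V. (\<pi> t \<in> L) = (\<pi> s \<in> L)"
      using V(3) \<pi>(2) by blast
    ultimately show "\<exists>T. openin (top_of_set {0..1}) T \<and> t \<in> T \<and> (\<forall>x\<in>T. (\<pi> t \<in> L) = (\<pi> x \<in> L))"
      by blast
  qed auto
  with 0 show ?thesis by simp
qed

end

section \<open>The hyperboloid model\<close>

text \<open>The Lorentz form on \<open>'a \<times> \<real> \<times> \<real>\<close>, with a null pair of coordinates in the last two places.\<close>

definition mink :: "'a::real_inner \<times> real \<times> real \<Rightarrow> 'a \<times> real \<times> real \<Rightarrow> real"
  where "mink X Y = (fst (snd X) * snd (snd Y) + snd (snd X) * fst (snd Y)) / 2 - fst X \<bullet> fst Y"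

lemma mink_commute: "mink X Y = mink Y X"
  by (simp add: mink_def inner_commute)

lemma mink_simps:
  "mink (X + X') Y = mink X Y + mink X' Y" "mink (X - X') Y = mink X Y - mink X' Y"
  "mink (k *\<^sub>R X) Y = k * mink X Y" "mink (- X) Y = - mink X Y"
  "mink Y (X + X') = mink Y X + mink Y X'" "mink Y (X - X') = mink Y X - mink Y X'"
  "mink Y (k *\<^sub>R X) = k * mink Y X" "mink Y (- X) = - mink Y X"
  by (simp_all add: mink_def inner_simps field_simps)

text \<open>The isometry from the half-space to the hyperboloid \<open>mink X X = 1\<close>. Its inverse on the sheet with
positive middle coordinate is \<open>halfspace_point\<close>.\<close>

definition hyperboloid :: "'a::euclidean_space \<times> real \<Rightarrow> 'a \<times> real \<times> real"
  where "hyperboloid p = (1 / snd p) *\<^sub>R (fst p, 1, p \<bullet> p)"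

definition halfspace_point :: "'a::euclidean_space \<times> real \<times> real \<Rightarrow> 'a \<times> real"
  where "halfspace_point X = (1 / fst (snd X)) *\<^sub>R (fst X, 1)"

text \<open>The product of two points of the hyperboloid is the hyperbolic cosine of their distance.\<close>

lemma mink_hyperboloid:
  assumes "p \<in> halfspace" "q \<in> halfspace"
  shows "mink (hyperboloid p) (hyperboloid q) = 1 + ((p - q) \<bullet> (p - q)) / (2 * snd p * snd q)"
proof -
  have pos: "snd p > 0" "snd q > 0" using assms by (auto simp: halfspace_def)
  have "mink (hyperboloid p) (hyperboloid q)
      = (1 / (snd p * snd q)) * ((p \<bullet> p + q \<bullet> q) / 2 - fst p \<bullet> fst q)"
    using pos by (simp add: hyperboloid_def mink_def inner_simps field_simps)
  also have "\<dots> = (1 / (snd p * snd q)) * ((p - q) \<bullet> (p - q) / 2 + snd p * snd q)"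
    by (simp add: inner_simps inner_commute[of q p] inner_prod_def[of p q] field_simps)
  finally show ?thesis using pos by (simp add: field_simps)
qed

lemma halfspace_point_hyperboloid: "p \<in> halfspace \<Longrightarrow> halfspace_point (hyperboloid p) = p"
  by (cases p) (simp add: halfspace_def halfspace_point_def hyperboloid_def)

lemma hyperboloid_halfspace_point:
  assumes "mink X X = 1" "fst (snd X) > 0"
  shows "halfspace_point X \<in> halfspace" "hyperboloid (halfspace_point X) = X"
proof -
  obtain x z w where X: "X = (x, z, w)" by (cases X) auto
  have z: "z > 0" "z * w = 1 + x \<bullet> x" using assms by (simp_all add: X mink_def algebra_simps)
  show "halfspace_point X \<in> halfspace" using z by (simp add: X halfspace_point_def halfspace_def)
  have "halfspace_point X \<bullet> halfspace_point X = (1 + x \<bullet> x) / z\<^sup>2"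
    using z(1) by (simp add: X halfspace_point_def inner_prod_def field_simps power2_eq_square)
  also have "\<dots> = w / z" using z by (simp add: z(2)[symmetric] power2_eq_square)
  finally show "hyperboloid (halfspace_point X) = X" using z(1) by (simp add: X hyperboloid_def halfspace_point_def)
qed

text \<open>A point of the hyperboloid on the other sheet would have product at most \<open>-1\<close> with all points of this
sheet.\<close>

lemma forward_timelike:
  assumes X: "mink X X = 1" and q: "q \<in> halfspace" "mink X (hyperboloid q) > 0"
  shows "fst (snd X) > 0"
proof (rule ccontr)
  assume not: "\<not> fst (snd X) > 0"
  have "fst (snd X) * snd (snd X) = 1 + fst X \<bullet> fst X" using X by (simp add: mink_def)
  moreover have "1 + fst X \<bullet> fst X > 0" by (rule add_pos_nonneg) simp_all
  ultimately have "fst (snd X) \<noteq> 0" by auto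
  with not have "fst (snd (- X)) > 0" by simp
  moreover have "mink (- X) (- X) = 1" using X by (simp add: mink_simps)
  ultimately have d: "halfspace_point (- X) \<in> halfspace" "hyperboloid (halfspace_point (- X)) = - X" using hyperboloid_halfspace_point by blast+
  have "mink (hyperboloid (halfspace_point (- X))) (hyperboloid q) \<ge> 1"
    using mink_hyperboloid[OF d(1) q(1)] d(1) q(1) by (simp add: halfspace_def)
  then show False using q(2) by (simp add: d(2) mink_simps)
qed

definition hyperboloid_derivative :: "'a::euclidean_space \<times> real \<Rightarrow> 'a \<times> real \<Rightarrow> 'a \<times> real \<times> real"
  where "hyperboloid_derivative p w = (1 / snd p) *\<^sub>R (fst w, 0, 2 * (p \<bullet> w)) - (snd w / (snd p)\<^sup>2) *\<^sub>R (fst p, 1, p \<bullet> p)"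

lemma mink_hyperboloid_derivative:
  assumes "p \<in> halfspace" "q \<in> halfspace"
  shows "mink (hyperboloid p) (hyperboloid_derivative q w) =
    - ((p - q) \<bullet> w) / (snd p * snd q) - ((p - q) \<bullet> (p - q)) * snd w / (2 * snd p * (snd q)\<^sup>2)"
proof -
  have pos: "snd p > 0" "snd q > 0" using assms by (auto simp: halfspace_def)
  have "hyperboloid_derivative q w = (1 / snd q) *\<^sub>R (fst w, 0, 2 * (q \<bullet> w)) - (snd w / snd q) *\<^sub>R hyperboloid q"
    using pos by (simp add: hyperboloid_derivative_def hyperboloid_def power2_eq_square)
  then have eq: "mink (hyperboloid p) (hyperboloid_derivative q w) = (1 / (snd p * snd q)) * (q \<bullet> w - fst p \<bullet> fst w)
      - (snd w / snd q) * (1 + ((p - q) \<bullet> (p - q)) / (2 * snd p * snd q))"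
    using pos mink_hyperboloid[OF assms]
    by (simp only: mink_simps) (simp add: mink_def hyperboloid_def inner_simps field_simps)
  have eq': "q \<bullet> w - fst p \<bullet> fst w = - ((p - q) \<bullet> w) + snd p * snd w"
    by (simp add: inner_diff_left inner_prod_def[of p w])
  show ?thesis unfolding eq eq' using pos by (simp add: field_simps power2_eq_square)
qed

text \<open>The functions \<open>e\<^sup>-\<^sup>t (f + f')\<close> and \<open>e\<^sup>t (f - f')\<close> are constant.\<close>

lemma exp_solution:
  fixes f f' :: "real \<Rightarrow> 'b::real_normed_vector"
  assumes "\<And>t. (f has_vector_derivative f' t) (at t)" "\<And>t. (f' has_vector_derivative f t) (at t)"
  obtains A B where "\<And>t. f t = exp t *\<^sub>R A + exp (- t) *\<^sub>R B" "\<And>t. f' t = exp t *\<^sub>R A - exp (- t) *\<^sub>R B"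
proof -
  have "((\<lambda>t. exp (- t) *\<^sub>R (f t + f' t)) has_vector_derivative 0) (at t within UNIV)" for t
    by (rule has_vector_derivative_eq_rhs, rule has_vector_derivative_scaleR,
        rule derivative_eq_intros refl | rule derivative_eq_intros refl has_vector_derivative_add assms)+
      (simp add: algebra_simps)
  then obtain a where a: "\<And>t. exp (- t) *\<^sub>R (f t + f' t) = a"
    using has_vector_derivative_zero_constant[of UNIV "\<lambda>t. exp (- t) *\<^sub>R (f t + f' t)"] by auto
  have "((\<lambda>t. exp t *\<^sub>R (f t - f' t)) has_vector_derivative 0) (at t within UNIV)" for t
    by (rule has_vector_derivative_eq_rhs, rule has_vector_derivative_scaleR,
        rule derivative_eq_intros refl | rule derivative_eq_intros refl has_vector_derivative_diff assms)+
      (simp add: algebra_simps)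
  then obtain b where b: "\<And>t. exp t *\<^sub>R (f t - f' t) = b"
    using has_vector_derivative_zero_constant[of UNIV "\<lambda>t. exp t *\<^sub>R (f t - f' t)"] by auto
  have 1: "f t + f' t = exp t *\<^sub>R a" "f t - f' t = exp (- t) *\<^sub>R b" for t
    using arg_cong[OF a[of t], of "scaleR (exp t)"] arg_cong[OF b[of t], of "scaleR (exp (- t))"]
    by (simp_all add: exp_minus)
  have 2: "f t = (1/2) *\<^sub>R ((f t + f' t) + (f t - f' t))" "f' t = (1/2) *\<^sub>R ((f t + f' t) - (f t - f' t))" for t
    by (simp_all add: scaleR_2[symmetric])
  show ?thesis
    by (rule that[of "(1/2) *\<^sub>R a" "(1/2) *\<^sub>R b"])
      (subst 2, simp only: 1, simp add: algebra_simps)+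
qed

text \<open>For a geodesic in the half-space the lifted curve satisfies \<open>X'' = X\<close>: with
  \<open>W = (x, 1, |\<gamma>|\<^sup>2)\<close> and \<open>z = 1/y\<close>, the geodesic equation at unit speed says
  \<open>z'' = z\<close> and \<open>2 z' W' + z W'' = 0\<close>.\<close>

lemma geodesic_hyperboloid:
  assumes "geodesic_line \<gamma>"
  obtains \<gamma>' A B where
    "\<And>t. \<gamma> t \<in> halfspace" "\<And>t. (\<gamma> has_vector_derivative \<gamma>' t) (at t)"
    "\<And>t. hmetric (\<gamma> t) (\<gamma>' t) (\<gamma>' t) = 1"
    "\<And>t. hyperboloid (\<gamma> t) = exp t *\<^sub>R A + exp (- t) *\<^sub>R B"
    "\<And>t. hyperboloid_derivative (\<gamma> t) (\<gamma>' t) = exp t *\<^sub>R A - exp (- t) *\<^sub>R B"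
proof -
  obtain \<gamma>' \<gamma>'' where "\<forall>t. \<gamma> t \<in> halfspace \<and>
      (\<gamma> has_vector_derivative \<gamma>' t) (at t) \<and>
      (\<gamma>' has_vector_derivative \<gamma>'' t) (at t) \<and>
      hmetric (\<gamma> t) (\<gamma>' t) (\<gamma>' t) = 1 \<and>
      hnabla (\<gamma> t) (\<gamma>' t) (\<gamma>' t) (\<gamma>'' t) = 0"
    using assms unfolding geodesic_line_def by blast
  then have g: "\<And>t. \<gamma> t \<in> halfspace" "\<And>t. (\<gamma> has_vector_derivative \<gamma>' t) (at t)"
    "\<And>t. (\<gamma>' has_vector_derivative \<gamma>'' t) (at t)"
    "\<And>t. hmetric (\<gamma> t) (\<gamma>' t) (\<gamma>' t) = 1"
    "\<And>t. hnabla (\<gamma> t) (\<gamma>' t) (\<gamma>' t) (\<gamma>'' t) = 0" by blast+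
  have y: "snd (\<gamma> t) > 0" for t using g(1)[of t] by (simp add: halfspace_def)
  have sq: "\<gamma>' t \<bullet> \<gamma>' t = (snd (\<gamma> t))\<^sup>2" for t
    using g(4)[of t] y[of t] by (simp add: hmetric_def)
  have g'': "\<gamma>'' t = (2 * snd (\<gamma>' t) / snd (\<gamma> t)) *\<^sub>R \<gamma>' t - (0, snd (\<gamma> t))" for t
  proof -
    have "\<gamma>'' t - (snd (\<gamma>' t) / snd (\<gamma> t)) *\<^sub>R \<gamma>' t - (snd (\<gamma>' t) / snd (\<gamma> t)) *\<^sub>R \<gamma>' t
        + (0, snd (\<gamma> t)) = 0"
      using g(5)[of t] y[of t] by (simp add: hnabla_def sq power2_eq_square)
    then have "\<gamma>'' t = (snd (\<gamma>' t) / snd (\<gamma> t)) *\<^sub>R \<gamma>' t + (snd (\<gamma>' t) / snd (\<gamma> t)) *\<^sub>R \<gamma>' t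
        - (0, snd (\<gamma> t))"
      by (simp add: algebra_simps eq_neg_iff_add_eq_0)
    then show ?thesis by (simp add: scaleR_left_distrib[symmetric])
  qed
  define z z' where "z t = 1 / snd (\<gamma> t)" and "z' t = - snd (\<gamma>' t) / (snd (\<gamma> t))\<^sup>2" for t
  define W W' W'' where "W t = (fst (\<gamma> t), 1::real, \<gamma> t \<bullet> \<gamma> t)"
    and "W' t = (fst (\<gamma>' t), 0::real, 2 * (\<gamma> t \<bullet> \<gamma>' t))"
    and "W'' t = (fst (\<gamma>'' t), 0::real, 2 * (\<gamma>' t \<bullet> \<gamma>' t + \<gamma> t \<bullet> \<gamma>'' t))" for t
  note d = g(2,3)
  have s: "((\<lambda>t. snd (\<gamma> t)) has_real_derivative snd (\<gamma>' t)) (at t)"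
    "((\<lambda>t. snd (\<gamma>' t)) has_real_derivative snd (\<gamma>'' t)) (at t)" for t
    using bounded_linear.has_vector_derivative[OF bounded_linear_snd d(1)]
      bounded_linear.has_vector_derivative[OF bounded_linear_snd d(2)]
    by (simp_all add: has_real_derivative_iff_has_vector_derivative)
  have z: "(z has_real_derivative z' t) (at t)" for t
    unfolding z_def z'_def
    by (rule derivative_eq_intros s refl)+ (use y[of t] in \<open>simp_all add: power2_eq_square\<close>)
  have z': "(z' has_real_derivative z t) (at t)" for t
    unfolding z_def z'_def
    by (rule derivative_eq_intros s refl)+
      (use y[of t] in \<open>simp_all add: g'' field_simps power2_eq_square\<close>)
  have f: "((\<lambda>t. fst (\<gamma> t)) has_vector_derivative fst (\<gamma>' t)) (at t)"
    "((\<lambda>t. fst (\<gamma>' t)) has_vector_derivative fst (\<gamma>'' t)) (at t)" for t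
    by (rule bounded_linear.has_vector_derivative[OF bounded_linear_fst] d)+
  have W: "(W has_vector_derivative W' t) (at t)" for t
  proof -
    have "((\<lambda>t. \<gamma> t \<bullet> \<gamma> t) has_vector_derivative 2 * (\<gamma> t \<bullet> \<gamma>' t)) (at t)"
      using bounded_bilinear.has_vector_derivative[OF bounded_bilinear_inner d(1) d(1), of t]
      by (simp add: inner_commute)
    then show ?thesis unfolding W_def W'_def
      by (intro has_vector_derivative_Pair f has_vector_derivative_const)
  qed
  have W': "(W' has_vector_derivative W'' t) (at t)" for t
  proof -
    have "((\<lambda>t. \<gamma> t \<bullet> \<gamma>' t) has_vector_derivative \<gamma>' t \<bullet> \<gamma>' t + \<gamma> t \<bullet> \<gamma>'' t) (at t)"
      using bounded_bilinear.has_vector_derivative[OF bounded_bilinear_inner d(1) d(2), of t]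
      by (simp add: add.commute)
    from bounded_linear.has_vector_derivative[OF bounded_linear_mult_right[of 2] this]
    show ?thesis unfolding W'_def W''_def
      by (intro has_vector_derivative_Pair f has_vector_derivative_const)
  qed
  have lz: "hyperboloid (\<gamma> t) = z t *\<^sub>R W t" "hyperboloid_derivative (\<gamma> t) (\<gamma>' t) = z t *\<^sub>R W' t + z' t *\<^sub>R W t" for t
    by (simp_all add: hyperboloid_def hyperboloid_derivative_def z_def z'_def W_def W'_def)
  have cancel: "2 *\<^sub>R (z' t *\<^sub>R W' t) + z t *\<^sub>R W'' t = 0" for t
  proof -
    have "\<gamma> t \<bullet> \<gamma>'' t = (2 * snd (\<gamma>' t) / snd (\<gamma> t)) * (\<gamma> t \<bullet> \<gamma>' t) - (snd (\<gamma> t))\<^sup>2"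
      by (simp add: g'' inner_diff_right inner_prod_def[of "\<gamma> t" "(0, _)"] power2_eq_square)
    then have "W'' t = (2 * snd (\<gamma>' t) / snd (\<gamma> t)) *\<^sub>R W' t"
      by (simp add: W''_def W'_def g'' sq)
    then show ?thesis using y[of t]
      by (simp add: z_def z'_def power2_eq_square)
  qed
  have "((\<lambda>t. hyperboloid (\<gamma> t)) has_vector_derivative hyperboloid_derivative (\<gamma> t) (\<gamma>' t)) (at t)" for t
    unfolding lz by (rule has_vector_derivative_scaleR[OF z W])
  moreover have "((\<lambda>t. hyperboloid_derivative (\<gamma> t) (\<gamma>' t)) has_vector_derivative hyperboloid (\<gamma> t)) (at t)" for t
  proof -
    have "((\<lambda>t. z t *\<^sub>R W' t + z' t *\<^sub>R W t) has_vector_derivative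
        (z t *\<^sub>R W'' t + z' t *\<^sub>R W' t) + (z' t *\<^sub>R W' t + z t *\<^sub>R W t)) (at t)"
      by (intro has_vector_derivative_add has_vector_derivative_scaleR z z' W W')
    moreover have "(z t *\<^sub>R W'' t + z' t *\<^sub>R W' t) + (z' t *\<^sub>R W' t + z t *\<^sub>R W t) = z t *\<^sub>R W t"
      using cancel[of t, unfolded scaleR_2] by (simp add: algebra_simps)
    ultimately show ?thesis unfolding lz by simp
  qed
  ultimately obtain A B where "\<And>t. hyperboloid (\<gamma> t) = exp t *\<^sub>R A + exp (- t) *\<^sub>R B"
    "\<And>t. hyperboloid_derivative (\<gamma> t) (\<gamma>' t) = exp t *\<^sub>R A - exp (- t) *\<^sub>R B"
    using exp_solution[of "\<lambda>t. hyperboloid (\<gamma> t)" "\<lambda>t. hyperboloid_derivative (\<gamma> t) (\<gamma>' t)"] by blast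
  with that g(1,2,4) show ?thesis by blast
qed

section \<open>Families of rays in the plane\<close>

text \<open>The point \<open>(u, v)\<close> lies on the line through \<open>(e\<^sup>t, e\<^sup>-\<^sup>t)\<close> in the direction \<open>((1 + h) e\<^sup>t, (1 - h) e\<^sup>-\<^sup>t)\<close>.\<close>

definition ray_eq :: "real \<Rightarrow> real \<Rightarrow> real \<Rightarrow> real \<Rightarrow> bool"
  where "ray_eq t h u v \<longleftrightarrow> (1 - h) * (exp (- t) * u - 1) = (1 + h) * (exp t * v - 1)"

text \<open>This is what the leaves of a foliation give at once: two of the lines that have a common point in the
region \<open>u v \<ge> 1\<close> coincide there. That different lines do not coincide is only known after \<open>|h| \<le> 1\<close>.\<close>

definition equal_or_disjoint_rays :: "(real \<Rightarrow> real) \<Rightarrow> bool"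
  where "equal_or_disjoint_rays h \<longleftrightarrow> (\<forall>s t u v u' v'.
    0 < u \<and> 0 < v \<and> 1 \<le> u * v \<and> 0 < u' \<and> 0 < v' \<and> 1 \<le> u' * v' \<and>
    ray_eq s (h s) u v \<and> ray_eq t (h t) u v \<and> ray_eq s (h s) u' v' \<longrightarrow> ray_eq t (h t) u' v')"

text \<open>The condition that \<open>t + artanh (h t)\<close> is nondecreasing, with denominators cleared in
\<open>exp (2 artanh h) = (1 + h) / (1 - h)\<close>. In this form \<open>h = 1\<close> and \<open>h = -1\<close> count as the values \<open>\<infinity>\<close> and
\<open>-\<infinity>\<close> of \<open>artanh\<close>.\<close>

definition monotone_slopes :: "(real \<Rightarrow> real) \<Rightarrow> bool"
  where "monotone_slopes h \<longleftrightarrow> (\<forall>s t. s < t \<longrightarrow>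
    (1 + h s) * (1 - h t) * exp (s - t) \<le> (1 - h s) * (1 + h t) * exp (t - s))"

lemma ray_eq_start: "ray_eq t h (exp t) (exp (- t))"
  by (simp add: ray_eq_def exp_minus)

lemma ray_eq_geodesic:
  "ray_eq t h (exp s) (exp (- s)) \<longleftrightarrow> (1 - h) * (exp (s - t) - 1) = (1 + h) * (exp (t - s) - 1)"
  by (simp add: ray_eq_def exp_diff exp_minus field_simps)

lemma ray_eq_reflect: "ray_eq (- t) (- h) v u \<longleftrightarrow> ray_eq t h u v"
  by (auto simp: ray_eq_def)

lemma equal_or_disjoint_rays_reflect:
  assumes "equal_or_disjoint_rays h"
  shows "equal_or_disjoint_rays (\<lambda>t. - h (- t))"
  unfolding equal_or_disjoint_rays_def
proof (intro allI impI, elim conjE)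
  fix s t u v u' v' :: real
  assume *: "0 < u" "0 < v" "1 \<le> u * v" "0 < u'" "0 < v'" "1 \<le> u' * v'"
    "ray_eq s (- h (- s)) u v" "ray_eq t (- h (- t)) u v" "ray_eq s (- h (- s)) u' v'"
  have "1 \<le> v * u" "1 \<le> v' * u'" using *(3,6) by (simp_all add: mult.commute)
  moreover have "ray_eq (- s) (h (- s)) v u" "ray_eq (- t) (h (- t)) v u" "ray_eq (- s) (h (- s)) v' u'"
    using *(7-9) ray_eq_reflect[of s "- h (- s)" v u] ray_eq_reflect[of t "- h (- t)" v u]
      ray_eq_reflect[of s "- h (- s)" v' u'] by simp_all
  ultimately have "ray_eq (- t) (h (- t)) v' u'"
    using assms *(1,2,4,5) unfolding equal_or_disjoint_rays_def by blast
  then show "ray_eq t (- h (- t)) u' v'" using ray_eq_reflect[of t "- h (- t)" v' u'] by simp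
qed

text \<open>A slope \<open>h t > 1\<close> would give a chord of the hyperbola, ending at some \<open>t'\<close> with
  \<open>h t' = - h t\<close>. Between \<open>t\<close> and \<open>t'\<close> there is a ray with \<open>h m = 0\<close>, which crosses the chord.\<close>

lemma rays_slope_le_1:
  assumes rays: "equal_or_disjoint_rays h" and cont: "continuous_on UNIV h"
  shows "h t \<le> 1"
proof (rule ccontr)
  assume "\<not> h t \<le> 1"
  define H where "H = h t"
  have H: "H > 1" using \<open>\<not> h t \<le> 1\<close> by (simp add: H_def)
  define k where "k = (H + 1) / (H - 1)"
  have k: "k > 1" using H by (simp add: k_def field_simps)
  define t' where "t' = t + ln k"
  have tt': "t < t'" using k by (simp add: t'_def)
  have e: "exp (t' - t) = k" "exp (t - t') = 1 / k"
    using k by (simp_all add: t'_def exp_minus field_simps)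
  have "(1 - H) * (k - 1) = (1 + H) * (1 / k - 1)"
    using H by (simp add: k_def field_simps)
  then have "ray_eq t (h t) (exp t') (exp (- t'))"
    unfolding ray_eq_geodesic e H_def .
  then have "ray_eq t' (h t') (exp t) (exp (- t))"
    using rays ray_eq_start[of t "h t"] ray_eq_start[of t' "h t'"]
    unfolding equal_or_disjoint_rays_def by (metis exp_gt_zero exp_minus_inverse order_refl)
  then have "(1 - h t') * (1 / k - 1) = (1 + h t') * (k - 1)"
    unfolding ray_eq_geodesic e .
  then have "(k - 1) * ((1 - h t') + (1 + h t') * k) = 0"
    using k by (simp add: field_simps)
  then have "(1 - h t') + (1 + h t') * k = 0" using k by simp
  then have "(1 - h t') * (H - 1) + (1 + h t') * (H + 1) = 0"
    using H by (simp add: k_def field_simps)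
  then have t': "h t' = - H" by (simp add: algebra_simps)
  have "\<exists>m\<ge>t. m \<le> t' \<and> h m = 0"
    by (rule IVT2') (use H t' tt' cont in \<open>auto simp: H_def intro: continuous_on_subset\<close>)
  then obtain m where m: "t \<le> m" "m \<le> t'" "h m = 0" by blast
  define a where "a = exp (m - t)"
  have a: "1 \<le> a" "a \<le> k" using m e(1) by (simp_all add: a_def) (metis diff_right_mono exp_le_cancel_iff)
  have a_inv: "exp (t - m) = 1 / a" by (simp add: a_def exp_diff)
  have chord: "(H - 1) * a + (H + 1) / a \<le> 2 * H"
  proof -
    have "(H - 1) * a \<le> H + 1" using a(2) H by (simp add: k_def field_simps)
    then have "(a - 1) * ((H - 1) * a - (H + 1)) \<le> 0" using a(1) by (simp add: mult_nonneg_nonpos)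
    then show ?thesis using a(1) by (simp add: field_simps)
  qed
  have den: "(H - 1) * a + (H + 1) / a > 0" using H a(1) by (intro add_pos_pos) auto
  \<comment> \<open>The ray with \<open>h m = 0\<close> is \<open>c (e\<^sup>m, e\<^sup>-\<^sup>m)\<close> with \<open>c \<ge> 1\<close>; this is its intersection with the chord.\<close>
  define c where "c = 2 * H / ((H - 1) * a + (H + 1) / a)"
  have c: "c \<ge> 1" using chord den by (simp add: c_def field_simps)
  have cc: "c * ((H - 1) * a + (H + 1) / a) = 2 * H" using den by (simp add: c_def)
  let ?u = "c * exp m" and ?v = "c * exp (- m)"
  have "?u > 0" "?v > 0" using c by simp_all
  moreover have "1 \<le> ?u * ?v"
  proof -
    have "?u * ?v = (c * c) * (exp m * exp (- m))" by (simp only: ac_simps)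
    then have "?u * ?v = c * c" by (simp only: exp_minus_inverse mult_1_right)
    then show ?thesis using mult_ge1_I[OF c c] by linarith
  qed
  moreover have "ray_eq m (h m) ?u ?v" by (simp add: ray_eq_def m(3) exp_minus)
  moreover have "ray_eq t (h t) ?u ?v"
  proof -
    have "exp (- t) * ?u = c * a" "exp t * ?v = c / a"
      using a_inv by (simp_all add: a_def exp_diff exp_minus field_simps)
    moreover have "(1 - H) * (c * a - 1) = (1 + H) * (c / a - 1)"
      using cc by (simp add: algebra_simps)
    ultimately show ?thesis by (simp only: ray_eq_def H_def)
  qed
  ultimately have "ray_eq t (h t) (exp m) (exp (- m))"
    using rays ray_eq_start[of m "h m"]
    unfolding equal_or_disjoint_rays_def by (metis exp_gt_zero exp_minus_inverse order_refl)
  then have "(1 - H) * (a - 1) = (1 + H) * (1 / a - 1)"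
    unfolding ray_eq_geodesic H_def a_inv a_def[symmetric] .
  moreover have "(1 + H) * (1 / a - 1) * a = (1 + H) * (1 - a)" using a(1) by (simp add: field_simps)
  ultimately have "(1 - H) * (a - 1) * a = (1 + H) * (1 - a)" by simp
  then have "(a - 1) * ((H - 1) * a - (H + 1)) = 0" by (simp add: algebra_simps)
  then have "a = 1 \<or> (H - 1) * a = H + 1" unfolding mult_eq_0_iff by linarith
  then have "a = 1 \<or> a = k" using H by (auto simp: k_def field_simps)
  then have "m = t \<or> m = t'"
    using e(1) by (auto simp: a_def dest: arg_cong[of _ _ ln])
  then show False using m(3) t' H by (auto simp: H_def)
qed

lemma rays_slope_bounded:
  assumes rays: "equal_or_disjoint_rays h" and cont: "continuous_on UNIV h"
  shows "\<bar>h t\<bar> \<le> 1"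
proof -
  have "continuous_on UNIV (\<lambda>t. - h (- t))"
    by (intro continuous_intros continuous_on_compose2[OF cont]) auto
  then have "- h (- (- t)) \<le> 1"
    using rays_slope_le_1[OF equal_or_disjoint_rays_reflect[OF rays]] by blast
  then show ?thesis using rays_slope_le_1[OF assms, of t] by simp
qed

text \<open>With \<open>e = exp (t - s)\<close>, this expression is the defining function of the line of \<open>s\<close> at the point of
the hyperbola with time \<open>t > s\<close>.\<close>

lemma later_start_off_ray:
  fixes h e :: real
  assumes "0 \<le> 1 + h" "0 \<le> 1 - h" "e > 1"
  shows "(1 - h) * (e - 1) + (1 + h) * (1 - 1 / e) > 0"
proof (cases "h = 1")
  case True
  then show ?thesis using assms(3) by (simp add: field_simps)
next
  case False
  then have "(1 - h) * (e - 1) > 0" using assms(2,3) by simp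
  moreover have "(1 + h) * (1 - 1 / e) \<ge> 0" using assms(1,3) by simp
  ultimately show ?thesis by linarith
qed

lemma ray_point_product:
  "(exp t * (1 + c * (1 + h))) * (exp (- t) * (1 + c * (1 - h))) = 1 + (2 * c + c\<^sup>2 * (1 - h\<^sup>2))"
  for c h t :: real
proof -
  have "(exp t * (1 + c * (1 + h))) * (exp (- t) * (1 + c * (1 - h)))
      = (exp t * exp (- t)) * ((1 + c * (1 + h)) * (1 + c * (1 - h)))"
    by (simp only: ac_simps)
  also have "\<dots> = (1 + c * (1 + h)) * (1 + c * (1 - h))"
    by (simp only: exp_minus_inverse mult_1_left)
  finally show ?thesis by (simp add: algebra_simps power2_eq_square)
qed

text \<open>If the later ray is steeper than the earlier one, the two rays meet. Then they coincide, so the line of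
the earlier ray passes through the starting point of the later one; but that point lies strictly on
one side of the line.\<close>

lemma rays_monotone_slopes:
  assumes rays: "equal_or_disjoint_rays h" and bound: "\<And>t. \<bar>h t\<bar> \<le> 1"
  shows "monotone_slopes h"
  unfolding monotone_slopes_def
proof (intro allI impI, rule ccontr)
  fix s t :: real
  assume st: "s < t"
  define e where "e = exp (t - s)"
  have e: "e > 1" "exp (s - t) = 1 / e" using st by (simp_all add: e_def exp_diff)
  assume "\<not> (1 + h s) * (1 - h t) * exp (s - t) \<le> (1 - h s) * (1 + h t) * exp (t - s)"
  then have D: "(1 + h s) * (1 - h t) / e - (1 - h s) * (1 + h t) * e > 0" (is "?D > 0")
    by (simp add: e_def[symmetric] e(2))
  have hs: "0 \<le> 1 + h s" "0 \<le> 1 - h s" "0 \<le> 1 + h t" "0 \<le> 1 - h t"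
    using bound[of s] bound[of t] by auto
  have num: "(1 - h s) * (e - 1) + (1 + h s) * (1 - 1 / e) > 0" (is "?N > 0")
    by (rule later_start_off_ray[OF hs(1,2) e(1)])
  \<comment> \<open>The parameter of the intersection point on the ray of \<open>t\<close>.\<close>
  define c where "c = ?N / ?D"
  have c: "c \<ge> 0" "c * ?D = ?N" using num D by (simp_all add: c_def)
  let ?u = "exp t * (1 + c * (1 + h t))" and ?v = "exp (- t) * (1 + c * (1 - h t))"
  have ge: "1 + c * (1 + h t) \<ge> 1" "1 + c * (1 - h t) \<ge> 1" using c hs by simp_all
  have "?u > 0" "?v > 0" using ge by (simp_all add: zero_less_mult_iff)
  moreover have "1 \<le> ?u * ?v"
    unfolding ray_point_product using c(1) bound[of t] by (simp add: abs_square_le_1)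
  moreover have "ray_eq t (h t) ?u ?v" by (simp add: ray_eq_def exp_minus algebra_simps)
  moreover have "ray_eq s (h s) ?u ?v"
  proof -
    have ea: "exp (- s) * ?u = e * (1 + c * (1 + h t))" "exp s * ?v = (1 / e) * (1 + c * (1 - h t))"
      by (simp_all add: e_def exp_diff exp_minus field_simps)
    have "(1 - h s) * (e * (1 + c * (1 + h t)) - 1) - (1 + h s) * ((1 / e) * (1 + c * (1 - h t)) - 1)
        = ?N - c * ?D"
      by (simp add: algebra_simps diff_divide_distrib add_divide_distrib)
    then show ?thesis unfolding ray_eq_def ea using c(2) by linarith
  qed
  ultimately have "ray_eq s (h s) (exp t) (exp (- t))"
    using rays ray_eq_start[of t "h t"]
    unfolding equal_or_disjoint_rays_def by (metis exp_gt_zero exp_minus_inverse order_refl)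
  then have "(1 - h s) * (e - 1) = (1 + h s) * (1 / e - 1)"
    unfolding ray_eq_geodesic e(2) e_def[symmetric] .
  then show False using num by (simp add: algebra_simps)
qed

text \<open>The lower bound for \<open>e\<^sup>-\<^sup>t u + e\<^sup>t v\<close> holds in the region \<open>u v \<ge> 1\<close> and selects the forward half of the line.\<close>

lemma ray_eq_parametrise:
  assumes "ray_eq t h u v" "\<bar>h\<bar> \<le> 1" "exp (- t) * u + exp t * v \<ge> 2"
  obtains c where "c \<ge> 0" "u = exp t * (1 + c * (1 + h))" "v = exp (- t) * (1 + c * (1 - h))"
proof -
  define a b where "a = exp (- t) * u - 1" and "b = exp t * v - 1"
  have ab: "(1 - h) * a = (1 + h) * b" using assms(1) by (simp add: ray_eq_def a_def b_def)
  let ?c = "(a + b) / 2"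
  have "?c \<ge> 0" using assms(3) by (simp add: a_def b_def)
  moreover have "a = ?c * (1 + h)" "b = ?c * (1 - h)" using ab by (simp_all add: field_simps)
  then have "exp t * (1 + a) = exp t * (1 + ?c * (1 + h))" "exp (- t) * (1 + b) = exp (- t) * (1 + ?c * (1 - h))"
    by simp_all
  moreover have "exp t * (1 + a) = u" "exp (- t) * (1 + b) = v"
    by (simp_all add: a_def b_def exp_minus)
  ultimately show ?thesis using that by metis
qed

text \<open>Relative to the line of an earlier ray, the starting point of a later ray lies strictly on one side,
and by monotonicity the later ray does not move back towards the line.\<close>

lemma monotone_slopes_disjoint:
  assumes mono: "monotone_slopes h" and bound: "\<And>t. \<bar>h t\<bar> \<le> 1"
    and rays: "ray_eq s (h s) u v" "ray_eq t (h t) u v"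
    and uv: "\<And>t. exp (- t) * u + exp t * v \<ge> 2"
  shows "s = t"
proof -
  have False if rays: "ray_eq s (h s) u v" "ray_eq t (h t) u v" and st: "s < t" for s t
  proof -
    define e where "e = exp (t - s)"
    have e: "e > 1" "exp (s - t) = 1 / e" using st by (simp_all add: e_def exp_diff)
    have hs: "0 \<le> 1 + h s" "0 \<le> 1 - h s" using bound[of s] by auto
    obtain c where c: "c \<ge> 0" "u = exp t * (1 + c * (1 + h t))" "v = exp (- t) * (1 + c * (1 - h t))"
      using ray_eq_parametrise[OF rays(2) bound uv] .
    have "exp (- s) * u = e * (1 + c * (1 + h t))" "exp s * v = (1 / e) * (1 + c * (1 - h t))"
      by (simp_all add: c e_def exp_diff exp_minus field_simps)
    then have "0 = (1 - h s) * (e * (1 + c * (1 + h t)) - 1) - (1 + h s) * ((1 / e) * (1 + c * (1 - h t)) - 1)"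
      using rays(1) by (simp add: ray_eq_def)
    also have "\<dots> = (1 - h s) * (e - 1) + (1 + h s) * (1 - 1 / e)
        + c * ((1 - h s) * (1 + h t) * e - (1 + h s) * (1 - h t) * (1 / e))"
      by (simp add: algebra_simps diff_divide_distrib add_divide_distrib)
    finally have eq: "(1 - h s) * (e - 1) + (1 + h s) * (1 - 1 / e)
        + c * ((1 - h s) * (1 + h t) * e - (1 + h s) * (1 - h t) * (1 / e)) = 0" by simp
    have "(1 - h s) * (1 + h t) * e - (1 + h s) * (1 - h t) * (1 / e) \<ge> 0"
      using mono st unfolding monotone_slopes_def by (metis e(2) e_def diff_ge_0_iff_ge)
    then have "c * ((1 - h s) * (1 + h t) * e - (1 + h s) * (1 - h t) * (1 / e)) \<ge> 0"
      using c(1) by simp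
    moreover have "(1 - h s) * (e - 1) + (1 + h s) * (1 - 1 / e) > 0"
      by (rule later_start_off_ray[OF hs e(1)])
    ultimately show False using eq by linarith
  qed
  then show ?thesis using rays by (metis linorder_neqE_linordered_idom)
qed

lemma artanh_slope:
  assumes "\<bar>x\<bar> < (1::real)" "\<bar>y\<bar> < 1"
  shows "(- artanh y) - (- artanh x) \<le> t - s \<longleftrightarrow>
    (1 + x) * (1 - y) * exp (s - t) \<le> (1 - x) * (1 + y) * exp (t - s)"
proof -
  have p: "1 + x > 0" "1 - x > 0" "1 + y > 0" "1 - y > 0" using assms by auto
  have "(1 + x) * (1 - y) * exp (s - t) \<le> (1 - x) * (1 + y) * exp (t - s)
      \<longleftrightarrow> ln ((1 + x) * (1 - y) * exp (s - t)) \<le> ln ((1 - x) * (1 + y) * exp (t - s))"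
    using p by (intro ln_le_cancel_iff[symmetric]) auto
  also have "ln ((1 + x) * (1 - y) * exp (s - t)) = ln (1 + x) + ln (1 - y) + (s - t)"
    using p by (simp add: ln_mult)
  also have "ln ((1 - x) * (1 + y) * exp (t - s)) = ln (1 - x) + ln (1 + y) + (t - s)"
    using p by (simp add: ln_mult)
  finally have *: "(1 + x) * (1 - y) * exp (s - t) \<le> (1 - x) * (1 + y) * exp (t - s)
      \<longleftrightarrow> ln (1 + x) + ln (1 - y) + (s - t) \<le> ln (1 - x) + ln (1 + y) + (t - s)" .
  have a: "artanh x = (ln (1 + x) - ln (1 - x)) / 2" "artanh y = (ln (1 + y) - ln (1 - y)) / 2"
    using p by (simp_all add: artanh_def ln_div)
  show ?thesis unfolding * a by (auto simp: field_simps)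
qed

lemma route_condition_imp_monotone_slopes:
  assumes route: "route_condition h t1 t2" and bound: "\<And>t. \<bar>h t\<bar> \<le> 1"
  shows "monotone_slopes h"
  unfolding monotone_slopes_def
proof (intro allI impI)
  fix s t :: real assume st: "s < t"
  have hs: "0 \<le> 1 + h s" "0 \<le> 1 - h s" "0 \<le> 1 + h t" "0 \<le> 1 - h t"
    using bound[of s] bound[of t] by auto
  show "(1 + h s) * (1 - h t) * exp (s - t) \<le> (1 - h s) * (1 + h t) * exp (t - s)"
  proof (cases "h s = -1 \<or> h t = 1")
    case True
    then show ?thesis using hs by auto
  next
    case False
    then have "t1 < ereal s" "ereal t < t2"
      using route unfolding route_condition_def not_le[symmetric] by blast+
    moreover have "ereal s < ereal t" using st by simp
    ultimately have less: "t1 < ereal s" "ereal s < t2" "t1 < ereal t" "ereal t < t2"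
      by (blast intro: order.strict_trans)+
    then have b: "\<bar>h s\<bar> < 1" "\<bar>h t\<bar> < 1" using route unfolding route_condition_def by blast+
    have "(- artanh (h t)) - (- artanh (h s)) \<le> t - s"
      using route less st unfolding route_condition_def by (metis less_imp_le)
    then show ?thesis unfolding artanh_slope[OF b] .
  qed
qed

text \<open>By monotonicity, \<open>h = -1\<close> persists to the left and \<open>h = 1\<close> persists to the right. The bounds \<open>t\<^sub>1\<close> and
\<open>t\<^sub>2\<close> are the ends of these sets, which are closed because \<open>h\<close> is continuous.\<close>

lemma monotone_slopes_imp_route_condition:
  assumes mono: "monotone_slopes h" and bound: "\<And>t. \<bar>h t\<bar> \<le> 1" and cont: "continuous_on UNIV h"
  shows "\<exists>t1 t2. route_condition h t1 t2"
proof -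
  define t1 where "t1 = Sup (ereal ` {t. h t = -1})"
  define t2 where "t2 = Inf (ereal ` {t. h t = 1})"
  have down: "h s = -1" if "h t = -1" "s < t" for s t
  proof -
    have "(1 + h s) * 2 * exp (s - t) \<le> 0" using mono that unfolding monotone_slopes_def by fastforce
    then have "1 + h s \<le> 0" by (simp add: mult_le_0_iff)
    then show ?thesis using bound[of s] by simp
  qed
  have up: "h t = 1" if "h s = 1" "s < t" for s t
  proof -
    have "2 * (1 - h t) * exp (s - t) \<le> 0" using mono that unfolding monotone_slopes_def by fastforce
    then have "1 - h t \<le> 0" by (simp add: mult_le_0_iff)
    then show ?thesis using bound[of t] by simp
  qed
  have cl: "closed {t. h t = c}" for c
    using cont by (intro closed_Collect_eq continuous_intros) auto
  have "h t = -1" if "ereal t \<le> t1" for t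
  proof (rule ccontr)
    assume "h t \<noteq> -1"
    then obtain e where e: "e > 0" "ball t e \<subseteq> - {t. h t = -1}"
      using cl[of "-1"] open_contains_ball[of "- {t. h t = -1}"] by auto
    have "ereal s \<le> ereal (t - e)" if s: "h s = -1" for s
    proof (rule ccontr)
      assume "\<not> ereal s \<le> ereal (t - e)"
      then have "t - e < s" by simp
      moreover have "\<not> t \<le> s" using down[OF s, of t] \<open>h t \<noteq> -1\<close> s by (cases "t = s") auto
      ultimately have "s \<in> ball t e" by (simp add: dist_real_def)
      then show False using e(2) s by blast
    qed
    then have "t1 \<le> ereal (t - e)" unfolding t1_def by (intro Sup_least) auto
    with that have "ereal t \<le> ereal (t - e)" by (rule order_trans)
    then show False using e(1) by simp
  qed
  moreover have "h t = 1" if "t2 \<le> ereal t" for t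
  proof (rule ccontr)
    assume "h t \<noteq> 1"
    then obtain e where e: "e > 0" "ball t e \<subseteq> - {t. h t = 1}"
      using cl[of 1] open_contains_ball[of "- {t. h t = 1}"] by auto
    have "ereal (t + e) \<le> ereal s" if s: "h s = 1" for s
    proof (rule ccontr)
      assume "\<not> ereal (t + e) \<le> ereal s"
      then have "s < t + e" by simp
      moreover have "\<not> s \<le> t" using up[OF s, of t] \<open>h t \<noteq> 1\<close> s by (cases "t = s") auto
      ultimately have "s \<in> ball t e" by (simp add: dist_real_def)
      then show False using e(2) s by blast
    qed
    then have "ereal (t + e) \<le> t2" unfolding t2_def by (intro Inf_greatest) auto
    then have "ereal (t + e) \<le> ereal t" using that by (rule order_trans)
    then show False using e(1) by simp
  qed
  moreover have inside: "\<bar>h t\<bar> < 1" if "t1 < ereal t" "ereal t < t2" for t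
  proof -
    have "h t \<noteq> -1" using that(1) Sup_upper[of "ereal t" "ereal ` {t. h t = -1}"]
      unfolding t1_def by (auto simp: not_le[symmetric])
    moreover have "h t \<noteq> 1" using that(2) Inf_lower[of "ereal t" "ereal ` {t. h t = 1}"]
      unfolding t2_def by (auto simp: not_le[symmetric])
    ultimately show ?thesis using bound[of t] by auto
  qed
  moreover have "(- artanh (h t)) - (- artanh (h s)) \<le> t - s"
    if st: "t1 < ereal s" "s \<le> t" "ereal t < t2" for s t
  proof (cases "s = t")
    case False
    then have less: "s < t" using st(2) by simp
    then have "ereal s < ereal t" by simp
    then have "t1 < ereal t" "ereal s < t2" using st by (blast intro: order.strict_trans)+
    then have b: "\<bar>h s\<bar> < 1" "\<bar>h t\<bar> < 1" using inside st by blast+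
    show ?thesis
      unfolding artanh_slope[OF b] using mono less unfolding monotone_slopes_def by blast
  qed simp
  ultimately show ?thesis unfolding route_condition_def by blast
qed

section \<open>Fermi coordinates along a geodesic\<close>

text \<open>The orthogonal complement of the plane spanned by \<open>A\<close> and \<open>B\<close> is negative definite; \<open>E\<close> parametrises it
isometrically and \<open>P\<close> inverts \<open>E\<close>. The vectors \<open>(x, 0, 2 c \<bullet> x)\<close>, where \<open>c\<close> is the ideal point of \<open>B\<close>, are
orthogonal to \<open>B\<close> and have the right products. Adding multiples of the null vector \<open>B\<close> does not change
this and makes them orthogonal to \<open>A\<close>.\<close>

lemma null_pair_complement:
  fixes A B :: "'a::euclidean_space \<times> real \<times> real"
  assumes null: "mink B B = 0" "mink A B = 1 / 2" and B: "fst (snd B) > 0"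
  obtains E :: "'a \<Rightarrow> 'a \<times> real \<times> real" and P
  where "linear E" "linear P" "\<And>x y. mink (E x) (E y) = - (x \<bullet> y)"
    "\<And>x. mink (E x) A = 0" "\<And>x. mink (E x) B = 0"
    "\<And>Y. mink Y A = 0 \<Longrightarrow> mink Y B = 0 \<Longrightarrow> E (P Y) = Y"
proof -
  define b where "b = fst (snd B)"
  define c where "c = (1 / b) *\<^sub>R fst B"
  have b: "b > 0" using B by (simp add: b_def)
  have BA: "mink B A = 1 / 2" using null(2) by (simp add: mink_commute)
  have fB: "fst B = b *\<^sub>R c" using b by (simp add: c_def)
  define H :: "'a \<Rightarrow> 'a \<times> real \<times> real" where "H x = (x, 0, 2 * (c \<bullet> x))" for x
  define E where "E x = H x - (2 * mink (H x) A) *\<^sub>R B" for x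
  define P where "P Y = fst Y - fst (snd Y) *\<^sub>R c" for Y :: "'a \<times> real \<times> real"
  have HB: "mink (H x) B = 0" for x
    by (simp add: mink_def H_def fB b_def[symmetric] inner_commute)
  have HH: "mink (H x) (H y) = - (x \<bullet> y)" for x y by (simp add: mink_def H_def)
  have lH: "linear H"
    by (rule linearI) (simp_all add: H_def inner_simps algebra_simps)
  have "linear E"
    by (rule linearI) (simp_all add: E_def linear_add[OF lH] linear_scale[OF lH] mink_simps algebra_simps)
  moreover have "linear P" by (rule linearI) (simp_all add: P_def algebra_simps)
  moreover have "mink (E x) (E y) = - (x \<bullet> y)" for x y
    by (simp add: E_def mink_simps HB HH null mink_commute[of B "H y"])
  moreover have "mink (E x) A = 0" for x
    by (simp add: E_def mink_simps BA)
  moreover have "mink (E x) B = 0" for x by (simp add: E_def mink_simps HB null)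
  moreover have "E (P Y) = Y" if Y: "mink Y A = 0" "mink Y B = 0" for Y
  proof -
    let ?k = "fst (snd Y) / b"
    define Z where "Z = Y - ?k *\<^sub>R B"
    have "mink Z B = 0" using Y null by (simp add: Z_def mink_simps)
    moreover have Z: "fst Z = P Y" "fst (snd Z) = 0"
      using b by (simp_all add: Z_def P_def fB b_def[symmetric])
    ultimately have "snd (snd Z) = 2 * (c \<bullet> P Y)"
      using b by (simp add: mink_def fB b_def[symmetric] inner_commute)
    then have ZH: "Z = H (P Y)" using Z by (simp add: H_def prod_eq_iff)
    have "mink Z A + ?k / 2 = 0" using Y by (simp add: Z_def mink_simps BA)
    then have "?k = - 2 * mink (H (P Y)) A" by (simp add: ZH)
    moreover have "Y = H (P Y) + ?k *\<^sub>R B" by (simp add: ZH[symmetric] Z_def)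
    ultimately show ?thesis by (metis E_def add_uminus_conv_diff mult_minus_left scaleR_minus_left)
  qed
  ultimately show ?thesis using that[of E P] by blast
qed

text \<open>A geodesic in the hyperboloid model, together with an isometric parametrisation \<open>E\<close> of its constant
normal space and the inverse \<open>P\<close> of \<open>E\<close>.\<close>

locale fermi_frame =
  fixes \<gamma> \<gamma>' :: "real \<Rightarrow> 'a::euclidean_space \<times> real"
    and A B :: "'a \<times> real \<times> real" and E :: "'a \<Rightarrow> 'a \<times> real \<times> real" and P :: "'a \<times> real \<times> real \<Rightarrow> 'a"
  assumes \<gamma>_in: "\<gamma> t \<in> halfspace"
    and \<gamma>_derivative: "(\<gamma> has_vector_derivative \<gamma>' t) (at t)"
    and \<gamma>_unit: "hmetric (\<gamma> t) (\<gamma>' t) (\<gamma>' t) = 1"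
    and hyperboloid_\<gamma>: "hyperboloid (\<gamma> t) = exp t *\<^sub>R A + exp (- t) *\<^sub>R B"
    and hyperboloid_derivative_\<gamma>: "hyperboloid_derivative (\<gamma> t) (\<gamma>' t) = exp t *\<^sub>R A - exp (- t) *\<^sub>R B"
    and null: "mink A A = 0" "mink B B = 0" "mink A B = 1 / 2"
    and linear_E: "linear E" and linear_P: "linear P"
    and E_isometry: "mink (E x) (E y) = - (x \<bullet> y)"
    and E_orth: "mink (E x) A = 0" "mink (E x) B = 0"
    and E_P: "mink Y A = 0 \<Longrightarrow> mink Y B = 0 \<Longrightarrow> E (P Y) = Y"

lemma geodesic_line_fermi_frame:
  fixes \<gamma> :: "real \<Rightarrow> 'a::euclidean_space \<times> real"
  assumes "geodesic_line \<gamma>"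
  obtains \<gamma>' A B E P where "fermi_frame \<gamma> \<gamma>' A B E P"
proof -
  obtain \<gamma>' A B where g: "\<And>t. \<gamma> t \<in> halfspace" "\<And>t. (\<gamma> has_vector_derivative \<gamma>' t) (at t)"
    "\<And>t. hmetric (\<gamma> t) (\<gamma>' t) (\<gamma>' t) = 1"
    "\<And>t. hyperboloid (\<gamma> t) = exp t *\<^sub>R A + exp (- t) *\<^sub>R B"
    "\<And>t. hyperboloid_derivative (\<gamma> t) (\<gamma>' t) = exp t *\<^sub>R A - exp (- t) *\<^sub>R B"
    using geodesic_hyperboloid[OF assms] by metis
  have q: "(exp t)\<^sup>2 * mink A A + 2 * mink A B + (exp (- t))\<^sup>2 * mink B B = 1" for t
  proof -
    have "mink (hyperboloid (\<gamma> t)) (hyperboloid (\<gamma> t)) = 1" using mink_hyperboloid[OF g(1) g(1), of t t] by simp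
    moreover have "mink (hyperboloid (\<gamma> t)) (hyperboloid (\<gamma> t))
        = (exp t)\<^sup>2 * mink A A + 2 * (exp t * exp (- t)) * mink A B + (exp (- t))\<^sup>2 * mink B B"
      by (simp add: g(4) mink_simps mink_commute[of B A] power2_eq_square algebra_simps)
    moreover have "exp t * exp (- t) = 1" by (simp add: exp_minus)
    ultimately show ?thesis by simp
  qed
  have "mink A A + 2 * mink A B + mink B B = 1" using q[of 0] by simp
  moreover have "4 * mink A A + 2 * mink A B + (1/4) * mink B B = 1"
    using q[of "ln 2"] by (simp add: exp_minus power2_eq_square)
  moreover have "(1/4) * mink A A + 2 * mink A B + 4 * mink B B = 1"
    using q[of "- ln 2"] by (simp add: exp_minus power2_eq_square)
  ultimately have n: "mink A A = 0" "mink B B = 0" "mink A B = 1 / 2" by linarith+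
  have "fst (snd (hyperboloid (\<gamma> 0))) > 0" using g(1)[of 0] by (simp add: hyperboloid_def halfspace_def)
  \<comment> \<open>At least one end of the geodesic is not the point at infinity.\<close>
  then have "fst (snd A) > 0 \<or> fst (snd B) > 0" by (simp add: g(4)) linarith
  then obtain E :: "'a \<Rightarrow> 'a \<times> real \<times> real" and P where E: "linear E" "linear P" "\<And>x y. mink (E x) (E y) = - (x \<bullet> y)"
    "\<And>x. mink (E x) A = 0" "\<And>x. mink (E x) B = 0"
    "\<And>Y. mink Y A = 0 \<Longrightarrow> mink Y B = 0 \<Longrightarrow> E (P Y) = Y"
  proof
    assume "fst (snd A) > 0"
    then show ?thesis
      using null_pair_complement[OF n(1), of B] n(3) that by (metis mink_commute)
  next
    assume "fst (snd B) > 0"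
    then show ?thesis
      using null_pair_complement[OF n(2,3)] that by metis
  qed
  have "fermi_frame \<gamma> \<gamma>' A B E P"
    by (rule fermi_frame.intro[OF g n E])
  with that show ?thesis .
qed

context fermi_frame
begin

text \<open>Every point is \<open>u A + v B + E x\<close> with \<open>u, v > 0\<close> and \<open>u v = 1 + x \<bullet> x\<close>. These are Fermi coordinates: \<open>x\<close>
is the normal displacement, and \<open>ln (u / v) / 2\<close> is the time of the foot point on the geodesic.\<close>

definition fermi_u :: "'a \<times> real \<Rightarrow> real" where "fermi_u p = 2 * mink (hyperboloid p) B"
definition fermi_v :: "'a \<times> real \<Rightarrow> real" where "fermi_v p = 2 * mink (hyperboloid p) A"
definition fermi_x :: "'a \<times> real \<Rightarrow> 'a" where "fermi_x p = P (hyperboloid p - fermi_u p *\<^sub>R A - fermi_v p *\<^sub>R B)"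
definition fermi_point :: "'a \<Rightarrow> real \<Rightarrow> real \<Rightarrow> 'a \<times> real"
  where "fermi_point x u v = halfspace_point (u *\<^sub>R A + v *\<^sub>R B + E x)"

lemma mink_BA: "mink B A = 1 / 2"
  using null(3) by (simp add: mink_commute)

lemma E_orth': "mink A (E x) = 0" "mink B (E x) = 0"
  using E_orth[of x] by (simp_all add: mink_commute)

lemma mink_frame:
  "mink (u *\<^sub>R A + v *\<^sub>R B + E x) (u' *\<^sub>R A + v' *\<^sub>R B + E x') = (u * v' + v * u') / 2 - x \<bullet> x'"
  by (simp add: mink_simps null mink_BA E_orth E_orth' E_isometry)

lemma P_E: "P (E x) = x"
proof -
  have "E (P (E x)) = E x" by (rule E_P[OF E_orth])
  then have "E (P (E x) - x) = 0" using linear_diff[OF linear_E] by simp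
  then have "(P (E x) - x) \<bullet> (P (E x) - x) = 0"
    using E_isometry[of "P (E x) - x" "P (E x) - x"] by (simp add: mink_def)
  then show ?thesis by simp
qed

lemma hyperboloid_frame: "hyperboloid p = fermi_u p *\<^sub>R A + fermi_v p *\<^sub>R B + E (fermi_x p)"
proof -
  have "E (fermi_x p) = hyperboloid p - fermi_u p *\<^sub>R A - fermi_v p *\<^sub>R B"
    unfolding fermi_x_def
    by (rule E_P) (simp_all add: mink_simps null mink_BA fermi_u_def fermi_v_def)
  then show ?thesis by simp
qed

lemma fermi_u_v_mult:
  assumes "p \<in> halfspace"
  shows "fermi_u p * fermi_v p = 1 + fermi_x p \<bullet> fermi_x p"
proof -
  have "mink (hyperboloid p) (hyperboloid p) = 1" using mink_hyperboloid[OF assms assms] by simp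
  then show ?thesis by (subst (asm) (1 2) hyperboloid_frame) (simp add: mink_frame)
qed

lemma mink_hyperboloid_\<gamma>: "mink (hyperboloid p) (hyperboloid (\<gamma> t)) = (exp (- t) * fermi_u p + exp t * fermi_v p) / 2"
  by (simp add: hyperboloid_\<gamma> mink_simps fermi_u_def fermi_v_def)

lemma fermi_u_v_pos:
  assumes "p \<in> halfspace"
  shows "fermi_u p > 0" "fermi_v p > 0"
proof -
  have "fermi_u p * fermi_v p > 0" unfolding fermi_u_v_mult[OF assms] by (rule add_pos_nonneg) simp_all
  moreover have "mink (hyperboloid p) (hyperboloid (\<gamma> 0)) \<ge> 1"
    using mink_hyperboloid[OF assms \<gamma>_in, of 0] assms \<gamma>_in[of 0] by (simp add: halfspace_def)
  then have "fermi_u p + fermi_v p > 0" using mink_hyperboloid_\<gamma>[of p 0] by simp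
  ultimately show "fermi_u p > 0" "fermi_v p > 0" by (auto simp: zero_less_mult_iff)
qed

lemma fermi_point:
  assumes "u > 0" "v > 0" "u * v = 1 + x \<bullet> x"
  shows "fermi_point x u v \<in> halfspace" "fermi_u (fermi_point x u v) = u" "fermi_v (fermi_point x u v) = v"
    "fermi_x (fermi_point x u v) = x" "fst (snd (u *\<^sub>R A + v *\<^sub>R B + E x)) > 0"
proof -
  let ?X = "u *\<^sub>R A + v *\<^sub>R B + E x"
  have X: "mink ?X ?X = 1" unfolding mink_frame using assms(3) by (simp add: mult.commute[of v u] field_simps)
  have "mink ?X (hyperboloid (\<gamma> 0)) = (u + v) / 2"
    using mink_frame[of u v x 1 1 0] linear_0[OF linear_E] by (simp add: hyperboloid_\<gamma>)
  then have "mink ?X (hyperboloid (\<gamma> 0)) > 0" using assms(1,2) by simp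
  then have pos: "fst (snd ?X) > 0" by (rule forward_timelike[OF X \<gamma>_in])
  then show "fst (snd ?X) > 0" .
  show "fermi_point x u v \<in> halfspace" unfolding fermi_point_def by (rule hyperboloid_halfspace_point(1)[OF X pos])
  have l: "hyperboloid (fermi_point x u v) = ?X" unfolding fermi_point_def by (rule hyperboloid_halfspace_point(2)[OF X pos])
  show u: "fermi_u (fermi_point x u v) = u" and v: "fermi_v (fermi_point x u v) = v"
    by (simp_all add: fermi_u_def fermi_v_def l mink_simps null mink_BA E_orth)
  show "fermi_x (fermi_point x u v) = x" unfolding fermi_x_def l u v by (simp add: P_E)
qed

lemma fermi_point_coords: "p \<in> halfspace \<Longrightarrow> fermi_point (fermi_x p) (fermi_u p) (fermi_v p) = p"
  unfolding fermi_point_def using hyperboloid_frame[of p] halfspace_point_hyperboloid by metis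

lemma \<gamma>_coords: "fermi_u (\<gamma> t) = exp t" "fermi_v (\<gamma> t) = exp (- t)" "fermi_x (\<gamma> t) = 0"
proof -
  show *: "fermi_u (\<gamma> t) = exp t" "fermi_v (\<gamma> t) = exp (- t)"
    by (simp_all add: fermi_u_def fermi_v_def hyperboloid_\<gamma> mink_simps null mink_BA)
  show "fermi_x (\<gamma> t) = 0" using linear_0[OF linear_P] by (simp add: fermi_x_def * hyperboloid_\<gamma>)
qed

text \<open>The left-hand side is twice the hyperbolic cosine of the distance from \<open>p\<close> to \<open>\<gamma> t\<close>.\<close>

lemma cosh_bound:
  assumes "p \<in> halfspace"
  shows "exp (- t) * fermi_u p + exp t * fermi_v p \<ge> 2"
    and "p \<noteq> \<gamma> t \<Longrightarrow> exp (- t) * fermi_u p + exp t * fermi_v p > 2"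
proof -
  have pos: "snd p > 0" "snd (\<gamma> t) > 0" using assms \<gamma>_in[of t] by (auto simp: halfspace_def)
  have *: "exp (- t) * fermi_u p + exp t * fermi_v p = 2 + ((p - \<gamma> t) \<bullet> (p - \<gamma> t)) / (snd p * snd (\<gamma> t))"
    using mink_hyperboloid_\<gamma>[of p t] mink_hyperboloid[OF assms \<gamma>_in, of t] by (simp add: field_simps)
  show "exp (- t) * fermi_u p + exp t * fermi_v p \<ge> 2" unfolding * using pos by simp
  show "exp (- t) * fermi_u p + exp t * fermi_v p > 2" if "p \<noteq> \<gamma> t"
    unfolding * using pos that by (simp add: inner_gt_zero_iff)
qed

lemma continuous_hyperboloid: "continuous_on halfspace (hyperboloid :: 'a \<times> real \<Rightarrow> _)"
  unfolding hyperboloid_def by (intro continuous_intros) (auto simp: halfspace_def)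

lemma continuous_fermi_u: "continuous_on halfspace fermi_u" and continuous_fermi_v: "continuous_on halfspace fermi_v"
  unfolding fermi_u_def fermi_v_def mink_def by (auto intro!: continuous_intros continuous_hyperboloid)

section \<open>Generalised spheres orthogonal to the geodesic\<close>

text \<open>The hypersphere orthogonal to the geodesic at time \<open>t\<close> with mean curvature \<open>h\<close> for the unit normal
\<open>- \<gamma>' t\<close>: its Euclidean normal is \<open>- \<gamma>' t / y\<close>, and the curvature \<open>l\<close> solves \<open>l y - M\<^sub>n = h\<close>.\<close>

definition tsphere :: "real \<Rightarrow> real \<Rightarrow> ('a \<times> real) set"
  where "tsphere t h = gsphere (\<gamma> t) (- (1 / snd (\<gamma> t)) *\<^sub>R \<gamma>' t) ((h - snd (\<gamma>' t) / snd (\<gamma> t)) / snd (\<gamma> t))"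

lemma tsphere_normal_unit:
  "(- (1 / snd (\<gamma> t)) *\<^sub>R \<gamma>' t) \<bullet> (- (1 / snd (\<gamma> t)) *\<^sub>R \<gamma>' t) = 1"
proof -
  have pos: "snd (\<gamma> t) > 0" using \<gamma>_in[of t] by (simp add: halfspace_def)
  then have eq: "\<gamma>' t \<bullet> \<gamma>' t = snd (\<gamma> t) * snd (\<gamma> t)"
    using \<gamma>_unit[of t] by (simp add: hmetric_def power2_eq_square)
  show ?thesis unfolding inner_scaleR_left inner_scaleR_right eq using pos by simp
qed

text \<open>Up to positive factors, the defining function of the sphere is \<open>C' + h (C - 1)\<close>, where \<open>C\<close> is the
hyperbolic cosine of the distance from \<open>p\<close> to \<open>\<gamma> t\<close> and \<open>C'\<close> its derivative in \<open>t\<close>. In the hyperboloid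
model \<open>C = (e\<^sup>-\<^sup>t u + e\<^sup>t v) / 2\<close>.\<close>

lemma tsphere_iff:
  assumes p: "p \<in> halfspace"
  shows "p \<in> tsphere t h \<longleftrightarrow> ray_eq t h (fermi_u p) (fermi_v p)"
proof -
  let ?y = "snd (\<gamma> t)" and ?y' = "snd (\<gamma>' t)" and ?d = "(p - \<gamma> t) \<bullet> (p - \<gamma> t)" and ?w = "(p - \<gamma> t) \<bullet> \<gamma>' t"
  have pos: "snd p > 0" "?y > 0" using p \<gamma>_in[of t] by (auto simp: halfspace_def)
  have 1: "(exp (- t) * fermi_u p + exp t * fermi_v p) / 2 = 1 + ?d / (2 * snd p * ?y)"
    using mink_hyperboloid_\<gamma>[of p t] mink_hyperboloid[OF p \<gamma>_in, of t] by simp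
  have "mink (hyperboloid p) (hyperboloid_derivative (\<gamma> t) (\<gamma>' t)) = (exp t * fermi_v p - exp (- t) * fermi_u p) / 2"
    by (simp add: hyperboloid_derivative_\<gamma> mink_simps fermi_u_def fermi_v_def)
  then have 2: "(exp t * fermi_v p - exp (- t) * fermi_u p) / 2 = - ?w / (snd p * ?y) - ?d * ?y' / (2 * snd p * ?y\<^sup>2)"
    using mink_hyperboloid_derivative[OF p \<gamma>_in, of t "\<gamma>' t"] by simp
  have "(1 + h) * (exp t * fermi_v p - 1) - (1 - h) * (exp (- t) * fermi_u p - 1)
      = 2 * ((exp t * fermi_v p - exp (- t) * fermi_u p) / 2) + 2 * h * ((exp (- t) * fermi_u p + exp t * fermi_v p) / 2 - 1)"
    by (simp add: field_simps)
  also have "\<dots> = (1 / snd p) * (2 * (- ?w / ?y) + ((h - ?y' / ?y) / ?y) * ?d)"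
    unfolding 1 2 using pos by (simp add: field_simps power2_eq_square)
  also have "\<dots> = (1 / snd p) * (2 * (- (1 / ?y) *\<^sub>R \<gamma>' t \<bullet> (p - \<gamma> t)) + ((h - ?y' / ?y) / ?y) * ?d)"
    by (simp add: inner_commute)
  finally show ?thesis
    using pos(1) by (auto simp: tsphere_def gsphere_def ray_eq_def)
qed

end

lemma continuous_on_halfspace_point:
  assumes "continuous_on S X" "\<And>c. c \<in> S \<Longrightarrow> fst (snd (X c)) \<noteq> 0"
  shows "continuous_on S (\<lambda>c. halfspace_point (X c))"
  unfolding halfspace_point_def using assms by (intro continuous_intros) auto

text \<open>The region above a branch of the hyperbola is convex.\<close>

lemma convex_hyperbola_region:
  assumes "u * v = 1" "u' * v' \<ge> 1" "u * v' + u' * v \<ge> 2" "0 \<le> c" "c \<le> (1::real)"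
  shows "((1 - c) * u + c * u') * ((1 - c) * v + c * v') \<ge> 1"
proof -
  have "((1 - c) * u + c * u') * ((1 - c) * v + c * v')
      = (1 - c)\<^sup>2 * (u * v) + c\<^sup>2 * (u' * v') + c * (1 - c) * (u * v' + u' * v)"
    by (simp add: algebra_simps power2_eq_square)
  also have "\<dots> \<ge> (1 - c)\<^sup>2 * 1 + c\<^sup>2 * 1 + c * (1 - c) * 2"
    unfolding assms(1) using assms(2-5) by (intro add_mono mult_left_mono order_refl) auto
  also have "(1 - c)\<^sup>2 * 1 + c\<^sup>2 * 1 + c * (1 - c) * 2 = 1"
    by (simp add: algebra_simps power2_eq_square)
  finally show ?thesis .
qed

lemma unit_direction:
  fixes x :: "'a::euclidean_space"
  obtains w where "norm w = 1" "norm x *\<^sub>R w = x"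
proof (cases "x = 0")
  case True
  obtain b :: 'a where "b \<in> Basis" using nonempty_Basis by blast
  then show ?thesis using True that[of b] by simp
next
  case False
  then show ?thesis using that[of "x /\<^sub>R norm x"] by simp
qed

context fermi_frame
begin

lemma \<gamma>_vector_derivative: "vector_derivative \<gamma> (at t) = \<gamma>' t"
  using \<gamma>_derivative by (rule vector_derivative_at)

lemma \<gamma>_height_pos: "snd (\<gamma> t) > 0"
  using \<gamma>_in[of t] by (simp add: halfspace_def)

text \<open>The path follows a segment in the \<open>(u, v)\<close>-plane, on which the linear equation of the sphere
  persists, and keeps the direction of the normal displacement \<open>x\<close>; its length is given by
  \<open>u v - 1\<close>.\<close>

lemma tsphere_segment:
  assumes p: "p \<in> tsphere t h" "p \<in> halfspace"
  obtains \<pi> where "continuous_on {0..1::real} \<pi>" "\<pi> 0 = \<gamma> t" "\<pi> 1 = p"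
    "\<And>c. c \<in> {0..1} \<Longrightarrow> \<pi> c \<in> tsphere t h \<inter> halfspace"
proof -
  \<comment> \<open>If \<open>p\<close> lies on the geodesic, its normal displacement is zero and any direction serves.\<close>
  obtain w where w: "norm w = 1" "norm (fermi_x p) *\<^sub>R w = fermi_x p" using unit_direction .
  have ww: "w \<bullet> w = 1" using w(1) by (simp add: dot_square_norm)
  define u v where "u c = (1 - c) * exp t + c * fermi_u p" and "v c = (1 - c) * exp (- t) + c * fermi_v p" for c
  define x where "x c = sqrt (u c * v c - 1) *\<^sub>R w" for c
  let ?X = "\<lambda>c. u c *\<^sub>R A + v c *\<^sub>R B + E (x c)"
  have uv: "u c > 0" "v c > 0" "u c * v c = 1 + x c \<bullet> x c" if c: "c \<in> {0..1}" for c
  proof -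
    show "u c > 0" "v c > 0"
      using c fermi_u_v_pos[OF p(2)] by (cases "c = 0"; simp add: u_def v_def add_nonneg_pos)+
    have "fermi_u p * fermi_v p \<ge> 1" unfolding fermi_u_v_mult[OF p(2)] by simp
    moreover have "exp t * fermi_v p + fermi_u p * exp (- t) \<ge> 2" using cosh_bound(1)[OF p(2), of t] by (simp add: mult.commute)
    ultimately have "u c * v c \<ge> 1"
      unfolding u_def v_def using c by (intro convex_hyperbola_region) (auto simp: exp_minus)
    then show "u c * v c = 1 + x c \<bullet> x c" by (simp add: x_def ww)
  qed
  define \<pi> where "\<pi> c = fermi_point (x c) (u c) (v c)" for c
  have f: "\<pi> c \<in> halfspace" "fermi_u (\<pi> c) = u c" "fermi_v (\<pi> c) = v c" "fst (snd (?X c)) > 0" if "c \<in> {0..1}" for c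
    using fermi_point[OF uv[OF that]] by (simp_all add: \<pi>_def)
  have "\<pi> c \<in> tsphere t h" if c: "c \<in> {0..1}" for c
  proof -
    have "ray_eq t h (fermi_u p) (fermi_v p)" using tsphere_iff p by blast
    then have "c * ((1 - h) * (exp (- t) * fermi_u p - 1)) = c * ((1 + h) * (exp t * fermi_v p - 1))"
      by (simp add: ray_eq_def)
    moreover have "exp (- t) * u c - 1 = c * (exp (- t) * fermi_u p - 1)" "exp t * v c - 1 = c * (exp t * fermi_v p - 1)"
      by (simp_all add: u_def v_def exp_minus algebra_simps)
    ultimately have "ray_eq t h (u c) (v c)" by (simp add: ray_eq_def mult.left_commute)
    then show ?thesis using tsphere_iff[OF f(1)[OF c]] f(2,3)[OF c] by simp
  qed
  moreover have "continuous_on {0..1} \<pi>"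
  proof -
    have cu: "continuous_on {0..1} u" "continuous_on {0..1} v"
      unfolding u_def v_def by (intro continuous_intros)+
    then have cx: "continuous_on {0..1} x" unfolding x_def by (intro continuous_intros)
    have "bounded_linear E" using linear_E by (simp add: linear_conv_bounded_linear)
    then have cE: "continuous_on {0..1} (\<lambda>c. E (x c))" using cx by (rule bounded_linear.continuous_on)
    have "continuous_on {0..1} ?X" by (intro continuous_intros cE cu)
    then show ?thesis
      unfolding \<pi>_def fermi_point_def by (rule continuous_on_halfspace_point) (use f(4) in force)
  qed
  moreover have "\<pi> 0 = \<gamma> t"
    using fermi_point_coords[OF \<gamma>_in, of t] by (simp add: \<pi>_def x_def u_def v_def \<gamma>_coords exp_minus)
  moreover have "\<pi> 1 = p"
  proof -
    have "u 1 * v 1 - 1 = (norm (fermi_x p))\<^sup>2"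
      using fermi_u_v_mult[OF p(2)] by (simp add: u_def v_def power2_norm_eq_inner)
    then have "x 1 = fermi_x p" unfolding x_def using w(2) by simp
    then show ?thesis using fermi_point_coords[OF p(2)] by (simp add: \<pi>_def u_def v_def)
  qed
  ultimately show ?thesis using that f(1) by blast
qed

lemma path_connected_tsphere: "path_connected (tsphere t h \<inter> halfspace)"
proof -
  have "path_component (tsphere t h \<inter> halfspace) (\<gamma> t) p" if "p \<in> tsphere t h \<inter> halfspace" for p
  proof -
    obtain \<pi> where "continuous_on {0..1::real} \<pi>" "\<pi> 0 = \<gamma> t" "\<pi> 1 = p"
      "\<And>c. c \<in> {0..1} \<Longrightarrow> \<pi> c \<in> tsphere t h \<inter> halfspace"
      using tsphere_segment \<open>p \<in> _\<close> by (metis IntE)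
    then show ?thesis
      unfolding path_component_def path_def path_image_def pathstart_def pathfinish_def by blast
  qed
  then show ?thesis
    unfolding path_connected_component by (meson path_component_sym path_component_trans)
qed

lemma hyperbola_region_point:
  assumes "0 < u" "0 < v" "1 \<le> u * v"
  obtains p where "p \<in> halfspace" "fermi_u p = u" "fermi_v p = v"
proof -
  obtain w :: 'a where w: "norm w = 1" using unit_direction by blast
  have "u * v = 1 + (sqrt (u * v - 1) *\<^sub>R w) \<bullet> (sqrt (u * v - 1) *\<^sub>R w)"
    using w assms(3) by (simp add: dot_square_norm)
  from fermi_point[OF assms(1,2) this] that show ?thesis by blast
qed

section \<open>Necessity\<close>

context
  fixes F :: "('a \<times> real) set set" and h :: "real \<Rightarrow> real"
  assumes F: "umbilical_foliation F"
    and h: "\<And>t L. L \<in> F \<Longrightarrow> \<gamma> t \<in> L \<Longrightarrow> has_mean_curvature L (\<gamma> t) (- \<gamma>' t) (h t)"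
begin

text \<open>The patch that carries the mean curvature fixes the normal and the curvature of the generalised sphere
containing the leaf, up to a common sign. The leaf is the whole sphere because the sphere is connected
by the paths of \<open>tsphere_segment\<close>.\<close>

lemma leaf_eq_tsphere:
  assumes L: "L \<in> F" and t: "\<gamma> t \<in> L"
  shows "L = tsphere t (h t) \<inter> halfspace"
proof -
  let ?y = "snd (\<gamma> t)"
  let ?n = "- (1 / ?y) *\<^sub>R \<gamma>' t" and ?k = "(h t - snd (\<gamma>' t) / ?y) / ?y"
  obtain m l where m: "m \<bullet> m = 1" and sub: "L \<subseteq> gsphere (\<gamma> t) m l"
    using leaf_in_gsphere[OF F L t] .
  obtain r N x where r: "patch_in r L" "unit_normal_field r N" "r x = \<gamma> t" "N x = - \<gamma>' t"
    "shape_eigenvalues r N x = {h t}"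
    using h[OF L t] unfolding has_mean_curvature_def by blast
  have rp: "patch r" "range r \<subseteq> gsphere (\<gamma> t) m l" using r(1) sub by (auto simp: patch_in_def)
  obtain s where s: "s = 1 \<or> s = - 1"
    "\<And>x. euclidean_normal r N x = s *\<^sub>R (m + l *\<^sub>R (r x - \<gamma> t))"
    "\<And>x. shape_eigenvalues r N x = {s * (l * ?y - snd m)}"
    using gsphere_patch_umbilic[OF rp(1) r(2) m rp(2)] by metis
  have n: "?n = s *\<^sub>R m"
    using s(2)[of x] by (simp add: euclidean_normal_def r(3,4) inverse_eq_divide)
  have k: "h t = s * (l * ?y - snd m)" using s(3)[of x] r(5) by simp
  have "- (snd (\<gamma>' t) / ?y) = s * snd m" using arg_cong[OF n, of snd] by simp
  then have "h t - snd (\<gamma>' t) / ?y = (s * l) * ?y" using k by (simp add: algebra_simps)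
  then have sl: "?k = s * l" using \<gamma>_height_pos[of t] by simp
  have Q: "tsphere t (h t) = gsphere (\<gamma> t) m l"
    unfolding tsphere_def n sl using s(1) by (auto simp: gsphere_minus)
  show ?thesis
  proof
    show "L \<subseteq> tsphere t (h t) \<inter> halfspace" using sub leaf_subset[OF F L] Q by blast
    show "tsphere t (h t) \<inter> halfspace \<subseteq> L"
    proof
      fix p assume p: "p \<in> tsphere t (h t) \<inter> halfspace"
      obtain \<pi> where \<pi>: "continuous_on {0..1::real} \<pi>" "\<pi> 0 = \<gamma> t" "\<pi> 1 = p"
        "\<And>c. c \<in> {0..1} \<Longrightarrow> \<pi> c \<in> tsphere t (h t) \<inter> halfspace"
        using tsphere_segment p by (metis IntE)
      from path_stays_in_leaf[OF F L m sub \<pi>(1) \<pi>(4)[unfolded Q]] \<pi>(2,3) t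
      show "p \<in> L" by simp
    qed
  qed
qed

lemma tsphere_leaf: "tsphere t (h t) \<inter> halfspace \<in> F"
  using leaf_through[OF F \<gamma>_in[of t]] leaf_eq_tsphere by metis

lemma foliation_equal_or_disjoint_rays: "equal_or_disjoint_rays h"
  unfolding equal_or_disjoint_rays_def
proof (intro allI impI, elim conjE)
  fix s t u v u' v' :: real
  assume uv: "0 < u" "0 < v" "1 \<le> u * v" and uv': "0 < u'" "0 < v'" "1 \<le> u' * v'"
    and r: "ray_eq s (h s) u v" "ray_eq t (h t) u v" "ray_eq s (h s) u' v'"
  obtain p where p: "p \<in> halfspace" "fermi_u p = u" "fermi_v p = v" using hyperbola_region_point[OF uv] .
  obtain p' where p': "p' \<in> halfspace" "fermi_u p' = u'" "fermi_v p' = v'" using hyperbola_region_point[OF uv'] .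
  have "p \<in> tsphere s (h s) \<inter> halfspace" "p \<in> tsphere t (h t) \<inter> halfspace"
    using r p by (simp_all add: tsphere_iff)
  then have "tsphere s (h s) \<inter> halfspace = tsphere t (h t) \<inter> halfspace"
    using leaf_eqI[OF F tsphere_leaf tsphere_leaf] by blast
  moreover have "p' \<in> tsphere s (h s) \<inter> halfspace" using r(3) p' by (simp add: tsphere_iff)
  ultimately have "p' \<in> tsphere t (h t)" by blast
  then show "ray_eq t (h t) u' v'" using tsphere_iff[OF p'(1)] p'(2,3) by simp
qed

text \<open>The point with a fixed first chart coordinate on the plaque through \<open>\<gamma> s\<close> moves continuously
  with \<open>s\<close>, and \<open>h s\<close> can be read off from the Fermi coordinates of any point of the leaf other than
  \<open>\<gamma> s\<close>.\<close>

lemma foliation_curvature_continuous: "continuous_on UNIV h"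
proof -
  have "isCont h t" for t
  proof -
    obtain U g f where chart: "plaque_chart F U g f" and tU: "\<gamma> t \<in> U"
      using foliation_chart[OF F \<gamma>_in] by blast
    note U = plaque_chartD(1)[OF chart] and hom = plaque_chartD(2)[OF chart]
      and pc = plaque_chartD(4)[OF chart]
    have cf: "continuous_on U f" and cg: "continuous_on UNIV g" using hom by (auto simp: homeomorphism_def)
    obtain b :: 'a where b: "b \<in> Basis" using nonempty_Basis by blast
    then have "g (b, snd (f (\<gamma> t))) \<noteq> g (0, snd (f (\<gamma> t)))"
      using hom nonzero_Basis by (metis Pair_inject UNIV_I homeomorphism_apply1)
    then obtain x where x: "g (x, snd (f (\<gamma> t))) \<noteq> \<gamma> t" by metis
    define q where "q s = g (x, snd (f (\<gamma> s)))" for s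
    have c\<gamma>: "isCont \<gamma> s" for s
      using \<gamma>_derivative has_vector_derivative_continuous by blast
    have "isCont f (\<gamma> t)" using cf U tU by (simp add: continuous_on_eq_continuous_at)
    then have "isCont (\<lambda>s. f (\<gamma> s)) t" using c\<gamma>[of t] isCont_o2 by blast
    then have "isCont (\<lambda>s. (x, snd (f (\<gamma> s)))) t" by (intro continuous_intros)
    moreover have "isCont g z" for z using cg continuous_on_eq_continuous_at[OF open_UNIV, of g] by blast
    ultimately have cq: "isCont q t" unfolding q_def by (rule isCont_o2)
    have qH: "q s \<in> tsphere s (h s) \<inter> halfspace" if "\<gamma> s \<in> U" for s
    proof -
      obtain L where L: "L \<in> F" "\<gamma> s \<in> L" using leaf_through[OF F \<gamma>_in] .
      have "q s \<in> L" using plaque_subset_leaf[OF pc[OF L that]] by (simp add: q_def)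
      then show ?thesis using leaf_eq_tsphere[OF L] by simp
    qed
    have "open (halfspace :: ('a \<times> real) set)"
      unfolding halfspace_def by (intro open_Collect_less continuous_intros)
    then have "isCont fermi_u z" "isCont fermi_v z" if "z \<in> halfspace" for z
      using continuous_fermi_u continuous_fermi_v that by (simp_all add: continuous_on_eq_continuous_at)
    then have fq: "isCont fermi_u (q t)" "isCont fermi_v (q t)" using qH[OF tU] by blast+
    note cuv = isCont_o2[OF cq fq(1)] isCont_o2[OF cq fq(2)]
    let ?a = "\<lambda>s. exp (- s) * fermi_u (q s)" and ?b = "\<lambda>s. exp s * fermi_v (q s)"
    have "?a t + ?b t > 2" using cosh_bound(2)[of "q t" t] qH[OF tU] x by (auto simp: q_def)
    then have ne: "?a t + ?b t - 2 \<noteq> 0" by simp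
    then have c: "isCont (\<lambda>s. (?a s - ?b s) / (?a s + ?b s - 2)) t"
      by (intro continuous_intros cuv)
    have c2: "isCont (\<lambda>s. ?a s + ?b s - 2) t" by (intro continuous_intros cuv)
    have "\<forall>\<^sub>F s in at t. ?a s + ?b s - 2 \<noteq> 0"
      by (rule tendsto_imp_eventually_ne[OF c2[unfolded isCont_def] ne])
    moreover have "\<forall>\<^sub>F s in at t. \<gamma> s \<in> U"
      using topological_tendstoD[OF c\<gamma>[of t, unfolded isCont_def] U tU] .
    ultimately have ev: "\<forall>\<^sub>F s in at t. (?a s - ?b s) / (?a s + ?b s - 2) = h s"
    proof eventually_elim
      case (elim s)
      have "ray_eq s (h s) (fermi_u (q s)) (fermi_v (q s))" using qH[OF elim(2)] tsphere_iff by blast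
      then have "h s * (?a s + ?b s - 2) = ?a s - ?b s" by (simp add: ray_eq_def algebra_simps)
      then show ?case using elim(1) by (simp add: divide_eq_eq)
    qed
    have eq: "(?a t - ?b t) / (?a t + ?b t - 2) = h t"
    proof -
      have "ray_eq t (h t) (fermi_u (q t)) (fermi_v (q t))" using qH[OF tU] tsphere_iff by blast
      then have "h t * (?a t + ?b t - 2) = ?a t - ?b t" by (simp add: ray_eq_def algebra_simps)
      then show ?thesis using ne by (simp add: divide_eq_eq)
    qed
    show ?thesis
      using c unfolding isCont_def eq tendsto_cong[OF ev] .
  qed
  then show ?thesis by (simp add: continuous_at_imp_continuous_on)
qed

lemma foliation_route_condition:
  "(\<forall>t. \<bar>h t\<bar> \<le> 1) \<and> (\<exists>t1 t2. route_condition h t1 t2)"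
proof -
  note rays = foliation_equal_or_disjoint_rays and cont = foliation_curvature_continuous
  have bound: "\<bar>h t\<bar> \<le> 1" for t by (rule rays_slope_bounded[OF rays cont])
  with monotone_slopes_imp_route_condition[OF rays_monotone_slopes[OF rays bound] bound cont]
  show ?thesis by blast
qed

end

end

section \<open>Sufficiency\<close>

text \<open>For \<open>l \<noteq> 0\<close> the sphere has radius \<open>1 / |l|\<close> and its centre has height \<open>k / l\<close>, where \<open>k\<close> is the hyperbolic
mean curvature. So it meets the boundary hyperplane if and only if \<open>|k| \<le> 1\<close>.\<close>

lemma generalized_hypersphere_gsphere:
  fixes p m :: "'a::euclidean_space \<times> real"
  assumes m: "m \<bullet> m = 1" and p: "p \<in> halfspace" and k: "\<bar>l * snd p - snd m\<bar> \<le> 1"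
  shows "generalized_hypersphere (gsphere p m l \<inter> halfspace)"
proof (cases "l = 0")
  case True
  then have "gsphere p m l = {q. m \<bullet> q = m \<bullet> p}" by (auto simp: gsphere_def inner_diff_right)
  moreover have "m \<noteq> 0" using m by auto
  moreover have "p \<in> gsphere p m l \<inter> halfspace" using p gsphere_base by blast
  ultimately show ?thesis unfolding generalized_hypersphere_def by blast
next
  case False
  define c where "c = p - (1 / l) *\<^sub>R m"
  have "gsphere p m l = sphere c (1 / \<bar>l\<bar>)"
  proof -
    have "q \<in> gsphere p m l \<longleftrightarrow> q \<in> sphere c (1 / \<bar>l\<bar>)" for q
    proof -
      have qc: "q - c = (q - p) + (1 / l) *\<^sub>R m" by (simp add: c_def)
      have "l * ((z + (1 / l) *\<^sub>R m) \<bullet> (z + (1 / l) *\<^sub>R m)) = 2 * (m \<bullet> z) + l * (z \<bullet> z) + 1 / l" for z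
        using False m by (simp add: inner_add_left inner_add_right inner_commute[of z m] field_simps)
      then have "l * ((q - c) \<bullet> (q - c)) = 2 * (m \<bullet> (q - p)) + l * ((q - p) \<bullet> (q - p)) + 1 / l"
        unfolding qc .
      then have "q \<in> gsphere p m l \<longleftrightarrow> l * ((q - c) \<bullet> (q - c)) = 1 / l" by (simp add: gsphere_def)
      also have "\<dots> \<longleftrightarrow> (norm (q - c))\<^sup>2 = (1 / \<bar>l\<bar>)\<^sup>2"
        using False by (simp add: dot_square_norm power_divide field_simps power2_eq_square)
      also have "\<dots> \<longleftrightarrow> norm (q - c) = 1 / \<bar>l\<bar>"
        by (rule power2_eq_iff_nonneg) auto
      finally show ?thesis by (simp add: dist_norm norm_minus_commute)
    qed
    then show ?thesis by blast
  qed
  moreover have "sphere c (1 / \<bar>l\<bar>) \<inter> {p. snd p = 0} \<noteq> {}"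
  proof -
    obtain w :: 'a where w: "w \<in> Basis" using nonempty_Basis by blast
    let ?k = "l * snd p - snd m"
    have sc: "snd c = ?k / l" using False by (simp add: c_def field_simps)
    let ?q = "(fst c + (sqrt (1 - ?k\<^sup>2) / l) *\<^sub>R w, 0) :: 'a \<times> real"
    have k2: "1 - ?k\<^sup>2 \<ge> 0" using k by (simp add: abs_square_le_1)
    have sq: "(norm (a *\<^sub>R w, b))\<^sup>2 = a\<^sup>2 + b\<^sup>2" for a b :: real
      using w by (simp add: norm_Pair)
    have "c - ?q = (- (sqrt (1 - ?k\<^sup>2) / l) *\<^sub>R w, ?k / l)" using sc by (simp add: prod_eq_iff)
    then have "(norm (c - ?q))\<^sup>2 = (sqrt (1 - ?k\<^sup>2) / l)\<^sup>2 + (?k / l)\<^sup>2"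
      by (simp only: sq power2_minus)
    also have "\<dots> = (1 / \<bar>l\<bar>)\<^sup>2"
      using k2 by (simp add: power_divide add_divide_distrib[symmetric])
    finally have "norm (c - ?q) = 1 / \<bar>l\<bar>" by (simp add: power2_eq_iff_nonneg)
    then have "?q \<in> sphere c (1 / \<bar>l\<bar>) \<inter> {p. snd p = 0}" by (simp add: dist_norm)
    then show ?thesis by blast
  qed
  moreover have "p \<in> gsphere p m l \<inter> halfspace" using p gsphere_base by blast
  moreover have "0 < 1 / \<bar>l\<bar>" using False by simp
  ultimately show ?thesis unfolding generalized_hypersphere_def by blast
qed

text \<open>The nonnegative root of a quadratic equation, in a form without division by \<open>k\<close>, which may be zero.\<close>

lemma ray_parameter_iff:
  fixes n k c :: real
  assumes "n \<ge> 0" "k \<ge> 0"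
  shows "c = n / (1 + sqrt (1 + n * k)) \<longleftrightarrow> c \<ge> 0 \<and> 2 * c + c\<^sup>2 * k = n"
proof -
  define S where "S = sqrt (1 + n * k)"
  have S2: "S\<^sup>2 = 1 + n * k" and S: "1 + S > 0" using assms by (simp_all add: S_def add_pos_nonneg)
  have "c \<ge> 0 \<and> 2 * c + c\<^sup>2 * k = n" if c: "c = n / (1 + S)"
  proof -
    have cS: "c * (1 + S) = n" using c S by simp
    have "c\<^sup>2 * k * (1 + S)\<^sup>2 = n * (n * k)"
      using cS by (metis power_mult_distrib mult.assoc mult.commute power2_eq_square)
    also have "n * k = (S - 1) * (S + 1)" using S2 by (simp add: algebra_simps power2_eq_square)
    finally have "(c\<^sup>2 * k * (1 + S) - n * (S - 1)) * (1 + S) = 0"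
      by (simp add: algebra_simps power2_eq_square)
    then have "c\<^sup>2 * k * (1 + S) = n * (S - 1)" using S by simp
    then have "(2 * c + c\<^sup>2 * k - n) * (1 + S) = 0" using cS by (simp add: algebra_simps)
    then have "2 * c + c\<^sup>2 * k = n" using S by simp
    moreover have "c \<ge> 0" using c S assms by simp
    ultimately show ?thesis by simp
  qed
  moreover have "c = n / (1 + S)" if c: "c \<ge> 0" "2 * c + c\<^sup>2 * k = n"
  proof -
    have "1 + n * k = (1 + c * k)\<^sup>2" unfolding c(2)[symmetric] by (simp add: algebra_simps power2_eq_square)
    then have "S = 1 + c * k" using c(1) assms by (simp add: S_def)
    then have "c * (1 + S) = n" using c(2) by (simp add: algebra_simps power2_eq_square)
    then show ?thesis using S by (simp add: field_simps)
  qed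
  ultimately show ?thesis unfolding S_def[symmetric] by blast
qed

context fermi_frame
begin

context
  fixes h :: "real \<Rightarrow> real"
  assumes cont: "continuous_on UNIV h" and bound: "\<And>t. \<bar>h t\<bar> \<le> 1" and mono: "monotone_slopes h"
begin

definition leaf :: "real \<Rightarrow> ('a \<times> real) set"
  where "leaf t = tsphere t (h t) \<inter> halfspace"

text \<open>For late times the point \<open>(u, v)\<close> lies on one side of the line of \<open>t\<close>, for early times on the other.\<close>

lemma leaves_cover:
  assumes p: "p \<in> halfspace"
  obtains t where "p \<in> leaf t"
proof -
  note pos = fermi_u_v_pos[OF p]
  let ?f = "\<lambda>t. (1 - h t) * (exp (- t) * fermi_u p - 1) - (1 + h t) * (exp t * fermi_v p - 1)"
  \<comment> \<open>The times at which the hyperbola passes the abscissa \<open>u\<close> and the ordinate \<open>v\<close>.\<close>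
  define a b where "a = min (ln (fermi_u p)) (- ln (fermi_v p))" and "b = max (ln (fermi_u p)) (- ln (fermi_v p))"
  have hs: "0 \<le> 1 + h t" "0 \<le> 1 - h t" for t using bound[of t] by auto
  have eu: "exp (- t) * fermi_u p = exp (ln (fermi_u p) - t)" and ev: "exp t * fermi_v p = exp (t + ln (fermi_v p))" for t
    using pos by (simp_all add: exp_diff exp_add exp_minus field_simps)
  have "?f b \<le> 0"
  proof -
    have "exp (- b) * fermi_u p \<le> 1" "exp b * fermi_v p \<ge> 1" unfolding eu ev by (simp_all add: b_def)
    then have "(1 - h b) * (exp (- b) * fermi_u p - 1) \<le> 0" "(1 + h b) * (exp b * fermi_v p - 1) \<ge> 0"
      using hs by (simp_all add: mult_nonneg_nonpos)
    then show ?thesis by linarith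
  qed
  moreover have "0 \<le> ?f a"
  proof -
    have "exp (- a) * fermi_u p \<ge> 1" "exp a * fermi_v p \<le> 1" unfolding eu ev by (simp_all add: a_def min_def)
    then have "(1 - h a) * (exp (- a) * fermi_u p - 1) \<ge> 0" "(1 + h a) * (exp a * fermi_v p - 1) \<le> 0"
      using hs by (simp_all add: mult_nonneg_nonpos)
    then show ?thesis by linarith
  qed
  moreover have "a \<le> b" by (simp add: a_def b_def)
  moreover have "continuous_on {a..b} ?f"
    by (intro continuous_intros continuous_on_subset[OF cont]) auto
  ultimately obtain t where "?f t = 0" using IVT2'[of ?f b 0 a] by blast
  then have "p \<in> leaf t" using p by (simp add: leaf_def tsphere_iff ray_eq_def)
  with that show ?thesis .
qed

lemma leaves_disjoint: "p \<in> leaf s \<Longrightarrow> p \<in> leaf t \<Longrightarrow> s = t"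
  unfolding leaf_def using tsphere_iff monotone_slopes_disjoint[OF mono bound] cosh_bound(1) by blast

text \<open>The point of the leaf of \<open>t\<close> with normal displacement \<open>x\<close> lies over the point of the ray whose parameter
\<open>c\<close> solves \<open>u v - 1 = 2 c + c\<^sup>2 (1 - h\<^sup>2) = x \<bullet> x\<close>. With the displacement \<open>x\<close> and the time \<open>t\<close> as coordinates,
this gives a single chart for the whole foliation.\<close>

definition ray_parameter :: "'a \<Rightarrow> real \<Rightarrow> real"
  where "ray_parameter x t = (x \<bullet> x) / (1 + sqrt (1 + (x \<bullet> x) * (1 - (h t)\<^sup>2)))"
definition leaf_u :: "'a \<Rightarrow> real \<Rightarrow> real"
  where "leaf_u x t = exp t * (1 + ray_parameter x t * (1 + h t))"
definition leaf_v :: "'a \<Rightarrow> real \<Rightarrow> real"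
  where "leaf_v x t = exp (- t) * (1 + ray_parameter x t * (1 - h t))"
definition leaf_point :: "'a \<times> real \<Rightarrow> 'a \<times> real"
  where "leaf_point z = fermi_point (fst z) (leaf_u (fst z) (snd z)) (leaf_v (fst z) (snd z))"

lemma one_minus_h_square: "1 - (h t)\<^sup>2 \<ge> 0"
  using bound[of t] by (simp add: abs_square_le_1)

lemma ray_parameter_denominator_pos:
  "1 + sqrt (1 + (x \<bullet> x) * (1 - (h t)\<^sup>2)) > 0" "1 + (x \<bullet> x) * (1 - (h t)\<^sup>2) > 0"
proof -
  have "(x \<bullet> x) * (1 - (h t)\<^sup>2) \<ge> 0" using one_minus_h_square by simp
  then show "1 + (x \<bullet> x) * (1 - (h t)\<^sup>2) > 0" by linarith
  then show "1 + sqrt (1 + (x \<bullet> x) * (1 - (h t)\<^sup>2)) > 0" by (intro add_pos_nonneg) simp_all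
qed

lemma ray_parameter:
  "ray_parameter x t \<ge> 0" "2 * ray_parameter x t + (ray_parameter x t)\<^sup>2 * (1 - (h t)\<^sup>2) = x \<bullet> x"
  using ray_parameter_iff[of "x \<bullet> x" "1 - (h t)\<^sup>2" "ray_parameter x t"] one_minus_h_square
  by (auto simp: ray_parameter_def)

lemma leaf_uv: "leaf_u x t > 0" "leaf_v x t > 0" "leaf_u x t * leaf_v x t = 1 + x \<bullet> x"
proof -
  have "ray_parameter x t * (1 + h t) \<ge> 0" "ray_parameter x t * (1 - h t) \<ge> 0"
    using ray_parameter(1)[of x t] bound[of t] by (auto intro!: mult_nonneg_nonneg)
  then show "leaf_u x t > 0" "leaf_v x t > 0" by (simp_all add: leaf_u_def leaf_v_def add_pos_nonneg)
  show "leaf_u x t * leaf_v x t = 1 + x \<bullet> x"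
    unfolding leaf_u_def leaf_v_def ray_point_product ray_parameter(2) ..
qed

lemma leaf_point:
  "leaf_point (x, t) \<in> leaf t" "leaf_point (x, t) \<in> halfspace" "fermi_x (leaf_point (x, t)) = x"
proof -
  note f = fermi_point[OF leaf_uv, of x t]
  show "leaf_point (x, t) \<in> halfspace" "fermi_x (leaf_point (x, t)) = x"
    using f by (simp_all add: leaf_point_def)
  have e: "exp (- t) * (exp t * z) = z" "exp t * (exp (- t) * z) = z" for z :: real
    by (simp_all add: exp_minus)
  have "ray_eq t (h t) (leaf_u x t) (leaf_v x t)"
    unfolding ray_eq_def leaf_u_def leaf_v_def e by simp
  then show "leaf_point (x, t) \<in> leaf t"
    using f tsphere_iff[OF f(1)] by (simp add: leaf_point_def leaf_def)
qed

lemma leaf_point_fermi_x: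
  assumes p: "p \<in> leaf t"
  shows "leaf_point (fermi_x p, t) = p"
proof -
  have ph: "p \<in> halfspace" using p by (simp add: leaf_def)
  have "ray_eq t (h t) (fermi_u p) (fermi_v p)" using p tsphere_iff[of p t "h t"] by (simp add: leaf_def)
  then obtain c where c: "c \<ge> 0" "fermi_u p = exp t * (1 + c * (1 + h t))" "fermi_v p = exp (- t) * (1 + c * (1 - h t))"
    using ray_eq_parametrise[OF _ bound cosh_bound(1)[OF ph]] by metis
  have "2 * c + c\<^sup>2 * (1 - (h t)\<^sup>2) = fermi_x p \<bullet> fermi_x p"
    using fermi_u_v_mult[OF ph] unfolding c(2,3) ray_point_product by simp
  then have "c = ray_parameter (fermi_x p) t"
    using ray_parameter_iff[of "fermi_x p \<bullet> fermi_x p" "1 - (h t)\<^sup>2" c] one_minus_h_square c(1)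
    by (simp add: ray_parameter_def)
  then show ?thesis
    using fermi_point_coords[OF ph] by (simp add: leaf_point_def leaf_u_def leaf_v_def c(2,3))
qed

lemma range_leaf_point: "range (\<lambda>x. leaf_point (x, t)) = leaf t"
  using leaf_point(1) leaf_point_fermi_x by (auto simp: image_iff) metis

lemma leaf_point_inj: "inj leaf_point"
proof (rule injI, clarify)
  fix x t x' t' assume eq: "leaf_point (x, t) = leaf_point (x', t')"
  show "x = x' \<and> t = t'"
    using leaf_point(1)[of x t] leaf_point(1)[of x' t'] leaf_point(3)[of x t] leaf_point(3)[of x' t']
      leaves_disjoint eq by auto
qed

lemma leaf_point_surj: "range leaf_point = halfspace"
proof
  show "range leaf_point \<subseteq> halfspace" using leaf_point(2) by auto
  show "halfspace \<subseteq> range leaf_point" using leaves_cover leaf_point_fermi_x by (metis rangeI subsetI)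
qed

lemma bounded_linear_E: "bounded_linear E"
  using linear_E by (simp add: linear_conv_bounded_linear)

lemma leaf_point_eq: "leaf_point (x, t) = halfspace_point (leaf_u x t *\<^sub>R A + leaf_v x t *\<^sub>R B + E x)"
  by (simp add: leaf_point_def fermi_point_def)

lemma leaf_point_forward: "fst (snd (leaf_u x t *\<^sub>R A + leaf_v x t *\<^sub>R B + E x)) > 0"
  by (rule fermi_point(5)[OF leaf_uv])

lemma leaf_point_continuous: "continuous_on UNIV leaf_point"
proof -
  have ch: "continuous_on UNIV (\<lambda>z::'a \<times> real. h (snd z))"
    by (rule continuous_on_compose2[OF cont]) (auto intro: continuous_intros)
  have cr: "continuous_on UNIV (\<lambda>z. ray_parameter (fst z) (snd z))"
    unfolding ray_parameter_def
    by (intro continuous_intros ch) (use ray_parameter_denominator_pos(1) in \<open>metis less_irrefl\<close>)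
  have cE: "continuous_on UNIV (\<lambda>z::'a \<times> real. E (fst z))"
    by (rule bounded_linear.continuous_on[OF bounded_linear_E]) (intro continuous_intros)
  have cX: "continuous_on UNIV (\<lambda>z. leaf_u (fst z) (snd z) *\<^sub>R A + leaf_v (fst z) (snd z) *\<^sub>R B + E (fst z))"
    unfolding leaf_u_def leaf_v_def by (intro continuous_intros ch cr cE)
  have "continuous_on UNIV (\<lambda>z. halfspace_point (leaf_u (fst z) (snd z) *\<^sub>R A + leaf_v (fst z) (snd z) *\<^sub>R B + E (fst z)))"
    by (rule continuous_on_halfspace_point[OF cX less_imp_neq[THEN not_sym, OF leaf_point_forward]])
  moreover have "leaf_point = (\<lambda>z. halfspace_point (leaf_u (fst z) (snd z) *\<^sub>R A + leaf_v (fst z) (snd z) *\<^sub>R B + E (fst z)))"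
    by (simp add: fun_eq_iff leaf_point_eq)
  ultimately show ?thesis by simp
qed

lemma leaf_point_smooth: "smooth (\<lambda>x. leaf_point (x, t))"
proof -
  have sr: "smooth (\<lambda>x. ray_parameter x t)"
    unfolding ray_parameter_def
    by (intro smooth_divide smooth_inner smooth_add smooth_sqrt smooth_mult smooth_const smooth_ident
        ray_parameter_denominator_pos(2))
      (use ray_parameter_denominator_pos(1) in \<open>metis less_irrefl\<close>)
  let ?X = "\<lambda>x. leaf_u x t *\<^sub>R A + leaf_v x t *\<^sub>R B + E x"
  have sX: "smooth ?X"
    unfolding leaf_u_def leaf_v_def
    by (intro smooth_add smooth_scaleR smooth_mult smooth_const sr smooth_linear[OF bounded_linear_E])
  have "smooth (\<lambda>x. (1 / fst (snd (?X x))) *\<^sub>R (fst (?X x), 1::real))"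
    by (intro smooth_scaleR smooth_divide smooth_fst smooth_snd smooth_Pair smooth_const sX)
      (use leaf_point_forward in \<open>metis less_irrefl\<close>)
  then show ?thesis unfolding leaf_point_eq halfspace_point_def .
qed

lemma fermi_x_differentiable:
  assumes "p \<in> halfspace"
  shows "fermi_x differentiable (at p)"
proof -
  let ?L = "\<lambda>X. P (X - (2 * mink X B) *\<^sub>R A - (2 * mink X A) *\<^sub>R B)"
  have "linear (\<lambda>X. X - (2 * mink X B) *\<^sub>R A - (2 * mink X A) *\<^sub>R B)"
    by (rule linearI) (simp_all add: mink_simps algebra_simps)
  from linear_compose[OF this linear_P] have "bounded_linear ?L"
    by (simp add: linear_conv_bounded_linear o_def)
  moreover obtain l' where "(hyperboloid has_derivative l') (at p)"
  proof -
    have "snd p \<noteq> 0" using assms by (simp add: halfspace_def)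
    then have "\<exists>l'. (hyperboloid has_derivative l') (at p)"
      unfolding hyperboloid_def by - (rule exI, (rule derivative_eq_intros refl | simp)+)
    then show ?thesis using that by blast
  qed
  ultimately have "((\<lambda>p. ?L (hyperboloid p)) has_derivative (\<lambda>v. ?L (l' v))) (at p)"
    by (rule bounded_linear.has_derivative)
  moreover have "fermi_x = (\<lambda>p. ?L (hyperboloid p))" by (simp add: fun_eq_iff fermi_x_def fermi_u_def fermi_v_def)
  ultimately show ?thesis unfolding differentiable_def by metis
qed

text \<open>The derivative is injective because the Fermi coordinate \<open>x\<close> is a differentiable left inverse.\<close>

lemma leaf_point_patch: "patch (\<lambda>x. leaf_point (x, t))"
  unfolding patch_def
proof (intro conjI allI)
  show "smooth (\<lambda>x. leaf_point (x, t))" by (rule leaf_point_smooth)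
  show "range (\<lambda>x. leaf_point (x, t)) \<subseteq> halfspace" using leaf_point(2) by blast
  show "inj (D (\<lambda>x. leaf_point (x, t)) x)" for x
    by (rule inj_derivative_of_left_inverse[OF leaf_point_smooth fermi_x_differentiable])
      (rule leaf_point)+
qed

lemma \<gamma>_in_leaf: "\<gamma> t \<in> leaf t"
  by (simp add: leaf_def tsphere_def gsphere_base \<gamma>_in)

lemma leaf_umbilical: "totally_umbilical (leaf t)"
proof -
  have "\<exists>k. \<forall>x. shape_eigenvalues r N x = {k}" if "patch_in r (leaf t)" "unit_normal_field r N" for r N
  proof -
    have r: "patch r" "range r \<subseteq> tsphere t (h t)" using that(1) by (auto simp: patch_in_def leaf_def)
    show ?thesis
      using gsphere_patch_umbilic[OF r(1) that(2) tsphere_normal_unit r(2)[unfolded tsphere_def]] by metis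
  qed
  then show ?thesis unfolding totally_umbilical_def by meson
qed

text \<open>The map \<open>leaf_point\<close> is a continuous bijection onto the half-space, so by invariance of domain it is a
homeomorphism. Its plaques are whole leaves.\<close>

lemma leaves_foliation: "umbilical_foliation (range leaf)"
proof -
  have "open (halfspace :: ('a \<times> real) set)"
    unfolding halfspace_def by (intro open_Collect_less continuous_intros)
  obtain f where f: "homeomorphism UNIV halfspace leaf_point f"
    using invariance_of_domain_homeomorphism[OF open_UNIV leaf_point_continuous _ leaf_point_inj]
    unfolding leaf_point_surj by auto
  have comp: "path_component_set (leaf t \<inter> halfspace) q = range (\<lambda>x. leaf_point (x, snd (f q)))"
    if q: "q \<in> leaf t" for t q
  proof -
    have "leaf t \<inter> halfspace = leaf t" by (auto simp: leaf_def)
    moreover have "path_component_set (leaf t) q = leaf t"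
      using path_connected_tsphere q unfolding leaf_def path_connected_component_set by blast
    moreover have "f q = (fermi_x q, t)"
      using leaf_point_fermi_x[OF q] f by (metis UNIV_I homeomorphism_apply1)
    ultimately show ?thesis by (simp add: range_leaf_point)
  qed
  have "foliation (range leaf)"
    unfolding foliation_def
  proof (intro conjI ballI)
    have "halfspace \<subseteq> \<Union> (range leaf)"
    proof
      fix p :: "'a \<times> real" assume "p \<in> halfspace"
      then obtain t where "p \<in> leaf t" by (rule leaves_cover)
      then show "p \<in> \<Union> (range leaf)" by blast
    qed
    then show "\<Union> (range leaf) = halfspace" by (auto simp: leaf_def)
    show "disjoint (range leaf)" using leaves_disjoint by (auto simp: disjoint_def)
    show "L \<noteq> {}" "path_connected L" if "L \<in> range leaf" for L
      using that \<gamma>_in_leaf path_connected_tsphere by (auto simp: leaf_def)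
    show "\<exists>U g f. open U \<and> p \<in> U \<and> U \<subseteq> halfspace \<and> homeomorphism UNIV U g f \<and>
       (\<forall>s::real. patch (\<lambda>x. g (x, s))) \<and>
       (\<forall>L\<in>range leaf. \<forall>q\<in>L \<inter> U. path_component_set (L \<inter> U) q = range (\<lambda>x. g (x, snd (f q))))"
      if "p \<in> halfspace" for p
      using \<open>open halfspace\<close> that f leaf_point_patch comp
      by (intro exI[of _ halfspace] exI[of _ leaf_point] exI[of _ f]) auto
  qed
  then show ?thesis using leaf_umbilical by (auto simp: umbilical_foliation_def)
qed

lemma leaf_orthogonal: "orthogonal_at (leaf t) (\<gamma> t) (\<gamma>' t)"
  unfolding orthogonal_at_def
proof
  fix X assume "X \<in> tangent_space (leaf t) (\<gamma> t)"
  then obtain r x v where r: "patch_in r (leaf t)" "r x = \<gamma> t" and X: "X = D r x v"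
    unfolding tangent_space_def by blast
  from r have "smooth r" "r ` UNIV \<subseteq> tsphere t (h t)" by (auto simp: patch_in_def leaf_def patch_smooth)
  from gsphere_normal_orthogonal[OF this(1) open_UNIV UNIV_I this(2)[unfolded tsphere_def], of x v]
  have "\<gamma>' t \<bullet> D r x v = 0" using r(2) \<gamma>_height_pos[of t] by simp
  then show "hmetric (\<gamma> t) X (\<gamma>' t) = 0" unfolding X by (simp add: hmetric_def inner_commute)
qed

text \<open>The unit normal field extending \<open>- \<gamma>' t\<close> is the Euclidean normal of the sphere, scaled by the height.\<close>

lemma leaf_mean_curvature: "has_mean_curvature (leaf t) (\<gamma> t) (- \<gamma>' t) (h t)"
proof -
  let ?y = "snd (\<gamma> t)"
  let ?m = "- (1 / ?y) *\<^sub>R \<gamma>' t" and ?l = "(h t - snd (\<gamma>' t) / ?y) / ?y"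
  define r where "r x = leaf_point (x, t)" for x
  have r: "patch r" using leaf_point_patch by (simp add: r_def[abs_def])
  have rs: "range r \<subseteq> gsphere (\<gamma> t) ?m ?l"
    using leaf_point(1)[of _ t] by (auto simp: r_def leaf_def tsphere_def)
  have rL: "range r \<subseteq> leaf t" using leaf_point(1) by (auto simp: r_def)
  let ?M = "\<lambda>x. ?m + ?l *\<^sub>R (r x - \<gamma> t)"
  define N where "N x = snd (r x) *\<^sub>R ?M x" for x
  have M1: "?M x \<bullet> ?M x = 1" for x
    by (rule gsphere_normal_unit[OF tsphere_normal_unit subsetD[OF rs rangeI]])
  have "smooth (\<lambda>x. snd (r x) *\<^sub>R ?M x)"
    by (intro smooth_scaleR smooth_snd smooth_add smooth_diff smooth_const patch_smooth[OF r])
  then have "smooth N" by (simp add: N_def[abs_def])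
  moreover have "hmetric (r x) (N x) (N x) = 1" for x
  proof -
    have "N x \<bullet> N x = (snd (r x))\<^sup>2 * (?M x \<bullet> ?M x)"
      unfolding N_def inner_scaleR_left inner_scaleR_right by (simp only: power2_eq_square mult.assoc)
    then show ?thesis using patch_pos[OF r, of x] by (simp only: M1 hmetric_def) simp
  qed
  moreover have "hmetric (r x) (N x) (D r x v) = 0" for x v
  proof -
    have "?M x \<bullet> D r x v = 0"
      by (rule gsphere_normal_orthogonal[OF patch_smooth[OF r] open_UNIV UNIV_I rs])
    then show ?thesis unfolding N_def hmetric_def inner_scaleR_left by simp
  qed
  ultimately have N: "unit_normal_field r N" by (simp add: unit_normal_field_def)
  have r0: "r (fermi_x (\<gamma> t)) = \<gamma> t" using leaf_point_fermi_x[OF \<gamma>_in_leaf] by (simp add: r_def)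
  obtain s where s: "\<And>x. euclidean_normal r N x = s *\<^sub>R ?M x"
    "\<And>x. shape_eigenvalues r N x = {s * (?l * ?y - snd ?m)}"
    using gsphere_patch_umbilic[OF r N tsphere_normal_unit rs] by metis
  have "euclidean_normal r N x = ?M x" for x
    using patch_pos[OF r, of x] by (simp add: euclidean_normal_def N_def)
  then have "(s *\<^sub>R ?M 0) \<bullet> ?M 0 = 1" using s(1)[of 0] M1[of 0] by metis
  then have "s * (?M 0 \<bullet> ?M 0) = 1" unfolding inner_scaleR_left .
  then have "s = 1" unfolding M1 by simp
  moreover have "?l * ?y - snd ?m = h t" using \<gamma>_height_pos[of t] by simp
  ultimately have "shape_eigenvalues r N x = {h t}" for x using s(2)[of x] by simp
  moreover have "N (fermi_x (\<gamma> t)) = - \<gamma>' t" using \<gamma>_height_pos[of t] by (simp add: N_def r0)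
  moreover have "patch_in r (leaf t)" using r rL by (simp add: patch_in_def)
  ultimately show ?thesis unfolding has_mean_curvature_def using N r0 by blast
qed

lemma leaf_generalized_hypersphere: "generalized_hypersphere (leaf t)"
proof -
  have "((h t - snd (\<gamma>' t) / snd (\<gamma> t)) / snd (\<gamma> t)) * snd (\<gamma> t) - snd (- (1 / snd (\<gamma> t)) *\<^sub>R \<gamma>' t) = h t"
    using \<gamma>_height_pos[of t] by simp
  then show ?thesis
    unfolding leaf_def tsphere_def using bound
    by (intro generalized_hypersphere_gsphere tsphere_normal_unit \<gamma>_in) simp
qed

lemma leaves_umbilical_route: "umbilical_route h \<gamma>"
  unfolding umbilical_route_def \<gamma>_vector_derivative
  using leaf_generalized_hypersphere \<gamma>_in_leaf leaf_orthogonal leaf_mean_curvature leaves_foliation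
  by (intro exI[of _ leaf]) blast

end

end

theorem theorem2p2:
  fixes \<gamma> :: "real \<Rightarrow> 'a::euclidean_space \<times> real"
  assumes "geodesic_line \<gamma>"
  shows "(\<forall>\<F> h. umbilical_foliation \<F> \<and> orthogonal_foliation \<F> \<gamma> \<and>
             (\<forall>t. \<forall>L\<in>\<F>. \<gamma> t \<in> L \<longrightarrow>
                has_mean_curvature L (\<gamma> t) (- vector_derivative \<gamma> (at t)) (h t))
           \<longrightarrow> (\<forall>t. \<bar>h t\<bar> \<le> 1) \<and> (\<exists>t\<^sub>1 t\<^sub>2. route_condition h t\<^sub>1 t\<^sub>2))
       \<and> (\<forall>h. continuous_on UNIV h \<and> (\<forall>t. h t \<in> {-1..1}) \<and>
             (\<exists>t\<^sub>1 t\<^sub>2. route_condition h t\<^sub>1 t\<^sub>2)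
           \<longrightarrow> umbilical_route h \<gamma>)"
proof -
  obtain \<gamma>' A B E P where "fermi_frame \<gamma> \<gamma>' A B E P"
    using geodesic_line_fermi_frame[OF assms] by metis
  then interpret fermi_frame \<gamma> \<gamma>' A B E P .
  show ?thesis
  proof (intro conjI allI impI; elim conjE exE)
    fix F h t
    assume F: "umbilical_foliation F"
      and h: "\<forall>t. \<forall>L\<in>F. \<gamma> t \<in> L \<longrightarrow>
        has_mean_curvature L (\<gamma> t) (- vector_derivative \<gamma> (at t)) (h t)"
    have "(\<forall>t. \<bar>h t\<bar> \<le> 1) \<and> (\<exists>t1 t2. route_condition h t1 t2)"
      by (rule foliation_route_condition[OF F]) (use h in \<open>simp add: \<gamma>_vector_derivative\<close>)
    then show "\<bar>h t\<bar> \<le> 1" "\<exists>t\<^sub>1 t\<^sub>2. route_condition h t\<^sub>1 t\<^sub>2" by blast+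
  next
    fix h t1 t2
    assume h: "continuous_on UNIV h" "\<forall>t. h t \<in> {-1..1}" "route_condition h t1 t2"
    then have bound: "\<And>t. \<bar>h t\<bar> \<le> 1" by (simp add: abs_le_iff)
    show "umbilical_route h \<gamma>"
      by (rule leaves_umbilical_route[OF h(1) bound route_condition_imp_monotone_slopes[OF h(3) bound]])
  qed
qed

end
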